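(* Let $n\geq1$ be an integer and let $f:\Omega\to\mathbb{R}_m$ be a function. The following assertions are equivalent. \begin{itemize} \item[(a)] $f\in\mathcal{SM}^n(\Omega,\mathbb{R}_m)$, i.e., $f$ is global slice polymonogenic of order $n$. \item[(b)] $f\in\mathcal{S}^{n-1}(\Omega,\mathbb{R}_m)$, $f_*\in\mathscr{C}^n(\Omega_*,\mathbb{R}_m)$ and $f_*\in\ker(\overline{\vartheta}_m^{\,n})$. \item[(c)] $f\in\mathcal{S}^n(\Omega,\mathbb{R}_m)$ and $\overline{\partial}_I^{\,n} f_I=0$ on $\Omega_I$ for all $I\in\mathbb{S}^{m-1}$. \item[(c$'$)] $f\in\mathcal{S}^n(\Omega,\mathbb{R}_m)$ and $f_*\in\ker(\overline{\vartheta}_m^{\,n})$. \item[(c$''$)] $f\in\mathcal{S}^n(\Omega,\mathbb{R}_m)$ and $\big(\frac{\partial}{\partial x^c}\big)^nf=0$ on $\Omega$. \end{itemize}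
   Context: Fix an integer $m\geq2$. $\mathbb{R}_m=C\ell_{0,m}$ is the real Clifford algebra (of dimension $2^m$) generated by $e_1,\ldots,e_m$ with $e_j^2=-1$ and $e_je_k=-e_ke_j$ for $j\neq k$. $\mathbb{R}^{m+1}\subset\mathbb{R}_m$ is the subspace of paravectors $x=x_0+\sum_{j=1}^mx_je_j$, with $x_j\in\mathbb{R}$; $\mathrm{Im}(x)=\sum_{j=1}^mx_je_j$, $|\mathrm{Im}(x)|=(\sum_{j=1}^mx_j^2)^{1/2}$, $\overline{x}=x_0-\mathrm{Im}(x)$. $\mathbb{S}^{m-1}=\{x\in\mathbb{R}^{m+1}:x^2=-1\}$ and, for $I\in\mathbb{S}^{m-1}$, $\mathbb{C}_I=\{\alpha+I\beta:\alpha,\beta\in\mathbb{R}\}\subset\mathbb{R}^{m+1}$. A subset of $\mathbb{R}^{m+1}$ is circular if it has the form $\Omega_{m,E}=\{\alpha+I\beta:\alpha,\beta\in\mathbb{R},\ \alpha+i\beta\in E,\ I\in\mathbb{S}^{m-1}\}$ for some $E\subset\mathbb{C}$. Fixed throughout: $\Omega$ is a non-empty connected circular open subset of $\mathbb{R}^{m+1}$ with $\Omega\cap\mathbb{R}\neq\emptyset$, and $D\subset\mathbb{C}$ is the (non-empty, open, conjugation-invariant) set with $\Omega=\Omega_{m,D}$, i.e. $D=\{\alpha+i\beta:\alpha+I\beta\in\Omega\text{ for all }I\in\mathbb{S}^{m-1}\}$. Put $\Omega_I=\Omega\cap\mathbb{C}_I$, $\phi_I:D\to\Omega_I$, $\phi_I(\alpha+i\beta)=\alpha+I\beta$;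 $f_I=f|_{\Omega_I}$; $\Omega_*=\Omega\setminus\mathbb{R}$, $f_*=f|_{\Omega_*}$. For an open $O\subset\mathbb{R}^{m+1}$, $\mathscr{C}^n(O,\mathbb{R}_m)$ is the set of functions $O\to\mathbb{R}_m$ of class $\mathscr{C}^n$ in the real sense ($n=0$: continuous). For $n\geq1$ and $g:\Omega_I\to\mathbb{R}_m$ with $g\circ\phi_I$ of class $\mathscr{C}^n$, $\overline{\partial}_I^{\,n} g(x)=\frac1{2^n}\Big(\big(\frac{\partial}{\partial\alpha}+I\frac{\partial}{\partial\beta}\big)^n(g\circ\phi_I)\Big)(\phi_I^{-1}(x))$, and $\overline{\partial}_I=\overline{\partial}_I^{\,1}$. $\mathcal{SM}(\Omega,\mathbb{R}_m)$ (slice monogenic functions) is the set of $f\in\mathscr{C}^1(\Omega,\mathbb{R}_m)$ with $\overline{\partial}_I f_I=0$ on $\Omega_I$ for all $I\in\mathbb{S}^{m-1}$. $\mathcal{SM}^n(\Omega,\mathbb{R}_m)$ (global slice polymonogenic functions of order $n$) is the set of $f:\Omega\to\mathbb{R}_m$ for which there exist $f_0,\ldots,f_{n-1}\in\mathcal{SM}(\Omega,\mathbb{R}_m)$ with $f(x)=\sum_{h=0}^{n-1}\overline{x}^hf_h(x)$ for all $x\in\Omega$. The operator $\overline{\vartheta}_m$, sending $\mathscr{C}^k(\Omega_*,\mathbb{R}_m)$ to $\mathscr{C}^{k-1}(\Omega_*,\mathbb{R}_m)$ for $k\geq1$, is $$\overline{\vartheta}_m=\frac12\Big(\frac{\partial}{\partial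 x_0}+\frac{\mathrm{Im}(x)}{|\mathrm{Im}(x)|^2}\sum_{h=1}^mx_h\frac{\partial}{\partial x_h}\Big)$$ (Clifford factors multiply on the left), and $\overline{\vartheta}_m^{\,n}:\mathscr{C}^n(\Omega_*,\mathbb{R}_m)\to\mathscr{C}^0(\Omega_*,\mathbb{R}_m)$ is its $n$-fold composition. A stem function is $F=F_1+iF_2:D\to\mathbb{R}_m\otimes_{\mathbb{R}}\mathbb{C}$ ($F_1,F_2:D\to\mathbb{R}_m$) with $F_1(\overline z)=F_1(z)$, $F_2(\overline z)=-F_2(z)$. It induces the slice function $f=\mathcal{I}(F):\Omega\to\mathbb{R}_m$, $f(\alpha+I\beta)=F_1(\alpha+i\beta)+IF_2(\alpha+i\beta)$ for all $\alpha+i\beta\in D$, $I\in\mathbb{S}^{m-1}$; $F$ is uniquely determined by $f$. For $n\geq0$, $\mathcal{S}^n(\Omega,\mathbb{R}_m)$ is the set of slice functions induced by stem functions with $F_1,F_2$ of class $\mathscr{C}^n$ (continuous if $n=0$). For a $\mathscr{C}^1$ stem function, $\frac{\partial F}{\partial\overline z}=\frac12\Big(\big(\frac{\partial F_1}{\partial\alpha}-\frac{\partial F_2}{\partial\beta}\big)+i\big(\frac{\partial F_1}{\partial\beta}+\frac{\partial F_2}{\partial\alpha}\big)\Big)$ (again a stem function), $\frac{\partial^n F}{\partial\overline z^n}$ is its $n$-fold iterate, and for $f=\mathcal{I}(F)\in\mathcal{S}^n(\Omega,\mathbb{R}_m)$, $\big(\frac{\partial}{\partial x^c}\big)^nf=\mathcal{I}\big(\frac{\partial^nF}{\partial\overline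 z^n}\big)$. If $f\in\mathcal{S}^n(\Omega,\mathbb{R}_m)$ then $f_I\circ\phi_I$ is $\mathscr{C}^n$ for all $I$ and $f_*\in\mathscr{C}^n(\Omega_*,\mathbb{R}_m)$, so the expressions above make sense. *)

theory Defs
  imports "HOL-Analysis.Analysis"
begin

section \<open>The real Clifford algebra of signature (0,m)\<close>

text \<open>
  The dimension m is the cardinality of the linearly ordered index type \<open>'m\<close>, which labels the
  generators. An element is given by its coordinates in the basis of the ordered products
  e_A = e_{a1} ... e_{ak}, where A = {a1 < ... < ak} ranges over the subsets of \<open>'m\<close>.
  The topology is that of the Euclidean norm of the coordinates; this norm is not submultiplicative,
  so the type is not an instance of \<^class>\<open>real_normed_algebra\<close>.
\<close>

typedef 'm clifford = "UNIV :: ('m set \<Rightarrow> real) set"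
  morphisms coord Clifford
  by simp

lemmas coord_Clifford [simp] = Clifford_inverse[OF UNIV_I]

lemma clifford_eq_iff: "x = y \<longleftrightarrow> (\<forall>A. coord x A = coord y A)"
  by (metis coord_inject ext)

text \<open>
  The sign in e_A e_B = blade_sign A B e_C, with C the symmetric difference of A and B: a pair
  b < a contributes -1 from e_a e_b = - e_b e_a, and b = a contributes -1 from e_a e_a = -1.
\<close>

definition blade_sign :: "'m::{finite,linorder} set \<Rightarrow> 'm set \<Rightarrow> real" where
  "blade_sign A B = (\<Prod>a\<in>A. \<Prod>b\<in>B. if b \<le> a then - 1 else 1)"

lemma prod_sym_diff:
  fixes g :: "'a::finite \<Rightarrow> real"
  assumes "\<And>a. g a * g a = 1"
  shows "prod g (sym_diff A B) = prod g A * prod g B"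
proof -
  have A: "prod g A = prod g (A - B) * prod g (A \<inter> B)"
    by (subst prod.union_disjoint[symmetric]) (auto intro: prod.cong)
  have B: "prod g B = prod g (B - A) * prod g (A \<inter> B)"
    by (subst prod.union_disjoint[symmetric]) (auto intro: prod.cong)
  have "prod g (A \<inter> B) * prod g (A \<inter> B) = 1"
    by (simp add: prod.distrib[symmetric] assms)
  moreover have "prod g (sym_diff A B) = prod g (A - B) * prod g (B - A)"
    by (subst prod.union_disjoint) auto
  ultimately show ?thesis unfolding A B
    by (metis (no_types, lifting) mult.assoc mult.commute mult.right_neutral)
qed

lemma blade_sign_sq [simp]: "blade_sign A B * blade_sign A B = 1"
proof -
  have "(\<Prod>b\<in>B. if b \<le> a then - 1 else 1) * (\<Prod>b\<in>B. if b \<le> a then - 1 else (1::real)) = 1" for a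
    by (subst prod.distrib[symmetric], rule prod.neutral) auto
  then show ?thesis
    unfolding blade_sign_def by (subst prod.distrib[symmetric]) simp
qed

lemma blade_sign_sym_diff_left:
  "blade_sign (sym_diff A B) C = blade_sign A C * blade_sign B C"
  unfolding blade_sign_def
  by (rule prod_sym_diff) (subst prod.distrib[symmetric], rule prod.neutral, auto)

lemma blade_sign_sym_diff_right:
  "blade_sign A (sym_diff B C) = blade_sign A B * blade_sign A C"
proof -
  have "blade_sign A (sym_diff B C) =
      (\<Prod>a\<in>A. (\<Prod>b\<in>B. if b \<le> a then - 1 else 1) * (\<Prod>b\<in>C. if b \<le> a then - 1 else (1::real)))"
    unfolding blade_sign_def by (rule prod.cong[OF refl], rule prod_sym_diff) auto
  then show ?thesis
    by (simp add: blade_sign_def prod.distrib)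
qed

lemma blade_sign_empty [simp]: "blade_sign {} B = 1" "blade_sign A {} = 1"
  by (simp_all add: blade_sign_def)

lemma blade_sign_cocycle:
  "blade_sign A (sym_diff A B) * blade_sign B (sym_diff B D) =
   blade_sign A (sym_diff A D) * blade_sign (sym_diff A B) (sym_diff B D)"
proof -
  have "blade_sign A D * blade_sign A D = 1" by simp
  then show ?thesis
    unfolding blade_sign_sym_diff_left blade_sign_sym_diff_right
    by (metis (no_types, lifting) mult.assoc mult.commute mult.right_neutral)
qed

lemma sym_diff_cancel [simp]: "sym_diff A (sym_diff A B) = (B::'a set)"
  by blast

lemma bij_sym_diff: "bij (\<lambda>C. sym_diff (A::'a set) C)"
  by (rule involuntory_imp_bij) (rule sym_diff_cancel)

lemma sum_sym_diff:
  fixes g :: "'a::finite set \<Rightarrow> real"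
  shows "(\<Sum>C\<in>UNIV. g C) = (\<Sum>B\<in>UNIV. g (sym_diff A B))"
  using sum.reindex_bij_betw[OF bij_sym_diff, of g A] by simp

instantiation clifford :: (type) real_vector
begin

definition zero_clifford_def: "0 = Clifford (\<lambda>A. 0)"
definition plus_clifford_def: "x + y = Clifford (\<lambda>A. coord x A + coord y A)"
definition uminus_clifford_def: "- x = Clifford (\<lambda>A. - coord x A)"
definition minus_clifford_def: "x - y = Clifford (\<lambda>A. coord x A - coord y A)"
definition scaleR_clifford_def: "r *\<^sub>R x = Clifford (\<lambda>A. r * coord x A)"

instance
  by standard
    (simp_all add: clifford_eq_iff zero_clifford_def plus_clifford_def uminus_clifford_def
      minus_clifford_def scaleR_clifford_def algebra_simps)

end

lemma coord_zero [simp]: "coord 0 A = 0"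
  and coord_add [simp]: "coord (x + y) A = coord x A + coord y A"
  and coord_uminus [simp]: "coord (- x) A = - coord x A"
  and coord_diff [simp]: "coord (x - y) A = coord x A - coord y A"
  and coord_scaleR [simp]: "coord (r *\<^sub>R x) A = r * coord x A"
  by (simp_all add: zero_clifford_def plus_clifford_def uminus_clifford_def
      minus_clifford_def scaleR_clifford_def)

lemma coord_sum [simp]: "coord (sum f S) A = (\<Sum>i\<in>S. coord (f i) A)"
  by (induction S rule: infinite_finite_induct) auto

definition blade :: "'m set \<Rightarrow> 'm clifford" where
  "blade A = Clifford (\<lambda>B. if B = A then 1 else 0)"

abbreviation gen :: "'m \<Rightarrow> 'm clifford" where
  "gen j \<equiv> blade {j}"

lemma coord_blade [simp]: "coord (blade A) B = (if B = A then 1 else 0)"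
  by (simp add: blade_def)

instantiation clifford :: ("{finite,linorder}") real_algebra_1
begin

definition one_clifford_def: "1 = blade {}"

definition times_clifford_def:
  "x * y = Clifford (\<lambda>C. \<Sum>A\<in>UNIV. blade_sign A (sym_diff A C) * coord x A * coord y (sym_diff A C))"

instance
proof
  fix x y z :: "'a clifford" and r :: real
  show "x * y * z = x * (y * z)"
  proof (unfold clifford_eq_iff, intro allI)
    fix D
    have "coord (x * y * z) D =
        (\<Sum>B\<in>UNIV. \<Sum>A\<in>UNIV. (blade_sign A (sym_diff A B) * blade_sign B (sym_diff B D)) *
          (coord x A * coord y (sym_diff A B) * coord z (sym_diff B D)))"
      by (simp add: times_clifford_def sum_distrib_left sum_distrib_right mult_ac
          del: sym_diff_cancel)
    also have "\<dots> =
        (\<Sum>A\<in>UNIV. \<Sum>B\<in>UNIV. (blade_sign A (sym_diff A B) * blade_sign B (sym_diff B D)) *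
          (coord x A * coord y (sym_diff A B) * coord z (sym_diff B D)))"
      by (rule sum.swap)
    also have "\<dots> =
        (\<Sum>A\<in>UNIV. \<Sum>B\<in>UNIV. (blade_sign A (sym_diff A D) * blade_sign (sym_diff A B) (sym_diff B D)) *
          (coord x A * coord y (sym_diff A B) * coord z (sym_diff B D)))"
      by (simp only: blade_sign_cocycle)
    also have "\<dots> = coord (x * (y * z)) D"
    proof -
      have eq: "sym_diff (sym_diff A B) (sym_diff A D) = sym_diff B D" for A B :: "'a set"
        by blast
      have "coord (x * (y * z)) D =
        (\<Sum>A\<in>UNIV. blade_sign A (sym_diff A D) * coord x A *
          (\<Sum>C\<in>UNIV. blade_sign C (sym_diff C (sym_diff A D)) * coord y C *
            coord z (sym_diff C (sym_diff A D))))"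
        by (simp only: times_clifford_def coord_Clifford)
      also have "\<dots> =
        (\<Sum>A\<in>UNIV. blade_sign A (sym_diff A D) * coord x A *
          (\<Sum>B\<in>UNIV. blade_sign (sym_diff A B) (sym_diff B D) * coord y (sym_diff A B) *
            coord z (sym_diff B D)))"
      proof (rule sum.cong[OF refl])
        fix A :: "'a set"
        show "blade_sign A (sym_diff A D) * coord x A *
          (\<Sum>C\<in>UNIV. blade_sign C (sym_diff C (sym_diff A D)) * coord y C *
            coord z (sym_diff C (sym_diff A D))) =
          blade_sign A (sym_diff A D) * coord x A *
          (\<Sum>B\<in>UNIV. blade_sign (sym_diff A B) (sym_diff B D) * coord y (sym_diff A B) *
            coord z (sym_diff B D))"
          by (subst sum_sym_diff[of _ A]) (simp only: eq)
      qed
      finally show ?thesis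
        by (simp add: sum_distrib_left mult_ac)
    qed
    finally show "coord (x * y * z) D = coord (x * (y * z)) D" .
  qed
  show "1 * x = x"
  proof (unfold clifford_eq_iff, intro allI)
    fix C
    have "coord (1 * x) C = (\<Sum>A::'a set\<in>UNIV. if A = {} then coord x C else 0)"
      unfolding times_clifford_def one_clifford_def coord_Clifford
      by (rule sum.cong) auto
    then show "coord (1 * x) C = coord x C" by simp
  qed
  show "x * 1 = x"
  proof (unfold clifford_eq_iff, intro allI)
    fix C
    have "coord (x * 1) C = (\<Sum>A\<in>UNIV. if A = C then coord x C else 0)"
      unfolding times_clifford_def one_clifford_def coord_Clifford
      by (rule sum.cong) auto
    then show "coord (x * 1) C = coord x C" by simp
  qed
  show "(x + y) * z = x * z + y * z" "x * (y + z) = x * y + x * z"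
    by (simp_all add: clifford_eq_iff times_clifford_def algebra_simps sum.distrib)
  show "r *\<^sub>R x * y = r *\<^sub>R (x * y)" "x * r *\<^sub>R y = r *\<^sub>R (x * y)"
    by (simp_all add: clifford_eq_iff times_clifford_def sum_distrib_left mult_ac)
  show "(0::'a clifford) \<noteq> 1"
    by (auto simp: clifford_eq_iff one_clifford_def)
qed

end

lemma blade_mult: "blade A * blade B = blade_sign A B *\<^sub>R blade (sym_diff A B)"
proof (unfold clifford_eq_iff, intro allI)
  fix C
  have "coord (blade A * blade B) C =
      (\<Sum>A'\<in>UNIV. if A' = A then (if sym_diff A C = B then blade_sign A B else 0) else 0)"
    unfolding times_clifford_def coord_Clifford by (rule sum.cong) auto
  also have "\<dots> = (if C = sym_diff A B then blade_sign A B else 0)"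
    by auto
  finally show "coord (blade A * blade B) C = coord (blade_sign A B *\<^sub>R blade (sym_diff A B)) C"
    by simp
qed

lemma gen_mult_self: "gen j * gen j = - 1"
  by (simp add: blade_mult blade_sign_def one_clifford_def)

lemma gen_anticommute: "j \<noteq> k \<Longrightarrow> gen j * gen k = - (gen k * gen j)"
  by (cases "j < k") (auto simp: blade_mult blade_sign_def insert_Diff_if insert_commute)

lemma gen_mult_blade:
  assumes "\<And>a. a \<in> A \<Longrightarrow> j < a"
  shows "gen j * blade A = blade (insert j A)"
proof -
  have "blade_sign {j} A = 1"
    using assms by (auto simp: blade_sign_def not_le intro!: prod.neutral)
  moreover have "sym_diff {j} A = insert j A"
    using assms by auto
  ultimately show ?thesis by (simp add: blade_mult)
qed

lemma blade_eq_prod_list: "blade A = prod_list (map gen (sorted_list_of_set A))"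
proof -
  have "sorted_wrt (<) xs \<Longrightarrow> blade (set xs) = prod_list (map gen xs)" for xs :: "'a list"
    by (induction xs) (auto simp: one_clifford_def gen_mult_blade[symmetric])
  from this[of "sorted_list_of_set A"] show ?thesis by simp
qed

instantiation clifford :: (finite) euclidean_space
begin

definition inner_clifford_def: "inner x y = (\<Sum>A\<in>UNIV. coord x A * coord y A)"
definition norm_clifford_def: "norm (x::'a clifford) = sqrt (inner x x)"
definition sgn_clifford_def: "sgn (x::'a clifford) = x /\<^sub>R norm x"
definition dist_clifford_def: "dist (x::'a clifford) y = norm (x - y)"
definition uniformity_clifford_def [code del]:
  "(uniformity :: ('a clifford \<times> 'a clifford) filter) =
    (INF e\<in>{0 <..}. principal {(x, y). dist x y < e})"
definition open_clifford_def [code del]: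
  "open (U :: 'a clifford set) \<longleftrightarrow>
    (\<forall>x\<in>U. eventually (\<lambda>(x', y). x' = x \<longrightarrow> y \<in> U) uniformity)"
definition Basis_clifford_def: "Basis = range blade"

instance
proof
  fix x y z :: "'a clifford" and r :: real and U :: "'a clifford set"
  show "dist x y = norm (x - y)" by (rule dist_clifford_def)
  show "sgn x = x /\<^sub>R norm x" by (rule sgn_clifford_def)
  show "(uniformity :: ('a clifford \<times> 'a clifford) filter) =
    (INF e\<in>{0 <..}. principal {(x, y). dist x y < e})" by (rule uniformity_clifford_def)
  show "open U \<longleftrightarrow> (\<forall>x\<in>U. eventually (\<lambda>(x', y). x' = x \<longrightarrow> y \<in> U) uniformity)"
    by (rule open_clifford_def)
  show "inner x y = inner y x" by (simp add: inner_clifford_def mult.commute)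
  show "inner (x + y) z = inner x z + inner y z"
    by (simp add: inner_clifford_def algebra_simps sum.distrib)
  show "inner (r *\<^sub>R x) y = r * inner x y"
    by (simp add: inner_clifford_def sum_distrib_left mult_ac)
  show "0 \<le> inner x x" by (simp add: inner_clifford_def sum_nonneg)
  show "inner x x = 0 \<longleftrightarrow> x = 0"
    by (simp add: inner_clifford_def clifford_eq_iff sum_nonneg_eq_0_iff)
  show "norm x = sqrt (inner x x)" by (rule norm_clifford_def)
  have inner_blade: "inner u (blade A) = coord u A" for u :: "'a clifford" and A
    unfolding inner_clifford_def coord_blade by (simp add: if_distrib cong: if_cong)
  show "(Basis :: 'a clifford set) \<noteq> {}" "finite (Basis :: 'a clifford set)"
    by (simp_all add: Basis_clifford_def)
  show "u \<in> Basis \<Longrightarrow> v \<in> Basis \<Longrightarrow> inner u v = (if u = v then 1 else 0)" for u v :: "'a clifford"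
    by (auto simp: Basis_clifford_def inner_blade clifford_eq_iff)
  show "(\<forall>u\<in>Basis. inner x u = 0) \<longleftrightarrow> x = 0"
    by (auto simp: Basis_clifford_def inner_blade clifford_eq_iff)
qed

end

lemma DIM_clifford: "DIM('m::finite clifford) = 2 ^ CARD('m)"
proof -
  have "inj (blade :: 'm set \<Rightarrow> _)"
    by (rule injI) (metis coord_blade zero_neq_one)
  then show ?thesis
    by (simp add: Basis_clifford_def card_image card_UNIV_set)
qed


section \<open>Paravectors and circular sets\<close>

definition paravec_basis :: "'m::{finite,linorder} clifford set" where
  "paravec_basis = insert 1 (range gen)"

definition paravectors :: "'m::{finite,linorder} clifford set" where
  "paravectors = {of_real x0 + (\<Sum>j\<in>UNIV. x j *\<^sub>R gen j) | x0 x. True}"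

definition Im_part :: "'m::{finite,linorder} clifford \<Rightarrow> 'm clifford" where
  "Im_part x = (\<Sum>j\<in>UNIV. coord x {j} *\<^sub>R gen j)"

definition conj_paravec :: "'m::{finite,linorder} clifford \<Rightarrow> 'm clifford" where
  "conj_paravec x = of_real (coord x {}) - Im_part x"

definition imag_sphere :: "'m::{finite,linorder} clifford set" where
  "imag_sphere = {x \<in> paravectors. x\<^sup>2 = - 1}"

definition phi :: "'m::{finite,linorder} clifford \<Rightarrow> complex \<Rightarrow> 'm clifford" where
  "phi I z = of_real (Re z) + I * of_real (Im z)"

definition slice_plane :: "'m::{finite,linorder} clifford \<Rightarrow> 'm clifford set" where
  "slice_plane I = range (phi I)"

definition circularization :: "complex set \<Rightarrow> 'm::{finite,linorder} clifford set" where
  "circularization E = {phi I z | I z. z \<in> E \<and> I \<in> imag_sphere}"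

definition circular :: "'m::{finite,linorder} clifford set \<Rightarrow> bool" where
  "circular \<Omega> \<longleftrightarrow> (\<exists>E. \<Omega> = circularization E)"

definition profile :: "'m::{finite,linorder} clifford set \<Rightarrow> complex set" where
  "profile \<Omega> = {z. \<forall>I\<in>imag_sphere. phi I z \<in> \<Omega>}"


section \<open>Partial derivatives and classes of differentiability\<close>

text \<open>
  A function on a subset \<open>U\<close> is represented by a total function. Everything below only involves its
  values on \<open>U\<close>: derivatives are taken along the directions of a basis \<open>B\<close> of a linear subspace in
  which \<open>U\<close> is relatively open.
\<close>

definition partial :: "'a::real_normed_vector \<Rightarrow> ('a \<Rightarrow> 'b::real_normed_vector) \<Rightarrow> 'a \<Rightarrow> 'b" where
  "partial v f x = vector_derivative (\<lambda>t. f (x + t *\<^sub>R v)) (at 0)"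

primrec Ck_on :: "'a::real_normed_vector set \<Rightarrow> nat \<Rightarrow> 'a set \<Rightarrow>
    ('a \<Rightarrow> 'b::real_normed_vector) \<Rightarrow> bool" where
  "Ck_on B 0 U f \<longleftrightarrow> continuous_on U f"
| "Ck_on B (Suc n) U f \<longleftrightarrow> continuous_on U f \<and>
     (\<forall>v\<in>B. (\<forall>x\<in>U. (\<lambda>t. f (x + t *\<^sub>R v)) differentiable (at 0)) \<and> Ck_on B n U (partial v f))"

abbreviation Ck_complex :: "nat \<Rightarrow> complex set \<Rightarrow> (complex \<Rightarrow> 'b::real_normed_vector) \<Rightarrow> bool" where
  "Ck_complex \<equiv> Ck_on {1, \<i>}"

definition Ck_paravec :: "nat \<Rightarrow> 'm::{finite,linorder} clifford set \<Rightarrow>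
    ('m clifford \<Rightarrow> 'm clifford) set" where
  "Ck_paravec n U = {f. Ck_on paravec_basis n U f}"


section \<open>Slice monogenic and global slice polymonogenic functions\<close>

definition dbar_slice :: "nat \<Rightarrow> 'm::{finite,linorder} clifford \<Rightarrow> 'm clifford set \<Rightarrow>
    ('m clifford \<Rightarrow> 'm clifford) \<Rightarrow> 'm clifford \<Rightarrow> 'm clifford" where
  "dbar_slice n I \<Omega> g x =
     (1 / 2 ^ n) *\<^sub>R ((\<lambda>G z. partial 1 G z + I * partial \<i> G z) ^^ n) (g \<circ> phi I)
       (inv_into (profile \<Omega>) (phi I) x)"

definition slice_monogenic :: "'m::{finite,linorder} clifford set \<Rightarrow>
    ('m clifford \<Rightarrow> 'm clifford) set" where
  "slice_monogenic \<Omega> = {f \<in> Ck_paravec 1 \<Omega>.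
     \<forall>I\<in>imag_sphere. \<forall>x\<in>\<Omega> \<inter> slice_plane I. dbar_slice 1 I \<Omega> f x = 0}"

definition slice_polymonogenic :: "nat \<Rightarrow> 'm::{finite,linorder} clifford set \<Rightarrow>
    ('m clifford \<Rightarrow> 'm clifford) set" where
  "slice_polymonogenic n \<Omega> = {f. \<exists>fs :: nat \<Rightarrow> 'm clifford \<Rightarrow> 'm clifford.
     (\<forall>h<n. fs h \<in> slice_monogenic \<Omega>) \<and>
     (\<forall>x\<in>\<Omega>. f x = (\<Sum>h<n. conj_paravec x ^ h * fs h x))}"


section \<open>The global operator\<close>

definition theta_bar :: "('m::{finite,linorder} clifford \<Rightarrow> 'm clifford) \<Rightarrow>
    'm clifford \<Rightarrow> 'm clifford" where
  "theta_bar f x = (1 / 2) *\<^sub>R (partial 1 f x +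
     (Im_part x /\<^sub>R (norm (Im_part x))\<^sup>2) * (\<Sum>h\<in>UNIV. coord x {h} *\<^sub>R partial (gen h) f x))"

definition ker_theta_bar :: "nat \<Rightarrow> 'm::{finite,linorder} clifford set \<Rightarrow>
    ('m clifford \<Rightarrow> 'm clifford) set" where
  "ker_theta_bar n U = {f \<in> Ck_paravec n U. \<forall>x\<in>U. (theta_bar ^^ n) f x = 0}"


section \<open>Slice functions\<close>

text \<open>The element F1 + i F2 of the complexified Clifford algebra is represented by the pair (F1, F2).\<close>

definition stem_function :: "'m::{finite,linorder} clifford set \<Rightarrow>
    (complex \<Rightarrow> 'm clifford \<times> 'm clifford) \<Rightarrow> bool" where
  "stem_function \<Omega> F \<longleftrightarrow>
     (\<forall>z\<in>profile \<Omega>. fst (F (cnj z)) = fst (F z) \<and> snd (F (cnj z)) = - snd (F z))"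

definition induces :: "'m::{finite,linorder} clifford set \<Rightarrow>
    (complex \<Rightarrow> 'm clifford \<times> 'm clifford) \<Rightarrow> ('m clifford \<Rightarrow> 'm clifford) \<Rightarrow> bool" where
  "induces \<Omega> F f \<longleftrightarrow>
     (\<forall>z\<in>profile \<Omega>. \<forall>I\<in>imag_sphere. f (phi I z) = fst (F z) + I * snd (F z))"

definition slice_functions :: "nat \<Rightarrow> 'm::{finite,linorder} clifford set \<Rightarrow>
    ('m clifford \<Rightarrow> 'm clifford) set" where
  "slice_functions n \<Omega> = {f. \<exists>F. stem_function \<Omega> F \<and> induces \<Omega> F f \<and>
     Ck_complex n (profile \<Omega>) (\<lambda>z. fst (F z)) \<and> Ck_complex n (profile \<Omega>) (\<lambda>z. snd (F z))}"

definition dbar_stem :: "(complex \<Rightarrow> 'm::{finite,linorder} clifford \<times> 'm clifford) \<Rightarrow>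
    complex \<Rightarrow> 'm clifford \<times> 'm clifford" where
  "dbar_stem F z =
     ((1 / 2) *\<^sub>R (partial 1 (\<lambda>w. fst (F w)) z - partial \<i> (\<lambda>w. snd (F w)) z),
      (1 / 2) *\<^sub>R (partial \<i> (\<lambda>w. fst (F w)) z + partial 1 (\<lambda>w. snd (F w)) z))"

text \<open>
  A stem function determines the slice function it induces on a circular set, and conversely;
  this justifies the choices below (see \<open>induces_unique\<close>, \<open>induces_slice_fun_of\<close> and \<open>stem_unique\<close>).
\<close>

definition slice_fun_of :: "'m::{finite,linorder} clifford set \<Rightarrow>
    (complex \<Rightarrow> 'm clifford \<times> 'm clifford) \<Rightarrow> 'm clifford \<Rightarrow> 'm clifford" where
  "slice_fun_of \<Omega> F = (SOME f. induces \<Omega> F f)"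

definition stem_of :: "'m::{finite,linorder} clifford set \<Rightarrow> ('m clifford \<Rightarrow> 'm clifford) \<Rightarrow>
    complex \<Rightarrow> 'm clifford \<times> 'm clifford" where
  "stem_of \<Omega> f = (SOME F. stem_function \<Omega> F \<and> induces \<Omega> F f)"

definition dbar_slice_fun :: "nat \<Rightarrow> 'm::{finite,linorder} clifford set \<Rightarrow>
    ('m clifford \<Rightarrow> 'm clifford) \<Rightarrow> 'm clifford \<Rightarrow> 'm clifford" where
  "dbar_slice_fun n \<Omega> f = slice_fun_of \<Omega> ((dbar_stem ^^ n) (stem_of \<Omega> f))"

lemma coord_of_real: "coord (of_real r) A = (if A = {} then r else 0)"
  by (simp add: of_real_def one_clifford_def)

lemma paravectors_iff: "x \<in> paravectors \<longleftrightarrow> x = of_real (coord x {}) + Im_part x"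
proof
  assume "x \<in> paravectors"
  then obtain x0 y where x: "x = of_real x0 + (\<Sum>j\<in>UNIV. y j *\<^sub>R gen j)"
    by (auto simp: paravectors_def)
  have "coord x {} = x0"
    by (simp add: x coord_of_real)
  moreover have "coord x {k} = y k" for k
    by (simp add: x coord_of_real if_distrib cong: if_cong)
  ultimately show "x = of_real (coord x {}) + Im_part x"
    by (simp add: x Im_part_def)
next
  assume "x = of_real (coord x {}) + Im_part x"
  then show "x \<in> paravectors"
    unfolding paravectors_def Im_part_def
    by (intro CollectI exI[of _ "coord x {}"] exI[of _ "\<lambda>j. coord x {j}"]) simp
qed

lemma coord_Im_part: "coord (Im_part x) {} = 0" "coord (Im_part x) {k} = coord x {k}"
  by (simp_all add: Im_part_def if_distrib cong: if_cong)

lemma Im_part_sq: "Im_part x * Im_part x = - of_real (\<Sum>j\<in>UNIV. (coord x {j})\<^sup>2)"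
proof -
  let ?x = "\<lambda>j. coord x {j}"
  define S where "S = (\<Sum>j\<in>UNIV. \<Sum>k\<in>UNIV. (?x j * ?x k) *\<^sub>R (gen j * gen k))"
  have S: "Im_part x * Im_part x = S"
    by (simp add: S_def Im_part_def sum_product mult.commute)
  have S': "S = (\<Sum>j\<in>UNIV. \<Sum>k\<in>UNIV. (?x j * ?x k) *\<^sub>R (gen k * gen j))"
    unfolding S_def by (subst sum.swap) (simp add: mult.commute)
  have anti: "gen j * gen k + gen k * gen j = (if k = j then (- 2) *\<^sub>R 1 else 0)" for j k :: 'a
    using gen_anticommute[of j k] by (auto simp: gen_mult_self scaleR_2)
  have "2 *\<^sub>R S = S + S" by (rule scaleR_2)
  also have "\<dots> = (\<Sum>j\<in>UNIV. \<Sum>k\<in>UNIV. (?x j * ?x k) *\<^sub>R (gen j * gen k + gen k * gen j))"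
    by (subst (2) S') (simp add: S_def sum.distrib scaleR_add_right)
  also have "\<dots> = (\<Sum>j\<in>UNIV. (?x j * ?x j) *\<^sub>R ((- 2) *\<^sub>R 1))"
    unfolding anti by (rule sum.cong[OF refl]) (simp add: if_distrib cong: if_cong)
  also have "\<dots> = (\<Sum>j\<in>UNIV. (- 2) * (?x j)\<^sup>2) *\<^sub>R 1"
    unfolding scaleR_sum_left by (rule sum.cong[OF refl]) (simp add: power2_eq_square mult.commute)
  also have "\<dots> = 2 *\<^sub>R (- of_real (\<Sum>j\<in>UNIV. (?x j)\<^sup>2))"
    unfolding of_real_def sum_distrib_left[symmetric] by simp
  finally show ?thesis unfolding S scaleR_cancel_left by simp
qed

lemma imag_sphere_iff:
  "I \<in> imag_sphere \<longleftrightarrow> I = Im_part I \<and> (\<Sum>j\<in>UNIV. (coord I {j})\<^sup>2) = 1"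
proof
  assume I: "I \<in> imag_sphere"
  let ?a = "coord I {}" and ?v = "Im_part I" and ?s = "\<Sum>j\<in>UNIV. (coord I {j})\<^sup>2"
  have eq: "I = of_real ?a + ?v" and "I * I = - 1"
    using I by (auto simp: imag_sphere_def paravectors_iff power2_eq_square)
  then have sq: "(of_real ?a + ?v) * (of_real ?a + ?v) = - 1" by metis
  have expand: "(of_real ?a + ?v) * (of_real ?a + ?v) =
      of_real (?a * ?a - ?s) + (2 * ?a) *\<^sub>R ?v"
    by (simp add: algebra_simps Im_part_sq of_real_def scaleR_2[symmetric])
  have "coord ((of_real ?a + ?v) * (of_real ?a + ?v)) A = coord (- 1) A" for A
    by (simp only: sq)
  then have c: "coord (of_real (?a * ?a - ?s) + (2 * ?a) *\<^sub>R ?v) A = coord (- 1) A" for A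
    by (simp only: expand)
  have c0: "?a * ?a - ?s = - 1"
    using c[of "{}"]
    by (simp add: coord_of_real coord_Im_part one_clifford_def
        del: of_real_diff of_real_mult of_real_sum)
  have "?a * coord I {j} = 0" for j
    using c[of "{j}"]
    by (simp add: coord_of_real coord_Im_part one_clifford_def
        del: of_real_diff of_real_mult of_real_sum)
  then have "?a = 0"
  proof (cases "?a = 0")
    case False
    then have "coord I {j} = 0" for j using \<open>?a * coord I {j} = 0\<close> by simp
    then have "?s = 0" by simp
    with c0 show ?thesis using zero_le_square[of ?a] by linarith
  qed
  then show "I = ?v \<and> ?s = 1"
    using eq c0 by simp
next
  assume I: "I = Im_part I \<and> (\<Sum>j\<in>UNIV. (coord I {j})\<^sup>2) = 1"
  then have "coord I {} = 0" by (metis coord_Im_part(1))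
  moreover have "I * I = - 1" using I Im_part_sq[of I] by simp
  ultimately show "I \<in> imag_sphere"
    using I by (simp add: imag_sphere_def paravectors_iff power2_eq_square)
qed

lemma imag_sphere_uminus: "I \<in> imag_sphere \<Longrightarrow> - I \<in> imag_sphere"
  by (simp add: imag_sphere_iff Im_part_def sum_negf)

lemma gen_in_imag_sphere: "gen j \<in> imag_sphere"
proof -
  have "gen j = of_real 0 + (\<Sum>k\<in>UNIV. (if k = j then 1 else 0) *\<^sub>R gen k)"
    by (simp add: if_distrib[of "\<lambda>r. r *\<^sub>R _"] cong: if_cong)
  then have "gen j \<in> paravectors"
    unfolding paravectors_def
    by (intro CollectI exI[of _ 0] exI[of _ "\<lambda>k. if k = j then 1 else 0"]) simp
  then show ?thesis
    by (simp add: imag_sphere_def power2_eq_square gen_mult_self)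
qed

lemma phi_eqD:
  assumes I: "I \<in> imag_sphere" and J: "J \<in> imag_sphere" and eq: "phi I z = phi J w"
  shows "(w = z \<and> (J = I \<or> Im z = 0)) \<or> (w = cnj z \<and> J = - I)"
proof -
  have phi: "phi K u = of_real (Re u) + Im u *\<^sub>R K" for K :: "'a clifford" and u
    by (simp add: phi_def of_real_def)
  have I0: "coord I {} = 0" and J0: "coord J {} = 0"
    using I J by (metis imag_sphere_iff coord_Im_part(1))+
  have "coord (phi I z) {} = coord (phi J w) {}" by (simp add: eq)
  then have re: "Re z = Re w" by (simp add: phi coord_of_real I0 J0)
  have im: "Im z *\<^sub>R I = Im w *\<^sub>R J"
    using eq re by (simp add: phi)
  have sq: "(\<Sum>j\<in>UNIV. (coord (r *\<^sub>R K) {j})\<^sup>2) = r\<^sup>2"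
    if "K \<in> imag_sphere" for r and K :: "'a clifford"
    using that by (simp add: imag_sphere_iff power_mult_distrib sum_distrib_left[symmetric])
  have "(Im z)\<^sup>2 = (Im w)\<^sup>2"
    using sq[OF I, of "Im z"] sq[OF J, of "Im w"] im by metis
  then consider "Im w = Im z" | "Im w = - Im z"
    by (auto simp: power2_eq_iff)
  then show ?thesis
  proof cases
    case 1
    then show ?thesis using re im by (auto simp: complex_eq_iff)
  next
    case 2
    then have "Im z *\<^sub>R (I + J) = 0" using im by (simp add: scaleR_add_right)
    then have "Im z = 0 \<or> J = - I" by (auto simp: eq_neg_iff_add_eq_0 add.commute)
    then show ?thesis using re 2 by (auto simp: complex_eq_iff)
  qed
qed

lemma circular_profile:
  assumes "circular \<Omega>"
  shows "\<Omega> = circularization (profile \<Omega>)"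
  using assms by (auto simp: circular_def circularization_def profile_def)

lemma induces_unique:
  assumes "circular \<Omega>" "induces \<Omega> F f" "induces \<Omega> F g" "x \<in> \<Omega>"
  shows "f x = g x"
proof -
  have "x \<in> circularization (profile \<Omega>)"
    using assms(4) circular_profile[OF assms(1)] by simp
  then obtain z I where "x = phi I z" "z \<in> profile \<Omega>" "I \<in> imag_sphere"
    by (auto simp: circularization_def)
  then show ?thesis
    using assms(2,3) by (simp add: induces_def)
qed

lemma induces_slice_fun_of:
  fixes \<Omega> :: "'a::{finite,linorder} clifford set"
  assumes F: "stem_function \<Omega> F"
  shows "induces \<Omega> F (slice_fun_of \<Omega> F)"
proof -
  define P where "P x p \<longleftrightarrow> fst p \<in> profile \<Omega> \<and> snd p \<in> imag_sphere \<and> x = phi (snd p) (fst p)"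
    for x :: "'a clifford" and p
  define f where "f x = (let (w, J) = SOME p. P x p in fst (F w) + J * snd (F w))" for x
  have "induces \<Omega> F f"
    unfolding induces_def
  proof (intro ballI)
    fix z and I :: "'a clifford" assume z: "z \<in> profile \<Omega>" and I: "I \<in> imag_sphere"
    obtain w J where p: "(SOME p. P (phi I z) p) = (w, J)" by fastforce
    have "P (phi I z) (z, I)" using z I by (simp add: P_def)
    then have "P (phi I z) (w, J)" using someI[of "P (phi I z)"] p by metis
    then have w: "w \<in> profile \<Omega>" "J \<in> imag_sphere" "phi I z = phi J w"
      by (auto simp: P_def)
    have real: "snd (F z) = 0" if "Im z = 0"
    proof -
      have "cnj z = z" using that by (simp add: complex_eq_iff)
      then have "snd (F z) = - snd (F z)" using F z unfolding stem_function_def by metis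
      then have "2 *\<^sub>R snd (F z) = 0" by (simp add: scaleR_2 eq_neg_iff_add_eq_0)
      then show ?thesis by simp
    qed
    have "fst (F w) + J * snd (F w) = fst (F z) + I * snd (F z)"
      using phi_eqD[OF I w(2,3)] real F z by (auto simp: stem_function_def)
    then show "f (phi I z) = fst (F z) + I * snd (F z)"
      by (simp add: f_def p)
  qed
  then show ?thesis
    unfolding slice_fun_of_def by (rule someI[of "induces \<Omega> F" f])
qed

lemma stem_unique:
  fixes \<Omega> :: "'a::{finite,linorder} clifford set"
  assumes F: "induces \<Omega> F f" and G: "induces \<Omega> G f" and z: "z \<in> profile \<Omega>"
  shows "F z = G z"
proof -
  define I where "I = (gen undefined :: 'a clifford)"
  have I: "I \<in> imag_sphere" "- I \<in> imag_sphere"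
    by (simp_all add: I_def gen_in_imag_sphere imag_sphere_uminus)
  have 1: "fst (F z) + I * snd (F z) = fst (G z) + I * snd (G z)"
    using F G z I(1) by (metis induces_def)
  have 2: "fst (F z) + - I * snd (F z) = fst (G z) + - I * snd (G z)"
    using F G z I(2) by (metis induces_def)
  have "2 *\<^sub>R fst (F z) = (fst (F z) + I * snd (F z)) + (fst (F z) + - I * snd (F z))"
    by (simp add: scaleR_2)
  also have "\<dots> = 2 *\<^sub>R fst (G z)"
    unfolding 1 2 by (simp add: scaleR_2)
  finally have fst: "fst (F z) = fst (G z)" by simp
  with 1 have "I * snd (F z) = I * snd (G z)" by simp
  then have "I * I * snd (F z) = I * I * snd (G z)" by (simp add: mult.assoc)
  then have "snd (F z) = snd (G z)" by (simp add: I_def gen_mult_self)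
  with fst show ?thesis by (rule prod_eqI)
qed

end

theory Submission
  imports Defs "HOL-Complex_Analysis.Conformal_Mappings"
begin

text \<open>
  Everything is reduced to the stem function \<open>F = F1 + i F2\<close> on the profile \<open>D\<close>, and then, blade by
  blade, to complex-valued functions \<open>G = component A \<circ> F\<close> on \<open>D\<close>. Under \<open>f (\<alpha> + I \<beta>) = F1 + I F2\<close>
  left multiplication by \<open>I\<close> corresponds to multiplication of \<open>F\<close> by \<open>i\<close>. Therefore the slice
  operators, the operator \<open>theta_bar\<close> off the real axis and the stem operator are all the
  Cauchy-Riemann operator \<open>dbar\<close> on the components (\<open>dbar_slice_eq\<close>, \<open>theta_bar_pow_slice_function\<close>,
  \<open>dbar_slice_fun_eq\<close>), and multiplication of \<open>f\<close> by the conjugate paravector is multiplication of \<open>G\<close>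
  by \<open>cnj z\<close>. The theorem becomes the statement that \<open>dbar ^^ n\<close> annihilates \<open>G\<close> if and only if
  \<open>G z = (\<Sum>h<n. cnj z ^ h * H h z)\<close> with holomorphic \<open>H h\<close>.

  Three points need an argument. The weakest condition gives class C^n and the equation only off the
  real axis, and class C^(n - 1) across it. Then \<open>dbar ^^ (n - 1)\<close> of \<open>G\<close> is continuous on \<open>D\<close> and
  holomorphic off the real line, hence holomorphic on \<open>D\<close> by Painleve's theorem. Up to a factorial it
  is the top coefficient, and subtracting the top term lowers the order
  (\<open>polyanalytic_decomposition\<close>).

  Slice monogenic functions are only assumed to solve a Cauchy-Riemann equation on each slice. The
  stem function is read off on one slice; on any other slice the function that it induces and the
  given one solve the same equation and agree on the real axis, so they agree because \<open>D\<close> is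
  connected and meets the real axis (\<open>slice_monogenic_imp_stem\<close>).

  Conversely, the terms of the decomposition must be of class C^1 at real points, where the direction
  of the imaginary part has no limit. This holds because \<open>F2\<close> is odd in \<open>\<beta>\<close>, so that \<open>F2 / \<beta>\<close>
  extends continuously (\<open>C1_slice_function\<close>).
\<close>

section \<open>Calculus of directional derivatives and of the classes C^k\<close>

abbreviation has_partial ::
    "'a::real_normed_vector \<Rightarrow> ('a \<Rightarrow> 'b::real_normed_vector) \<Rightarrow> 'a \<Rightarrow> 'b \<Rightarrow> bool" where
  "has_partial v f x d \<equiv> ((\<lambda>t. f (x + t *\<^sub>R v)) has_vector_derivative d) (at 0)"

text \<open>
  A derivative at \<open>x\<close> in direction \<open>v\<close> only sees the values on the line through \<open>x\<close>. Openness along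
  the lines in the directions of \<open>B\<close> is what open sets of complex numbers and relatively open sets of
  paravectors have in common, and it makes these derivatives depend only on the values on \<open>U\<close>.
\<close>

definition line_open :: "'a::real_normed_vector set \<Rightarrow> 'a set \<Rightarrow> bool" where
  "line_open B U \<longleftrightarrow> (\<forall>x\<in>U. \<forall>v\<in>B. \<forall>\<^sub>F t in nhds 0. x + t *\<^sub>R v \<in> U)"

lemma partialI: "has_partial v f x d \<Longrightarrow> partial v f x = d"
  unfolding partial_def by (rule vector_derivative_at)

lemma line_openD: "line_open B U \<Longrightarrow> v \<in> B \<Longrightarrow> x \<in> U \<Longrightarrow> \<forall>\<^sub>F t in nhds 0. x + t *\<^sub>R v \<in> U"
  by (simp add: line_open_def)

lemma eventually_on_line:
  fixes x v :: "'a::real_normed_vector"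
  assumes "open U" "x \<in> U"
  shows "\<forall>\<^sub>F t::real in nhds 0. x + t *\<^sub>R v \<in> U"
proof -
  have "((\<lambda>t::real. x + t *\<^sub>R v) \<longlongrightarrow> x + 0 *\<^sub>R v) (nhds 0)"
    by (intro tendsto_intros filterlim_ident)
  then show ?thesis using assms by (auto simp: tendsto_def)
qed

lemma line_open_if_open: "open U \<Longrightarrow> line_open B U"
  by (simp add: line_open_def eventually_on_line)

lemma has_partial_cong:
  assumes "\<forall>\<^sub>F t in nhds 0. x + t *\<^sub>R v \<in> U" "\<And>y. y \<in> U \<Longrightarrow> f y = g y"
  shows "has_partial v f x d \<longleftrightarrow> has_partial v g x d"
proof (rule has_vector_derivative_cong_ev)
  show "\<forall>\<^sub>F t in nhds 0. t \<in> UNIV \<longrightarrow> f (x + t *\<^sub>R v) = g (x + t *\<^sub>R v)"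
    by (rule eventually_mono[OF assms(1)]) (simp add: assms(2))
  show "f (x + 0 *\<^sub>R v) = g (x + 0 *\<^sub>R v)"
    using eventually_nhds_x_imp_x[OF assms(1)] assms(2) by blast
qed

lemma partial_cong:
  assumes "\<forall>\<^sub>F t in nhds 0. x + t *\<^sub>R v \<in> U" "\<And>y. y \<in> U \<Longrightarrow> f y = g y"
  shows "partial v f x = partial v g x"
  unfolding partial_def vector_derivative_def
  by (rule arg_cong[where f = Eps], rule ext, rule has_partial_cong[OF assms])

lemma differentiable_line_cong:
  fixes f g :: "'a::real_normed_vector \<Rightarrow> 'b::real_normed_vector"
  assumes "\<forall>\<^sub>F t in nhds 0. x + t *\<^sub>R v \<in> U" "\<And>y. y \<in> U \<Longrightarrow> f y = g y"
  shows "(\<lambda>t. f (x + t *\<^sub>R v)) differentiable (at 0) \<longleftrightarrow> (\<lambda>t. g (x + t *\<^sub>R v)) differentiable (at 0)"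
proof -
  have "(\<lambda>t. h (x + t *\<^sub>R v)) differentiable (at 0) \<longleftrightarrow> (\<exists>d. has_partial v h x d)"
    for h :: "'a \<Rightarrow> 'b"
    using vector_derivative_works differentiableI_vector by blast
  moreover have "(\<exists>d. has_partial v f x d) \<longleftrightarrow> (\<exists>d. has_partial v g x d)"
    by (intro iff_exI has_partial_cong[OF assms])
  ultimately show ?thesis by simp
qed

lemma Ck_on_cong:
  assumes "line_open B U" "\<And>y. y \<in> U \<Longrightarrow> f y = g y"
  shows "Ck_on B n U f \<longleftrightarrow> Ck_on B n U g"
  using assms(2)
proof (induction n arbitrary: f g)
  case 0
  then show ?case by (simp cong: continuous_on_cong)
next
  case (Suc n)
  have 1: "Ck_on B n U (partial v f) \<longleftrightarrow> Ck_on B n U (partial v g)" if "v \<in> B" for v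
  proof (rule Suc.IH)
    show "partial v f y = partial v g y" if "y \<in> U" for y
      by (rule partial_cong[OF line_openD[OF assms(1) \<open>v \<in> B\<close> that] Suc.prems])
  qed
  have 2: "(\<lambda>t. f (x + t *\<^sub>R v)) differentiable (at 0) \<longleftrightarrow>
      (\<lambda>t. g (x + t *\<^sub>R v)) differentiable (at 0)" if "v \<in> B" "x \<in> U" for v x
    by (rule differentiable_line_cong[OF line_openD[OF assms(1) that] Suc.prems])
  have 3: "continuous_on U f \<longleftrightarrow> continuous_on U g"
    by (rule continuous_on_cong[OF refl Suc.prems])
  show ?case
    unfolding Ck_on.simps 3 by (intro conj_cong ball_cong refl 1 2)
qed

lemma Ck_on_transfer:
  assumes "line_open B U" "Ck_on B n U g" "\<And>y. y \<in> U \<Longrightarrow> f y = g y"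
  shows "Ck_on B n U f"
  using Ck_on_cong[OF assms(1), of f g n] assms(2,3) by blast

lemma Ck_on_subset:
  assumes "Ck_on B n U f" "V \<subseteq> U"
  shows "Ck_on B n V f"
  using assms(1)
proof (induction n arbitrary: f)
  case 0
  then show ?case using continuous_on_subset[OF _ assms(2)] by simp
next
  case (Suc n)
  then show ?case
    using continuous_on_subset[OF _ assms(2), of f] assms(2) by (simp add: subset_iff)
qed

lemma Ck_on_imp_continuous_on: "Ck_on B n U f \<Longrightarrow> continuous_on U f"
  by (cases n) auto

lemma Ck_on_SucD: "Ck_on B (Suc n) U f \<Longrightarrow> Ck_on B n U f"
proof (induction n arbitrary: f)
  case (Suc n)
  then show ?case
    unfolding Ck_on.simps(2)[of B "Suc n" U f] Ck_on.simps(2)[of B n U f] by blast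
qed simp

lemma Ck_on_has_partial:
  assumes "Ck_on B (Suc n) U f" "v \<in> B" "x \<in> U"
  shows "has_partial v f x (partial v f x)"
  using assms by (simp add: partial_def vector_derivative_works)

lemma Ck_on_SucI:
  assumes "line_open B U" "continuous_on U f"
    and "\<And>v x. v \<in> B \<Longrightarrow> x \<in> U \<Longrightarrow> has_partial v f x (f' v x)"
    and "\<And>v. v \<in> B \<Longrightarrow> Ck_on B n U (f' v)"
  shows "Ck_on B (Suc n) U f"
proof -
  have "Ck_on B n U (partial v f)" if "v \<in> B" for v
    using Ck_on_cong[OF assms(1), of "partial v f" "f' v"] partialI[OF assms(3)] assms(4) that
    by auto
  then show ?thesis
    using assms(2,3) by (auto intro: differentiableI_vector)
qed

lemma has_partial_const: "has_partial v (\<lambda>_. c) x 0"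
  by simp

lemma has_partial_bounded_linear:
  "bounded_linear L \<Longrightarrow> has_partial v f x d \<Longrightarrow> has_partial v (\<lambda>y. L (f y)) x (L d)"
  by (rule bounded_linear.has_vector_derivative)

lemma has_partial_bounded_bilinear:
  assumes "bounded_bilinear prd" "has_partial v f x d" "has_partial v g x e"
  shows "has_partial v (\<lambda>y. prd (f y) (g y)) x (prd (f x) e + prd d (g x))"
  using bounded_bilinear.has_vector_derivative[OF assms] by simp

lemma has_partial_add:
  "has_partial v f x d \<Longrightarrow> has_partial v g x e \<Longrightarrow> has_partial v (\<lambda>y. f y + g y) x (d + e)"
  by (rule has_vector_derivative_add)

lemma has_partial_diff:
  "has_partial v f x d \<Longrightarrow> has_partial v g x e \<Longrightarrow> has_partial v (\<lambda>y. f y - g y) x (d - e)"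
  by (rule has_vector_derivative_diff)

lemma has_partial_sum:
  "(\<And>i. i \<in> A \<Longrightarrow> has_partial v (f i) x (d i)) \<Longrightarrow>
    has_partial v (\<lambda>y. \<Sum>i\<in>A. f i y) x (\<Sum>i\<in>A. d i)"
  by (rule has_vector_derivative_sum)

lemma has_partial_scale_direction:
  assumes "has_partial v f x d"
  shows "has_partial (c *\<^sub>R v) f x (c *\<^sub>R d)"
proof -
  have "((\<lambda>t. f (x + t *\<^sub>R v)) \<circ> (\<lambda>t. t * c) has_vector_derivative c *\<^sub>R d) (at 0)"
    by (rule vector_diff_chain_at) (auto intro!: derivative_eq_intros assms)
  then show ?thesis by (simp add: o_def)
qed

lemma Ck_on_const: "Ck_on B n U (\<lambda>_. c)"
proof -
  have "partial v (\<lambda>_. c) = (\<lambda>_. 0)" for v :: 'a and c :: 'b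
    by (intro ext partialI has_partial_const)
  then show ?thesis
    by (induction n arbitrary: c) auto
qed

lemma Ck_on_bounded_linear:
  assumes "line_open B U" "bounded_linear L" "Ck_on B n U f"
  shows "Ck_on B n U (\<lambda>y. L (f y))"
  using assms(3)
proof (induction n arbitrary: f)
  case 0
  then show ?case
    by (simp add: bounded_linear.continuous_on[OF assms(2)])
next
  case (Suc n)
  show ?case
  proof (rule Ck_on_SucI[OF assms(1)])
    show "continuous_on U (\<lambda>y. L (f y))"
      using Suc.prems by (simp add: bounded_linear.continuous_on[OF assms(2)])
    show "has_partial v (\<lambda>y. L (f y)) x (L (partial v f x))" if "v \<in> B" "x \<in> U" for v x
      using has_partial_bounded_linear[OF assms(2)] Ck_on_has_partial[OF Suc.prems that] .
    show "Ck_on B n U (\<lambda>x. L (partial v f x))" if "v \<in> B" for v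
      by (rule Suc.IH) (use Suc.prems that in simp_all)
  qed
qed

lemma Ck_on_add:
  assumes "line_open B U" "Ck_on B n U f" "Ck_on B n U g"
  shows "Ck_on B n U (\<lambda>y. f y + g y)"
  using assms(2,3)
proof (induction n arbitrary: f g)
  case 0
  then show ?case by (simp add: continuous_on_add)
next
  case (Suc n)
  show ?case
  proof (rule Ck_on_SucI[OF assms(1)])
    show "continuous_on U (\<lambda>y. f y + g y)"
      using Suc.prems by (simp add: continuous_on_add)
    show "has_partial v (\<lambda>y. f y + g y) x (partial v f x + partial v g x)"
      if "v \<in> B" "x \<in> U" for v x
      using Ck_on_has_partial[OF Suc.prems(1) that] Ck_on_has_partial[OF Suc.prems(2) that]
      by (rule has_partial_add)
    show "Ck_on B n U (\<lambda>x. partial v f x + partial v g x)" if "v \<in> B" for v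
      by (rule Suc.IH) (use Suc.prems that in simp_all)
  qed
qed

lemma Ck_on_bounded_bilinear:
  assumes "line_open B U" "bounded_bilinear prd" "Ck_on B n U f" "Ck_on B n U g"
  shows "Ck_on B n U (\<lambda>y. prd (f y) (g y))"
  using assms(3,4)
proof (induction n arbitrary: f g)
  case 0
  then show ?case by (simp add: bounded_bilinear.continuous_on[OF assms(2)])
next
  case (Suc n)
  show ?case
  proof (rule Ck_on_SucI[OF assms(1)])
    show "continuous_on U (\<lambda>y. prd (f y) (g y))"
      using Suc.prems by (simp add: bounded_bilinear.continuous_on[OF assms(2)])
    show "has_partial v (\<lambda>y. prd (f y) (g y)) x (prd (f x) (partial v g x) + prd (partial v f x) (g x))"
      if "v \<in> B" "x \<in> U" for v x
      by (rule has_partial_bounded_bilinear[OF assms(2)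
            Ck_on_has_partial[OF Suc.prems(1) that] Ck_on_has_partial[OF Suc.prems(2) that]])
    show "Ck_on B n U (\<lambda>x. prd (f x) (partial v g x) + prd (partial v f x) (g x))" if "v \<in> B" for v
      using Suc.prems that Ck_on_SucD[OF Suc.prems(1)] Ck_on_SucD[OF Suc.prems(2)]
      by (intro Ck_on_add[OF assms(1)] Suc.IH) auto
  qed
qed

lemma Ck_on_scaleR:
  "line_open B U \<Longrightarrow> Ck_on B n U r \<Longrightarrow> Ck_on B n U f \<Longrightarrow> Ck_on B n U (\<lambda>y. r y *\<^sub>R f y)"
  by (rule Ck_on_bounded_bilinear[OF _ bounded_bilinear_scaleR])

lemma Ck_on_mult:
  fixes f :: "_ \<Rightarrow> 'b::real_normed_algebra"
  shows "line_open B U \<Longrightarrow> Ck_on B n U f \<Longrightarrow> Ck_on B n U g \<Longrightarrow> Ck_on B n U (\<lambda>y. f y * g y)"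
  by (rule Ck_on_bounded_bilinear[OF _ bounded_bilinear_mult])

lemma Ck_on_diff:
  assumes "line_open B U" "Ck_on B n U f" "Ck_on B n U g"
  shows "Ck_on B n U (\<lambda>y. f y - g y)"
  using Ck_on_add[OF assms(1,2) Ck_on_bounded_linear[OF assms(1) _ assms(3)], of uminus]
  by (simp add: bounded_linear_minus bounded_linear_ident)

lemma Ck_on_sum:
  assumes "line_open B U" "\<And>i. i \<in> A \<Longrightarrow> Ck_on B n U (f i)"
  shows "Ck_on B n U (\<lambda>y. \<Sum>i\<in>A. f i y)"
  using assms(2)
  by (induction A rule: infinite_finite_induct) (auto intro!: Ck_on_const Ck_on_add[OF assms(1)])

text \<open>
  Only derivatives along basis directions are available, so the chain rule is iterated for inner
  maps that carry each basis direction to a multiple of a basis direction.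
\<close>

lemma Ck_on_compose_axis_linear:
  assumes "line_open C V" "linear L" "continuous_on V L" "L ` V \<subseteq> U"
    and "\<And>w. w \<in> C \<Longrightarrow> b w \<in> B \<and> L w = c w *\<^sub>R b w"
    and "Ck_on B n U f"
  shows "Ck_on C n V (\<lambda>y. f (L y))"
  using assms(6)
proof (induction n arbitrary: f)
  case 0
  then show ?case
    using continuous_on_compose2[of U f V L] assms(3,4) by auto
next
  case (Suc n)
  show ?case
  proof (rule Ck_on_SucI[OF assms(1)])
    show "continuous_on V (\<lambda>y. f (L y))"
      using continuous_on_compose2[of U f V L] assms(3,4) Suc.prems by auto
    show "has_partial w (\<lambda>y. f (L y)) x (c w *\<^sub>R partial (b w) f (L x))" if "w \<in> C" "x \<in> V" for w x
    proof -
      have "has_partial (c w *\<^sub>R b w) f (L x) (c w *\<^sub>R partial (b w) f (L x))"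
        using assms(4,5) that
        by (intro has_partial_scale_direction Ck_on_has_partial[OF Suc.prems]) auto
      then show ?thesis
        using assms(5)[OF that(1)] by (simp add: linear_add[OF assms(2)] linear_scale[OF assms(2)])
    qed
    show "Ck_on C n V (\<lambda>x. c w *\<^sub>R partial (b w) f (L x))" if "w \<in> C" for w
      using assms(5)[OF that] Suc.prems
      by (intro Ck_on_bounded_linear[OF assms(1) bounded_linear_scaleR_right] Suc.IH) auto
  qed
qed

section \<open>From the coordinate directions to all directions\<close>

text \<open>
  The estimate is required at all base points near \<open>x\<close>: this is what makes such derivatives
  additive in the direction \<open>v\<close>, and it is what a continuous derivative provides.
\<close>

definition strict_partial ::
    "'a::real_normed_vector set \<Rightarrow> 'a \<Rightarrow> ('a \<Rightarrow> 'b::real_normed_vector) \<Rightarrow> 'a \<Rightarrow> 'b \<Rightarrow> bool" where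
  "strict_partial P v f x d \<longleftrightarrow> (\<forall>\<epsilon>>0. \<exists>\<delta>>0. \<forall>y\<in>P. \<forall>t. dist y x < \<delta> \<longrightarrow> \<bar>t\<bar> < \<delta> \<longrightarrow>
     norm (f (y + t *\<^sub>R v) - f y - t *\<^sub>R d) \<le> \<epsilon> * \<bar>t\<bar>)"

lemma strict_partialD:
  assumes "strict_partial P v f x d" "\<epsilon> > 0"
  obtains \<delta> where "\<delta> > 0" "\<And>y t. y \<in> P \<Longrightarrow> dist y x < \<delta> \<Longrightarrow> \<bar>t\<bar> < \<delta> \<Longrightarrow>
     norm (f (y + t *\<^sub>R v) - f y - t *\<^sub>R d) \<le> \<epsilon> * \<bar>t\<bar>"
  using assms unfolding strict_partial_def by metis

lemma strict_partial_imp_has_partial: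
  assumes "strict_partial P v f x d" "x \<in> P"
  shows "has_partial v f x d"
  unfolding has_vector_derivative_def has_derivative_at_alt
proof (intro conjI allI impI bounded_linear_scaleR_left)
  fix \<epsilon> :: real assume "\<epsilon> > 0"
  then obtain \<delta> where \<delta>: "\<delta> > 0" "\<And>y t. y \<in> P \<Longrightarrow> dist y x < \<delta> \<Longrightarrow> \<bar>t\<bar> < \<delta> \<Longrightarrow>
     norm (f (y + t *\<^sub>R v) - f y - t *\<^sub>R d) \<le> \<epsilon> * \<bar>t\<bar>"
    using strict_partialD[OF assms(1)] by metis
  show "\<exists>\<delta>>0. \<forall>t. norm (t - 0) < \<delta> \<longrightarrow>
      norm (f (x + t *\<^sub>R v) - f (x + 0 *\<^sub>R v) - (t - 0) *\<^sub>R d) \<le> \<epsilon> * norm (t - 0)"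
    using \<delta> assms(2) by (intro exI[of _ \<delta>]) auto
qed

lemma strict_partial_zero: "strict_partial P 0 f x 0"
  by (auto simp: strict_partial_def intro!: exI[of _ 1])

lemma strict_partial_add:
  assumes "subspace P" "u \<in> P" "strict_partial P u f x d" "strict_partial P v f x e"
  shows "strict_partial P (u + v) f x (d + e)"
  unfolding strict_partial_def
proof (intro allI impI)
  fix \<epsilon> :: real assume "\<epsilon> > 0"
  then have h: "\<epsilon> / 2 > 0" by simp
  obtain \<delta>1 where \<delta>1: "\<delta>1 > 0" "\<And>y t. y \<in> P \<Longrightarrow> dist y x < \<delta>1 \<Longrightarrow> \<bar>t\<bar> < \<delta>1 \<Longrightarrow>
     norm (f (y + t *\<^sub>R u) - f y - t *\<^sub>R d) \<le> \<epsilon> / 2 * \<bar>t\<bar>"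
    using strict_partialD[OF assms(3) h] by metis
  obtain \<delta>2 where \<delta>2: "\<delta>2 > 0" "\<And>y t. y \<in> P \<Longrightarrow> dist y x < \<delta>2 \<Longrightarrow> \<bar>t\<bar> < \<delta>2 \<Longrightarrow>
     norm (f (y + t *\<^sub>R v) - f y - t *\<^sub>R e) \<le> \<epsilon> / 2 * \<bar>t\<bar>"
    using strict_partialD[OF assms(4) h] by metis
  \<comment> \<open>The second increment starts at \<open>y + t u\<close>, which has to stay within \<open>\<delta>2\<close> of \<open>x\<close>.\<close>
  define \<delta> where "\<delta> = min \<delta>1 (\<delta>2 / (2 * (1 + norm u)))"
  have pos: "1 + norm u > 0" by (simp add: add_pos_nonneg)
  have "\<delta> > 0" using \<delta>1(1) \<delta>2(1) pos by (simp add: \<delta>_def)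
  moreover have "norm (f (y + t *\<^sub>R (u + v)) - f y - t *\<^sub>R (d + e)) \<le> \<epsilon> * \<bar>t\<bar>"
    if y: "y \<in> P" "dist y x < \<delta>" and t: "\<bar>t\<bar> < \<delta>" for y t
  proof -
    have small: "\<delta> * (1 + norm u) \<le> \<delta>2 / 2"
    proof -
      have "\<delta> \<le> \<delta>2 / 2 / (1 + norm u)" by (simp add: \<delta>_def)
      then show ?thesis using pos pos_le_divide_eq by blast
    qed
    have "dist (y + t *\<^sub>R u) x \<le> dist y x + \<bar>t\<bar> * norm u"
      by (smt (verit, ccfv_threshold) add_diff_cancel_left' dist_norm dist_triangle2 dist_commute norm_scaleR)
    also have "\<dots> \<le> \<delta> + \<delta> * norm u"
      using y t by (intro add_mono mult_right_mono) auto
    also have "\<dots> < \<delta>2"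
      using small \<delta>2(1) by (simp add: algebra_simps)
    finally have near: "dist (y + t *\<^sub>R u) x < \<delta>2" .
    have "\<delta> \<le> \<delta> * (1 + norm u)" using \<open>\<delta> > 0\<close> by (simp add: algebra_simps)
    then have "\<delta> < \<delta>2" using small \<delta>2(1) by linarith
    have "norm (f (y + t *\<^sub>R u + t *\<^sub>R v) - f (y + t *\<^sub>R u) - t *\<^sub>R e) \<le> \<epsilon> / 2 * \<bar>t\<bar>"
      using near t \<open>\<delta> < \<delta>2\<close> y(1) assms(1,2)
      by (intro \<delta>2(2)) (auto intro: subspace_add subspace_scale)
    moreover have "norm (f (y + t *\<^sub>R u) - f y - t *\<^sub>R d) \<le> \<epsilon> / 2 * \<bar>t\<bar>"
      using y t by (intro \<delta>1(2)) (auto simp: \<delta>_def)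
    ultimately have "norm ((f (y + t *\<^sub>R u + t *\<^sub>R v) - f (y + t *\<^sub>R u) - t *\<^sub>R e) +
        (f (y + t *\<^sub>R u) - f y - t *\<^sub>R d)) \<le> \<epsilon> * \<bar>t\<bar>"
      by (rule order_trans[OF norm_triangle_mono]) simp
    then show ?thesis by (simp add: algebra_simps)
  qed
  ultimately show "\<exists>\<delta>>0. \<forall>y\<in>P. \<forall>t. dist y x < \<delta> \<longrightarrow> \<bar>t\<bar> < \<delta> \<longrightarrow>
      norm (f (y + t *\<^sub>R (u + v)) - f y - t *\<^sub>R (d + e)) \<le> \<epsilon> * \<bar>t\<bar>" by blast
qed

lemma strict_partial_scale:
  assumes "strict_partial P v f x d"
  shows "strict_partial P (c *\<^sub>R v) f x (c *\<^sub>R d)"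
  unfolding strict_partial_def
proof (intro allI impI)
  fix \<epsilon> :: real assume "\<epsilon> > 0"
  have pos: "1 + \<bar>c\<bar> > 0" by simp
  then have "\<epsilon> / (1 + \<bar>c\<bar>) > 0" using \<open>\<epsilon> > 0\<close> by simp
  then obtain \<delta> where \<delta>: "\<delta> > 0" "\<And>y t. y \<in> P \<Longrightarrow> dist y x < \<delta> \<Longrightarrow> \<bar>t\<bar> < \<delta> \<Longrightarrow>
     norm (f (y + t *\<^sub>R v) - f y - t *\<^sub>R d) \<le> \<epsilon> / (1 + \<bar>c\<bar>) * \<bar>t\<bar>"
    using strict_partialD[OF assms] by metis
  have "norm (f (y + t *\<^sub>R c *\<^sub>R v) - f y - t *\<^sub>R c *\<^sub>R d) \<le> \<epsilon> * \<bar>t\<bar>"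
    if y: "y \<in> P" "dist y x < \<delta> / (1 + \<bar>c\<bar>)" and t: "\<bar>t\<bar> < \<delta> / (1 + \<bar>c\<bar>)" for y t
  proof -
    have "\<delta> / (1 + \<bar>c\<bar>) \<le> \<delta>" using \<delta>(1) pos by (simp add: field_simps)
    moreover have "\<bar>t * c\<bar> < \<delta>"
    proof -
      have "\<bar>t * c\<bar> \<le> \<bar>t\<bar> * (1 + \<bar>c\<bar>)" by (simp add: abs_mult algebra_simps)
      also have "\<dots> < \<delta>" using t pos by (simp add: pos_less_divide_eq)
      finally show ?thesis .
    qed
    ultimately have "norm (f (y + (t * c) *\<^sub>R v) - f y - (t * c) *\<^sub>R d) \<le> \<epsilon> / (1 + \<bar>c\<bar>) * \<bar>t * c\<bar>"
      using y by (intro \<delta>(2)) auto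
    also have "\<dots> = \<epsilon> * \<bar>t\<bar> * (\<bar>c\<bar> / (1 + \<bar>c\<bar>))" by (simp add: abs_mult)
    also have "\<dots> \<le> \<epsilon> * \<bar>t\<bar> * 1"
      using \<open>\<epsilon> > 0\<close> by (intro mult_left_mono) auto
    finally show ?thesis by simp
  qed
  then show "\<exists>\<delta>>0. \<forall>y\<in>P. \<forall>t. dist y x < \<delta> \<longrightarrow> \<bar>t\<bar> < \<delta> \<longrightarrow>
      norm (f (y + t *\<^sub>R c *\<^sub>R v) - f y - t *\<^sub>R c *\<^sub>R d) \<le> \<epsilon> * \<bar>t\<bar>"
    using \<delta>(1) pos by (intro exI[of _ "\<delta> / (1 + \<bar>c\<bar>)"]) auto
qed

lemma strict_partial_sum:
  assumes "subspace P" "\<And>i. i \<in> A \<Longrightarrow> v i \<in> P" "\<And>i. i \<in> A \<Longrightarrow> strict_partial P (v i) f x (d i)"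
  shows "strict_partial P (\<Sum>i\<in>A. c i *\<^sub>R v i) f x (\<Sum>i\<in>A. c i *\<^sub>R d i)"
  using assms(2,3)
  by (induction A rule: infinite_finite_induct)
    (auto intro!: strict_partial_zero strict_partial_add[OF assms(1)] strict_partial_scale
      subspace_scale[OF assms(1)])

text \<open>
  The mean value inequality on segments in direction \<open>v\<close>: their base points may vary because the
  derivative is close to \<open>f' x\<close> at all nearby points.
\<close>

lemma C1_imp_strict_partial:
  assumes P: "subspace P" "v \<in> P" and U: "openin (top_of_set P) U" "x \<in> U"
    and d: "\<And>y. y \<in> U \<Longrightarrow> has_partial v f y (f' y)" and c: "continuous_on U f'"
  shows "strict_partial P v f x (f' x)"
  unfolding strict_partial_def
proof (intro allI impI)
  fix \<epsilon> :: real assume "\<epsilon> > 0"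
  obtain r1 where r1: "r1 > 0" "\<And>y. y \<in> P \<Longrightarrow> dist y x < r1 \<Longrightarrow> y \<in> U"
    using U by (auto simp: openin_euclidean_subtopology_iff)
  obtain r2 where r2: "r2 > 0" "\<And>y. y \<in> U \<Longrightarrow> dist y x < r2 \<Longrightarrow> dist (f' y) (f' x) < \<epsilon>"
    using c U(2) \<open>\<epsilon> > 0\<close> unfolding continuous_on_iff by metis
  define r where "r = min r1 r2"
  define \<delta> where "\<delta> = r / (2 * (1 + norm v))"
  have pos: "1 + norm v > 0" by (simp add: add_pos_nonneg)
  have "r > 0" using r1 r2 by (simp add: r_def)
  have "\<delta> > 0" using \<open>r > 0\<close> pos by (simp add: \<delta>_def)
  have \<delta>: "\<delta> + \<delta> * norm v < r"
  proof -
    have "r / (2 * s) * s = r / 2" if "s > 0" for s :: real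
      using that by simp
    from this[OF pos] have "\<delta> * (1 + norm v) = r / 2" unfolding \<delta>_def .
    then show ?thesis using \<open>r > 0\<close> by (simp add: algebra_simps)
  qed
  have "norm (f (y + t *\<^sub>R v) - f y - t *\<^sub>R f' x) \<le> \<epsilon> * \<bar>t\<bar>"
    if y: "y \<in> P" "dist y x < \<delta>" and t: "\<bar>t\<bar> < \<delta>" for y t
  proof -
    let ?S = "{-\<bar>t\<bar>..\<bar>t\<bar>}"
    have near: "y + s *\<^sub>R v \<in> U \<and> dist (y + s *\<^sub>R v) x < r2" if "s \<in> ?S" for s
    proof -
      have "dist (y + s *\<^sub>R v) x \<le> dist y x + \<bar>s\<bar> * norm v"
        by (smt (verit, ccfv_threshold) add_diff_cancel_left' dist_norm dist_triangle2 dist_commute norm_scaleR)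
      also have "\<dots> \<le> \<delta> + \<delta> * norm v"
        using y t that by (intro add_mono mult_right_mono) auto
      finally have "dist (y + s *\<^sub>R v) x < r" using \<delta> by linarith
      moreover have "y + s *\<^sub>R v \<in> P" using P y by (simp add: subspace_add subspace_scale)
      ultimately show ?thesis using r1(2) by (auto simp: r_def)
    qed
    have der: "((\<lambda>s. f (y + s *\<^sub>R v) - s *\<^sub>R f' x) has_derivative
        (\<lambda>h. h *\<^sub>R (f' (y + s *\<^sub>R v) - f' x))) (at s within ?S)" if "s \<in> ?S" for s
    proof -
      have "((\<lambda>h. f (y + s *\<^sub>R v + h *\<^sub>R v)) has_vector_derivative f' (y + s *\<^sub>R v)) (at (s - s))"
        using d near[OF that] by simp
      moreover have "((\<lambda>u. u - s) has_vector_derivative 1) (at s)"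
        by (auto intro!: derivative_eq_intros)
      ultimately have "((\<lambda>h. f (y + s *\<^sub>R v + h *\<^sub>R v)) \<circ> (\<lambda>u. u - s)
          has_vector_derivative 1 *\<^sub>R f' (y + s *\<^sub>R v)) (at s)"
        by (intro vector_diff_chain_at) auto
      moreover have "(\<lambda>h. f (y + s *\<^sub>R v + h *\<^sub>R v)) \<circ> (\<lambda>u. u - s) = (\<lambda>u. f (y + u *\<^sub>R v))"
        by (auto simp: fun_eq_iff algebra_simps)
      ultimately have "((\<lambda>u. f (y + u *\<^sub>R v)) has_vector_derivative f' (y + s *\<^sub>R v)) (at s)"
        by simp
      then have "((\<lambda>u. f (y + u *\<^sub>R v) - u *\<^sub>R f' x) has_vector_derivative
          f' (y + s *\<^sub>R v) - f' x) (at s)"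
        by (auto intro!: derivative_eq_intros)
      then show ?thesis
        unfolding has_vector_derivative_def by (rule has_derivative_at_withinI)
    qed
    have "norm ((f (y + t *\<^sub>R v) - t *\<^sub>R f' x) - (f (y + 0 *\<^sub>R v) - 0 *\<^sub>R f' x)) \<le> \<epsilon> * norm (t - 0)"
    proof (rule differentiable_bound[where S="?S" and f'="\<lambda>s h. h *\<^sub>R (f' (y + s *\<^sub>R v) - f' x)"])
      show "onorm (\<lambda>h. h *\<^sub>R (f' (y + s *\<^sub>R v) - f' x)) \<le> \<epsilon>" if "s \<in> ?S" for s
      proof (rule onorm_le)
        have "norm (f' (y + s *\<^sub>R v) - f' x) \<le> \<epsilon>"
          using r2(2) near[OF that] by (metis dist_norm less_imp_le)
        then show "norm (h *\<^sub>R (f' (y + s *\<^sub>R v) - f' x)) \<le> \<epsilon> * norm h" for h :: real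
          by (metis mult.commute mult_left_mono norm_ge_zero norm_scaleR real_norm_def)
      qed
    qed (use der in auto)
    then show ?thesis by (simp add: algebra_simps)
  qed
  then show "\<exists>\<delta>>0. \<forall>y\<in>P. \<forall>t. dist y x < \<delta> \<longrightarrow> \<bar>t\<bar> < \<delta> \<longrightarrow>
      norm (f (y + t *\<^sub>R v) - f y - t *\<^sub>R f' x) \<le> \<epsilon> * \<bar>t\<bar>" using \<open>\<delta> > 0\<close> by blast
qed

lemma Ck_on_strict_partial:
  assumes "subspace P" "v \<in> P" "openin (top_of_set P) U" "x \<in> U" "Ck_on B (Suc n) U f" "v \<in> B"
  shows "strict_partial P v f x (partial v f x)"
proof (rule C1_imp_strict_partial[OF assms(1-4)])
  show "has_partial v f y (partial v f y)" if "y \<in> U" for y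
    using Ck_on_has_partial[OF assms(5,6) that] .
  have "Ck_on B n U (partial v f)" using assms(5,6) by simp
  then show "continuous_on U (partial v f)" by (rule Ck_on_imp_continuous_on)
qed

section \<open>The Cauchy-Riemann operator on complex functions\<close>

definition dbar :: "(complex \<Rightarrow> complex) \<Rightarrow> complex \<Rightarrow> complex" where
  "dbar G z = (partial 1 G z + \<i> * partial \<i> G z) / 2"

lemma dbar_cong:
  assumes "open D" "\<And>z. z \<in> D \<Longrightarrow> F z = G z" "z \<in> D"
  shows "dbar F z = dbar G z"
  unfolding dbar_def by (simp add: partial_cong[OF eventually_on_line[OF assms(1,3)] assms(2)])

lemma dbar_pow_cong:
  assumes "open D" "\<And>z. z \<in> D \<Longrightarrow> F z = G z" "z \<in> D"
  shows "(dbar ^^ n) F z = (dbar ^^ n) G z"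
  using assms(3) by (induction n arbitrary: z) (auto intro: assms(2) dbar_cong[OF assms(1)])

lemma Ck_dbar:
  assumes "open D" "Ck_complex (Suc n) D G"
  shows "Ck_complex n D (dbar G)"
proof -
  have "Ck_complex n D (\<lambda>z. (1 / 2) *\<^sub>R (partial 1 G z + \<i> * partial \<i> G z))"
    using assms(2)
    by (intro Ck_on_bounded_linear[OF line_open_if_open[OF assms(1)] bounded_linear_scaleR_right]
        Ck_on_add Ck_on_mult Ck_on_const line_open_if_open assms(1)) auto
  moreover have "dbar G = (\<lambda>z. (1 / 2) *\<^sub>R (partial 1 G z + \<i> * partial \<i> G z))"
    by (simp add: dbar_def fun_eq_iff scaleR_conv_of_real)
  ultimately show ?thesis by simp
qed

lemma Ck_dbar_pow:
  "open D \<Longrightarrow> Ck_complex (n + k) D G \<Longrightarrow> Ck_complex k D ((dbar ^^ n) G)"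
  by (induction n arbitrary: k) (auto intro!: Ck_dbar simp del: Ck_on.simps)

lemma dbar_eqI:
  "has_partial 1 G z p \<Longrightarrow> has_partial \<i> G z q \<Longrightarrow> dbar G z = (p + \<i> * q) / 2"
  by (simp add: dbar_def partialI)

lemma dbar_diff:
  assumes "Ck_complex (Suc n) D F" "Ck_complex (Suc n) D G" "z \<in> D"
  shows "dbar (\<lambda>w. F w - G w) z = dbar F z - dbar G z"
proof -
  have "dbar (\<lambda>w. F w - G w) z =
      ((partial 1 F z - partial 1 G z) + \<i> * (partial \<i> F z - partial \<i> G z)) / 2"
    using assms by (intro dbar_eqI has_partial_diff Ck_on_has_partial[where B = "{1, \<i>}"]) auto
  then show ?thesis
    by (simp only:) (simp add: dbar_def diff_divide_distrib add_divide_distrib algebra_simps)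
qed

lemma dbar_pow_diff:
  assumes "open D" "Ck_complex n D F" "Ck_complex n D G" "z \<in> D"
  shows "(dbar ^^ n) (\<lambda>w. F w - G w) z = (dbar ^^ n) F z - (dbar ^^ n) G z"
  using assms(2-4)
proof (induction n arbitrary: z)
  case (Suc n)
  have "(dbar ^^ Suc n) (\<lambda>w. F w - G w) z = dbar (\<lambda>w. (dbar ^^ n) F w - (dbar ^^ n) G w) z"
    using Suc.IH[OF Ck_on_SucD[OF Suc.prems(1)] Ck_on_SucD[OF Suc.prems(2)]] Suc.prems(3)
    by (auto intro: dbar_cong[OF assms(1)])
  also have "\<dots> = (dbar ^^ Suc n) F z - (dbar ^^ Suc n) G z"
    using dbar_diff[of 0 D "(dbar ^^ n) F" "(dbar ^^ n) G" z] Ck_dbar_pow[OF assms(1), of n 1] Suc.prems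
    by simp
  finally show ?case .
qed simp

lemma dbar_sum:
  assumes "\<And>i. i \<in> A \<Longrightarrow> Ck_complex (Suc n) D (F i)" "z \<in> D"
  shows "dbar (\<lambda>w. \<Sum>i\<in>A. F i w) z = (\<Sum>i\<in>A. dbar (F i) z)"
proof -
  have p: "has_partial v (F i) z (partial v (F i) z)" if "v \<in> {1, \<i>}" "i \<in> A" for v i
    by (rule Ck_on_has_partial[OF assms(1)[OF that(2)] that(1) assms(2)])
  have "dbar (\<lambda>w. \<Sum>i\<in>A. F i w) z = ((\<Sum>i\<in>A. partial 1 (F i) z) + \<i> * (\<Sum>i\<in>A. partial \<i> (F i) z)) / 2"
    by (intro dbar_eqI has_partial_sum p) auto
  then show ?thesis
    by (simp only:) (simp add: dbar_def sum_distrib_left sum.distrib sum_divide_distrib add_divide_distrib)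
qed

lemma holomorphic_has_partial:
  assumes "H holomorphic_on D" "open D" "z \<in> D"
  shows "has_partial v H z (v * deriv H z)"
proof -
  have "(H has_field_derivative deriv H z) (at (z + 0 *\<^sub>R v))"
    using assms holomorphic_derivI by fastforce
  moreover have "((\<lambda>t. z + t *\<^sub>R v) has_vector_derivative v) (at 0)"
    by (auto intro!: derivative_eq_intros)
  ultimately show ?thesis
    using field_vector_diff_chain_at[of "\<lambda>t. z + t *\<^sub>R v" v 0 H] by (simp add: o_def)
qed

lemma holomorphic_imp_Ck:
  assumes "open D" "H holomorphic_on D"
  shows "Ck_complex n D H"
  using assms(2)
proof (induction n arbitrary: H)
  case 0
  then show ?case by (simp add: holomorphic_on_imp_continuous_on)
next
  case (Suc n)
  show ?case
  proof (rule Ck_on_SucI[OF line_open_if_open[OF assms(1)]])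
    show "continuous_on D H" using Suc.prems by (rule holomorphic_on_imp_continuous_on)
    show "has_partial v H z (v * deriv H z)" if "z \<in> D" for v z
      using holomorphic_has_partial[OF Suc.prems assms(1) that] .
    show "Ck_complex n D (\<lambda>z. v * deriv H z)" for v
      using Suc.prems assms(1) by (intro Suc.IH holomorphic_intros)
  qed
qed

lemma dbar_holomorphic:
  assumes "H holomorphic_on D" "open D" "z \<in> D"
  shows "dbar H z = 0"
  using dbar_eqI[OF holomorphic_has_partial[OF assms] holomorphic_has_partial[OF assms]]
  by (simp add: algebra_simps)

text \<open>
  Continuous partial derivatives give total differentiability, after which the equation
  \<open>dbar G = 0\<close> says that the differential is complex linear.
\<close>

lemma dbar_zero_imp_holomorphic:
  assumes "open D" "Ck_complex 1 D G" "\<And>z. z \<in> D \<Longrightarrow> dbar G z = 0"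
  shows "G holomorphic_on D"
  unfolding holomorphic_on_open[OF assms(1)]
proof
  fix z assume z: "z \<in> D"
  define p where "p = partial 1 G z"
  have "partial 1 G z + \<i> * partial \<i> G z = 0"
    using assms(3)[OF z] by (simp add: dbar_def)
  then have q: "partial \<i> G z = \<i> * p"
    by (auto simp: p_def complex_eq_iff)
  have strict: "strict_partial UNIV v G z (partial v G z)" if "v \<in> {1, \<i>}" for v
    using that assms(1,2) z
    by (intro Ck_on_strict_partial[of UNIV v D z "{1, \<i>}" 0]) auto
  have "(G has_derivative (*) p) (at z)"
    unfolding has_derivative_at_alt
  proof (intro conjI allI impI bounded_linear_mult_right)
    fix \<epsilon> :: real assume "\<epsilon> > 0"
    then have h: "\<epsilon> / 2 > 0" by simp
    obtain \<delta>1 where \<delta>1: "\<delta>1 > 0" "\<And>y t. y \<in> UNIV \<Longrightarrow> dist y z < \<delta>1 \<Longrightarrow> \<bar>t\<bar> < \<delta>1 \<Longrightarrow>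
       norm (G (y + t *\<^sub>R 1) - G y - t *\<^sub>R p) \<le> \<epsilon> / 2 * \<bar>t\<bar>"
      using strict_partialD[OF strict[of 1] h] p_def by auto
    obtain \<delta>2 where \<delta>2: "\<delta>2 > 0" "\<And>y t. y \<in> UNIV \<Longrightarrow> dist y z < \<delta>2 \<Longrightarrow> \<bar>t\<bar> < \<delta>2 \<Longrightarrow>
       norm (G (y + t *\<^sub>R \<i>) - G y - t *\<^sub>R (\<i> * p)) \<le> \<epsilon> / 2 * \<bar>t\<bar>"
      using strict_partialD[OF strict[of \<i>] h] q by auto
    have "norm (G y - G z - p * (y - z)) \<le> \<epsilon> * norm (y - z)" if "norm (y - z) < min \<delta>1 \<delta>2" for y
    proof -
      define a b where "a = Re (y - z)" and "b = Im (y - z)"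
      have ab: "\<bar>a\<bar> \<le> norm (y - z)" "\<bar>b\<bar> \<le> norm (y - z)"
        unfolding a_def b_def by (rule abs_Re_le_cmod abs_Im_le_cmod)+
      have y: "y = z + a *\<^sub>R 1 + b *\<^sub>R \<i>"
        by (simp add: complex_eq_iff a_def b_def)
      have "norm (G (z + a *\<^sub>R 1 + b *\<^sub>R \<i>) - G (z + a *\<^sub>R 1) - b *\<^sub>R (\<i> * p)) \<le> \<epsilon> / 2 * \<bar>b\<bar>"
        using ab that by (intro \<delta>2(2)) (auto simp: dist_norm)
      moreover have "norm (G (z + a *\<^sub>R 1) - G z - a *\<^sub>R p) \<le> \<epsilon> / 2 * \<bar>a\<bar>"
        using ab that \<delta>1(1) by (intro \<delta>1(2)) (auto simp: dist_norm)
      ultimately have "norm ((G y - G (z + a *\<^sub>R 1) - b *\<^sub>R (\<i> * p)) + (G (z + a *\<^sub>R 1) - G z - a *\<^sub>R p))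
          \<le> \<epsilon> / 2 * \<bar>b\<bar> + \<epsilon> / 2 * \<bar>a\<bar>"
        unfolding y by (rule norm_triangle_mono)
      also have "\<dots> \<le> \<epsilon> / 2 * norm (y - z) + \<epsilon> / 2 * norm (y - z)"
        using ab \<open>\<epsilon> > 0\<close> by (intro add_mono mult_left_mono) auto
      also have "\<dots> = \<epsilon> * norm (y - z)" by simp
      finally have *: "norm ((G y - G (z + a *\<^sub>R 1) - b *\<^sub>R (\<i> * p)) + (G (z + a *\<^sub>R 1) - G z - a *\<^sub>R p))
          \<le> \<epsilon> * norm (y - z)" .
      have "p * (y - z) = a *\<^sub>R p + b *\<^sub>R (\<i> * p)"
        by (simp add: y scaleR_conv_of_real algebra_simps)
      then have "(G y - G (z + a *\<^sub>R 1) - b *\<^sub>R (\<i> * p)) + (G (z + a *\<^sub>R 1) - G z - a *\<^sub>R p)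
          = G y - G z - p * (y - z)" by (simp only:) (simp add: algebra_simps)
      with * show ?thesis by simp
    qed
    then show "\<exists>\<delta>>0. \<forall>y. norm (y - z) < \<delta> \<longrightarrow> norm (G y - G z - p * (y - z)) \<le> \<epsilon> * norm (y - z)"
      using \<delta>1(1) \<delta>2(1) by (intro exI[of _ "min \<delta>1 \<delta>2"]) auto
  qed
  then show "\<exists>p. (G has_field_derivative p) (at z)"
    unfolding has_field_derivative_def by blast
qed

section \<open>Polyanalytic functions\<close>

lemma Ck_cnj_pow:
  assumes "open D" "Ck_complex n D H"
  shows "Ck_complex n D (\<lambda>z. cnj z ^ k * H z)"
proof -
  have "Ck_complex n D cnj"
    using Ck_on_bounded_linear[OF line_open_if_open[OF assms(1)] bounded_linear_cnj
        holomorphic_imp_Ck[OF assms(1) holomorphic_on_ident]] .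
  then have "Ck_complex n D (\<lambda>z. cnj z ^ k)"
    by (induction k) (auto intro!: Ck_on_const Ck_on_mult line_open_if_open assms(1) simp del: Ck_on.simps)
  then show ?thesis by (intro Ck_on_mult line_open_if_open assms)
qed

lemma dbar_cnj_pow_mult:
  assumes "open D" "H holomorphic_on D" "z \<in> D"
  shows "dbar (\<lambda>w. cnj w ^ k * H w) z = of_nat k * cnj z ^ (k - 1) * H z"
proof -
  have c: "has_partial v (\<lambda>w. cnj w ^ k) z (of_nat k * cnj v * cnj z ^ (k - 1))" for v
  proof -
    have "((\<lambda>t. cnj (z + t *\<^sub>R v)) has_vector_derivative cnj v) (at 0)"
      by (auto intro!: derivative_eq_intros)
    moreover have "((\<lambda>w. w ^ k) has_field_derivative of_nat k * cnj z ^ (k - 1)) (at (cnj (z + 0 *\<^sub>R v)))"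
      by (auto intro!: derivative_eq_intros)
    ultimately have "((\<lambda>w. w ^ k) \<circ> (\<lambda>t. cnj (z + t *\<^sub>R v)) has_vector_derivative
        cnj v * (of_nat k * cnj z ^ (k - 1))) (at 0)"
      by (rule field_vector_diff_chain_at)
    then show ?thesis by (simp add: o_def mult_ac)
  qed
  have "has_partial v (\<lambda>w. cnj w ^ k * H w) z
      (cnj z ^ k * (v * deriv H z) + of_nat k * cnj v * cnj z ^ (k - 1) * H z)" for v
    using has_partial_bounded_bilinear[OF bounded_bilinear_mult c
        holomorphic_has_partial[OF assms(2,1,3)]] .
  from dbar_eqI[OF this[of 1] this[of \<i>]] show ?thesis
    by (simp add: field_simps)
qed

text \<open>
  On sums \<open>\<Sum>h<n. cnj w ^ h * G h w\<close> the operator \<open>dbar\<close> is formal differentiation with respect to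
  \<open>cnj w\<close>, so each application removes one term.
\<close>

lemma dbar_pow_polyanalytic:
  assumes "open D" "\<And>h. h < n \<Longrightarrow> G h holomorphic_on D" "z \<in> D"
  shows "(dbar ^^ n) (\<lambda>w. \<Sum>h<n. cnj w ^ h * G h w) z = 0"
  using assms(2,3)
proof (induction n arbitrary: G z)
  case (Suc n)
  have "dbar (\<lambda>w. \<Sum>h<Suc n. cnj w ^ h * G h w) w = (\<Sum>h<n. cnj w ^ h * (of_nat (Suc h) * G (Suc h) w))"
    if "w \<in> D" for w
  proof -
    have "dbar (\<lambda>w. \<Sum>h<Suc n. cnj w ^ h * G h w) w = (\<Sum>h<Suc n. dbar (\<lambda>w. cnj w ^ h * G h w) w)"
      using Suc.prems that
      by (intro dbar_sum[of _ 0 D] Ck_cnj_pow holomorphic_imp_Ck assms(1)) auto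
    also have "\<dots> = (\<Sum>h<Suc n. of_nat h * cnj w ^ (h - 1) * G h w)"
      using Suc.prems that by (intro sum.cong dbar_cnj_pow_mult[OF assms(1)]) auto
    also have "\<dots> = (\<Sum>h<n. cnj w ^ h * (of_nat (Suc h) * G (Suc h) w))"
      by (subst sum.lessThan_Suc_shift) (simp add: mult_ac)
    finally show ?thesis .
  qed
  then have "(dbar ^^ n) (dbar (\<lambda>w. \<Sum>h<Suc n. cnj w ^ h * G h w)) z =
      (dbar ^^ n) (\<lambda>w. \<Sum>h<n. cnj w ^ h * (of_nat (Suc h) * G (Suc h) w)) z"
    using Suc.prems(2) by (intro dbar_pow_cong[OF assms(1)]) auto
  also have "\<dots> = 0"
    using Suc.prems by (intro Suc.IH holomorphic_intros) auto
  finally show ?case by (simp only: funpow_Suc_right o_apply)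
qed simp

lemma dbar_pow_cnj_pow_mult:
  assumes "open D" "H holomorphic_on D" "z \<in> D"
  shows "(dbar ^^ n) (\<lambda>w. cnj w ^ n * H w) z = fact n * H z"
  using assms(2,3)
proof (induction n arbitrary: H z)
  case (Suc n)
  have "(dbar ^^ n) (dbar (\<lambda>w. cnj w ^ Suc n * H w)) z =
      (dbar ^^ n) (\<lambda>w. cnj w ^ n * (of_nat (Suc n) * H w)) z"
    using dbar_cnj_pow_mult[OF assms(1) Suc.prems(1), of _ "Suc n"] Suc.prems(2)
    by (intro dbar_pow_cong[OF assms(1)]) (auto simp: mult_ac)
  also have "\<dots> = fact n * (of_nat (Suc n) * H z)"
    using Suc.prems by (intro Suc.IH holomorphic_intros)
  finally show ?case by (simp only: funpow_Suc_right o_apply) (simp add: mult_ac)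
qed simp

text \<open>
  The leading coefficient is, up to a factorial, \<open>(dbar ^^ n) G\<close>. This function is continuous across
  the real axis and holomorphic off it, hence holomorphic. Subtracting the leading term leaves a
  function of the same kind with \<open>n\<close> lowered by one.
\<close>

lemma polyanalytic_decomposition:
  assumes "open D" "Ck_complex n D G" "Ck_complex (Suc n) (D - \<real>) G"
    and "\<And>z. z \<in> D - \<real> \<Longrightarrow> (dbar ^^ Suc n) G z = 0"
  shows "\<exists>H. (\<forall>h\<le>n. H h holomorphic_on D) \<and> (\<forall>z\<in>D. G z = (\<Sum>h\<le>n. cnj z ^ h * H h z))"
  using assms(2-4)
proof (induction n arbitrary: G)
  have o: "open (D - \<real>)"
    using assms(1) closed_complex_Reals by (rule open_Diff)
  have top: "(dbar ^^ n) G holomorphic_on D"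
    if "Ck_complex n D G" "Ck_complex (Suc n) (D - \<real>) G"
      "\<And>z. z \<in> D - \<real> \<Longrightarrow> (dbar ^^ Suc n) G z = 0" for n G
  proof -
    have "Ck_complex 1 (D - \<real>) ((dbar ^^ n) G)"
      using that(2) by (intro Ck_dbar_pow o) simp
    then have hol: "(dbar ^^ n) G holomorphic_on (D - \<real>)"
      by (rule dbar_zero_imp_holomorphic[OF o]) (use that(3) in simp)
    have "Ck_complex 0 D ((dbar ^^ n) G)"
      using that(1) by (intro Ck_dbar_pow assms(1)) simp
    then have "continuous_on D ((dbar ^^ n) G)" by simp
    moreover have "D \<inter> {z. \<i> \<bullet> z < 0} \<subseteq> D - \<real>" "D \<inter> {z. 0 < \<i> \<bullet> z} \<subseteq> D - \<real>"
      by (auto simp: complex_is_Real_iff)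
    ultimately show ?thesis
      using holomorphic_on_paste_across_line[OF assms(1), of \<i> _ 0] holomorphic_on_subset[OF hol]
      by simp
  qed
  {
    case 0
    then have "G holomorphic_on D" using top[of 0 G] by simp
    then show ?case by (intro exI[of _ "\<lambda>_. G"]) simp
  next
    case (Suc n)
    define H where "H z = (dbar ^^ Suc n) G z / fact (Suc n)" for z
    have H: "H holomorphic_on D"
      unfolding H_def using top[OF Suc.prems] by (intro holomorphic_intros) auto
    define G' where "G' z = G z - cnj z ^ Suc n * H z" for z
    have G'_Ck: "Ck_complex k U G'" if "open U" "U \<subseteq> D" "Ck_complex k U G" for k U
    proof -
      have "Ck_complex k U (\<lambda>z. cnj z ^ Suc n * H z)"
        using that holomorphic_on_subset[OF H] by (intro Ck_cnj_pow holomorphic_imp_Ck)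
      then show ?thesis
        unfolding G'_def using that by (intro Ck_on_diff line_open_if_open)
    qed
    have "\<exists>K. (\<forall>h\<le>n. K h holomorphic_on D) \<and> (\<forall>z\<in>D. G' z = (\<Sum>h\<le>n. cnj z ^ h * K h z))"
    proof (rule Suc.IH)
      show "Ck_complex n D G'"
        by (rule G'_Ck[OF assms(1) order_refl Ck_on_SucD[OF Suc.prems(1)]])
      show "Ck_complex (Suc n) (D - \<real>) G'"
        by (rule G'_Ck[OF o Diff_subset Ck_on_SucD[OF Suc.prems(2)]])
      show "(dbar ^^ Suc n) G' z = 0" if "z \<in> D - \<real>" for z
      proof -
        have "(dbar ^^ Suc n) G' z = (dbar ^^ Suc n) G z - (dbar ^^ Suc n) (\<lambda>z. cnj z ^ Suc n * H z) z"
          unfolding G'_def using that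
          by (intro dbar_pow_diff[OF assms(1) Suc.prems(1)] Ck_cnj_pow holomorphic_imp_Ck assms(1) H) simp
        also have "(dbar ^^ Suc n) (\<lambda>z. cnj z ^ Suc n * H z) z = fact (Suc n) * H z"
          by (rule dbar_pow_cnj_pow_mult[OF assms(1) H]) (use that in simp)
        also have "\<dots> = (dbar ^^ Suc n) G z"
          unfolding H_def by (simp del: funpow.simps fact_Suc)
        finally show ?thesis by simp
      qed
    qed
    then obtain K where K: "\<And>h. h \<le> n \<Longrightarrow> K h holomorphic_on D"
      "\<And>z. z \<in> D \<Longrightarrow> G' z = (\<Sum>h\<le>n. cnj z ^ h * K h z)" by blast
    have "G z = (\<Sum>h\<le>Suc n. cnj z ^ h * (K(Suc n := H)) h z)" if "z \<in> D" for z
    proof -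
      have "(\<Sum>h\<le>n. cnj z ^ h * (K(Suc n := H)) h z) = (\<Sum>h\<le>n. cnj z ^ h * K h z)"
        by (rule sum.cong) auto
      then show ?thesis using K(2)[OF that] by (simp add: G'_def algebra_simps)
    qed
    moreover have "\<forall>h\<le>Suc n. (K(Suc n := H)) h holomorphic_on D"
      using K(1) H by (auto simp: le_Suc_eq)
    ultimately show ?case by blast
  }
qed

section \<open>Paravectors in polar form\<close>

text \<open>
  The norm is not submultiplicative; boundedness of the product comes from finite dimension.
\<close>

lemma bounded_bilinear_clifford_mult:
  "bounded_bilinear ((*) :: 'm::{finite,linorder} clifford \<Rightarrow> 'm clifford \<Rightarrow> 'm clifford)"
  unfolding bilinear_conv_bounded_bilinear[symmetric] bilinear_def
  by (auto intro!: linearI simp: algebra_simps)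

lemma bounded_linear_clifford_mult_right:
  "bounded_linear (\<lambda>x :: 'm::{finite,linorder} clifford. a * x)"
  by (rule bounded_bilinear.bounded_linear_right[OF bounded_bilinear_clifford_mult])

lemma bounded_linear_coord: "bounded_linear (\<lambda>x :: 'm::finite clifford. coord x A)"
  unfolding linear_conv_bounded_linear[symmetric] by (auto intro!: linearI)

lemma bounded_linear_Im_part:
  "bounded_linear (Im_part :: 'm::{finite,linorder} clifford \<Rightarrow> 'm clifford)"
  unfolding linear_conv_bounded_linear[symmetric] Im_part_def
  by (auto intro!: linearI simp: sum.distrib scaleR_add_left scaleR_right.sum)

lemma clifford_expand: "x = (\<Sum>A\<in>UNIV. coord x A *\<^sub>R blade A)"
  for x :: "'m::finite clifford"
proof (unfold clifford_eq_iff, intro allI)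
  fix B
  have "coord (\<Sum>A\<in>UNIV. coord x A *\<^sub>R blade A) B = (\<Sum>A\<in>UNIV. if A = B then coord x A else 0)"
    unfolding coord_sum by (rule sum.cong) auto
  then show "coord x B = coord (\<Sum>A\<in>UNIV. coord x A *\<^sub>R blade A) B" by simp
qed

lemma norm_Im_part_sq: "(norm (Im_part x))\<^sup>2 = (\<Sum>j\<in>UNIV. (coord x {j})\<^sup>2)"
proof -
  have "inner (gen j) (gen k) = (if j = k then 1 else (0::real))" for j k :: 'a
  proof -
    have "gen j \<in> Basis" "gen k \<in> Basis" by (simp_all add: Basis_clifford_def)
    moreover have "gen j = gen k \<longleftrightarrow> j = k" by (metis coord_blade singleton_inject zero_neq_one)
    ultimately show ?thesis by (simp add: inner_Basis)
  qed
  note orth = this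
  show ?thesis
    unfolding power2_norm_eq_inner Im_part_def
    by (simp add: inner_sum_left inner_sum_right power2_eq_square orth if_distrib cong: if_cong)
qed

lemma imag_sphere_iff_norm: "I \<in> imag_sphere \<longleftrightarrow> I = Im_part I \<and> norm I = 1"
proof -
  have "norm I = 1 \<longleftrightarrow> (\<Sum>j\<in>UNIV. (coord I {j})\<^sup>2) = 1" if "I = Im_part I"
  proof -
    have "norm I = 1 \<longleftrightarrow> (norm I)\<^sup>2 = 1" by (simp add: power2_eq_1_iff) (smt (verit) norm_ge_zero)
    then show ?thesis using norm_Im_part_sq[of I] that by simp
  qed
  then show ?thesis by (auto simp: imag_sphere_iff)
qed

lemma imag_sphere_sq: "I \<in> imag_sphere \<Longrightarrow> I * I = - 1"
  by (simp add: imag_sphere_def power2_eq_square)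

lemma imag_sphere_sq_mult: "I \<in> imag_sphere \<Longrightarrow> I * (I * x) = - x"
  by (metis imag_sphere_sq mult.assoc mult_minus1)

lemma phi_alt: "phi I z = of_real (Re z) + Im z *\<^sub>R I"
  by (simp add: phi_def of_real_def)

lemma phi_of_real: "phi I (of_real r) = of_real r"
  by (simp add: phi_alt)

lemma phi_uminus: "phi (- I) z = phi I (cnj z)"
  by (simp add: phi_alt)

lemma phi_add: "phi I (z + w) = phi I z + phi I w"
  by (simp add: phi_alt scaleR_add_left)

lemma phi_scaleR: "phi I (r *\<^sub>R z) = r *\<^sub>R phi I z"
  by (simp add: phi_alt of_real_def scaleR_add_right)

lemma phi_mult: "I \<in> imag_sphere \<Longrightarrow> phi I (z * w) = phi I z * phi I w"
  by (simp add: phi_alt of_real_def algebra_simps imag_sphere_sq)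

lemma phi_power: "I \<in> imag_sphere \<Longrightarrow> phi I (z ^ k) = phi I z ^ k"
proof (induction k)
  case 0
  show ?case by (simp add: phi_alt)
qed (simp add: phi_mult)

lemma bounded_linear_phi: "bounded_linear (phi I :: complex \<Rightarrow> 'm::{finite,linorder} clifford)"
  unfolding linear_conv_bounded_linear[symmetric]
  by (rule linearI) (simp_all add: phi_add phi_scaleR)

lemma Im_part_of_real: "Im_part (of_real r) = 0"
  by (simp add: Im_part_def coord_of_real)

lemma coord_imag_sphere: "I \<in> imag_sphere \<Longrightarrow> coord I {} = 0"
  by (metis imag_sphere_iff coord_Im_part(1))

lemma Im_part_phi:
  assumes "I \<in> imag_sphere"
  shows "Im_part (phi I z) = Im z *\<^sub>R I"
proof -
  have "Im_part (phi I z) = Im_part (of_real (Re z)) + Im z *\<^sub>R Im_part I"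
    unfolding phi_alt
    by (simp add: linear_add linear_scale bounded_linear.linear[OF bounded_linear_Im_part])
  then show ?thesis using assms by (simp add: Im_part_of_real imag_sphere_iff)
qed

lemma coord_phi: "I \<in> imag_sphere \<Longrightarrow> coord (phi I z) {} = Re z"
  by (simp add: phi_alt coord_of_real coord_imag_sphere)

lemma conj_phi: "I \<in> imag_sphere \<Longrightarrow> conj_paravec (phi I z) = phi I (cnj z)"
  by (simp add: conj_paravec_def coord_phi Im_part_phi) (simp add: phi_alt)

lemma phi_in_paravectors: "I \<in> imag_sphere \<Longrightarrow> phi I z \<in> paravectors"
  by (simp add: paravectors_iff coord_phi Im_part_phi) (simp add: phi_alt)

lemma inj_phi: "I \<in> imag_sphere \<Longrightarrow> inj (phi I)"
proof (rule injI)
  fix z w assume I: "I \<in> imag_sphere" and eq: "phi I z = phi I w"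
  have "I \<noteq> 0" using I by (auto simp: imag_sphere_iff_norm)
  then show "z = w"
    using coord_phi[OF I, of z] coord_phi[OF I, of w] Im_part_phi[OF I, of z] Im_part_phi[OF I, of w] eq
    by (simp add: complex_eq_iff)
qed

lemma paravector_real_iff: "x \<in> paravectors \<Longrightarrow> x \<in> \<real> \<longleftrightarrow> Im_part x = 0"
  by (metis Im_part_of_real Reals_cases Reals_of_real add.right_neutral paravectors_iff)

lemma phi_real_iff: "I \<in> imag_sphere \<Longrightarrow> phi I z \<in> \<real> \<longleftrightarrow> z \<in> \<real>"
  by (auto simp: paravector_real_iff phi_in_paravectors Im_part_phi complex_is_Real_iff
      imag_sphere_iff_norm)

text \<open>
  The point of the closed upper half-plane with \<open>x = phi (im_dir x) (polar x)\<close> for paravectors \<open>x\<close>.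
\<close>

definition polar :: "'m::{finite,linorder} clifford \<Rightarrow> complex" where
  "polar x = Complex (coord x {}) (norm (Im_part x))"

text \<open>The direction of the imaginary part is taken to be \<open>0\<close> at real points.\<close>

definition im_dir :: "'m::{finite,linorder} clifford \<Rightarrow> 'm clifford" where
  "im_dir x = Im_part x /\<^sub>R norm (Im_part x)"

lemma Re_polar [simp]: "Re (polar x) = coord x {}"
  and Im_polar [simp]: "Im (polar x) = norm (Im_part x)"
  by (simp_all add: polar_def)

lemma polar_phi: "I \<in> imag_sphere \<Longrightarrow> Im z \<ge> 0 \<Longrightarrow> polar (phi I z) = z"
  by (simp add: complex_eq_iff coord_phi Im_part_phi imag_sphere_iff_norm)

lemma im_dir_phi: "I \<in> imag_sphere \<Longrightarrow> Im z > 0 \<Longrightarrow> im_dir (phi I z) = I"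
  by (simp add: im_dir_def Im_part_phi imag_sphere_iff_norm)

lemma polar_real_iff: "x \<in> paravectors \<Longrightarrow> polar x \<in> \<real> \<longleftrightarrow> x \<in> \<real>"
  by (simp add: complex_is_Real_iff paravector_real_iff)

lemma im_dir_in_imag_sphere:
  assumes "x \<in> paravectors" "x \<notin> \<real>"
  shows "im_dir x \<in> imag_sphere"
proof -
  have nz: "Im_part x \<noteq> 0" using assms paravector_real_iff by blast
  have idem: "Im_part (Im_part x) = Im_part x"
    by (simp add: Im_part_def[of "Im_part x"] coord_Im_part) (simp add: Im_part_def)
  have "Im_part (im_dir x) = im_dir x"
    unfolding im_dir_def
    by (simp add: linear_scale[OF bounded_linear.linear[OF bounded_linear_Im_part]] idem)
  moreover have "norm (im_dir x) = 1" using nz by (simp add: im_dir_def)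
  ultimately show ?thesis by (simp add: imag_sphere_iff_norm)
qed

lemma phi_im_dir_polar: "x \<in> paravectors \<Longrightarrow> phi (im_dir x) (polar x) = x"
proof -
  assume "x \<in> paravectors"
  then have "x = of_real (coord x {}) + Im_part x" by (simp add: paravectors_iff)
  then show ?thesis by (cases "Im_part x = 0") (auto simp: phi_alt im_dir_def)
qed

lemma subspace_paravectors: "subspace (paravectors :: 'm::{finite,linorder} clifford set)"
proof -
  have "linear (\<lambda>x :: 'm clifford. of_real (coord x {}) + Im_part x - x)"
    unfolding Im_part_def
    by (rule linearI)
      (simp_all add: sum.distrib scaleR_add_left scaleR_right.sum of_real_def algebra_simps)
  from linear_subspace_kernel[OF this]
  have "subspace {x :: 'm clifford. of_real (coord x {}) + Im_part x - x = 0}" .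
  moreover have "{x :: 'm clifford. of_real (coord x {}) + Im_part x - x = 0} = paravectors"
  proof (intro set_eqI)
    fix x :: "'m clifford"
    show "x \<in> {x. of_real (coord x {}) + Im_part x - x = 0} \<longleftrightarrow> x \<in> paravectors"
      unfolding paravectors_iff mem_Collect_eq right_minus_eq by (rule eq_commute)
  qed
  ultimately show ?thesis by simp
qed

lemma one_in_paravectors: "1 \<in> paravectors"
  using phi_in_paravectors[OF gen_in_imag_sphere, of undefined 1] by (simp add: phi_alt)

lemma imag_sphere_subset_paravectors: "I \<in> imag_sphere \<Longrightarrow> I \<in> paravectors"
  by (simp add: imag_sphere_def)

lemma paravec_basis_subset: "v \<in> paravec_basis \<Longrightarrow> v \<in> paravectors"
  by (auto simp: paravec_basis_def one_in_paravectors imag_sphere_subset_paravectors gen_in_imag_sphere)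

lemma line_open_paravectors:
  assumes "openin (top_of_set paravectors) U"
  shows "line_open paravec_basis U"
proof -
  obtain T where T: "open T" "U = paravectors \<inter> T"
    using assms by (auto simp: openin_open)
  show ?thesis
    unfolding line_open_def
  proof (intro ballI)
    fix x v assume x: "x \<in> U" and v: "v \<in> (paravec_basis :: 'a clifford set)"
    have "\<forall>\<^sub>F t::real in nhds 0. x + t *\<^sub>R v \<in> T"
      using x T by (intro eventually_on_line) auto
    moreover have "x + t *\<^sub>R v \<in> paravectors" for t
      using x T v paravec_basis_subset subspace_paravectors
      by (intro subspace_add subspace_scale) auto
    ultimately show "\<forall>\<^sub>F t in nhds 0. x + t *\<^sub>R v \<in> U"
      using T(2) by (auto elim: eventually_mono)
  qed
qed

lemma continuous_on_polar: "continuous_on U polar"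
proof -
  have "polar = (\<lambda>x. of_real (coord x {}) + \<i> * of_real (norm (Im_part x)))"
    by (auto simp: fun_eq_iff complex_eq_iff)
  show ?thesis
    unfolding \<open>polar = _\<close>
    by (intro continuous_intros bounded_linear.continuous_on[OF bounded_linear_coord]
        bounded_linear.continuous_on[OF bounded_linear_Im_part])
qed

lemma closed_clifford_Reals: "closed (\<real> :: 'm::{finite,linorder} clifford set)"
proof -
  have eq: "\<real> = {x :: 'm clifford. of_real (coord x {}) - x = 0}"
    by (auto simp: coord_of_real elim!: Reals_cases) (metis Reals_of_real)
  have "closed {x :: 'm clifford. of_real (coord x {}) - x = 0}"
    by (intro closed_Collect_eq continuous_intros bounded_linear.continuous_on[OF bounded_linear_coord]
        continuous_on_of_real)
  then show ?thesis by (simp only: eq)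
qed

section \<open>Circular domains that meet the real axis\<close>

locale circular_domain =
  fixes \<Omega> :: "'m::{finite,linorder} clifford set"
  assumes circular: "circular \<Omega>"
    and connected: "connected \<Omega>"
    and openin: "openin (top_of_set paravectors) \<Omega>"
    and meets_Reals: "\<Omega> \<inter> \<real> \<noteq> {}"
begin

abbreviation D :: "complex set" where "D \<equiv> profile \<Omega>"

lemma domain_cases:
  assumes "x \<in> \<Omega>"
  obtains I z where "I \<in> imag_sphere" "z \<in> D" "x = phi I z"
proof -
  have "x \<in> circularization D"
    using assms circular_profile[OF circular] by (rule subst[rotated])
  then show ?thesis using that by (auto simp: circularization_def)
qed

lemma phi_in_domain: "z \<in> D \<Longrightarrow> I \<in> imag_sphere \<Longrightarrow> phi I z \<in> \<Omega>"
  by (simp add: profile_def)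

lemma cnj_in_profile: "z \<in> D \<Longrightarrow> cnj z \<in> D"
  using phi_in_domain[OF _ imag_sphere_uminus] by (simp add: profile_def phi_uminus[symmetric])

lemma phi_in_domain_iff:
  assumes "I \<in> imag_sphere"
  shows "phi I z \<in> \<Omega> \<longleftrightarrow> z \<in> D"
proof
  assume "phi I z \<in> \<Omega>"
  then obtain J w where w: "J \<in> imag_sphere" "w \<in> D" "phi I z = phi J w"
    by (rule domain_cases)
  then show "z \<in> D"
    using phi_eqD[OF assms w(1,3)] cnj_in_profile[OF w(2)] w(2) by auto
qed (simp add: phi_in_domain assms)

lemma domain_subset: "x \<in> \<Omega> \<Longrightarrow> x \<in> paravectors"
  using openin openin_imp_subset by blast

lemma polar_in_profile:
  assumes "x \<in> \<Omega>"
  shows "polar x \<in> D"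
proof -
  obtain I z where I: "I \<in> imag_sphere" and z: "z \<in> D" and x: "x = phi I z"
    using domain_cases[OF assms] .
  show ?thesis
  proof (cases "Im z \<ge> 0")
    case True
    then show ?thesis using I z by (simp add: x polar_phi)
  next
    case False
    then have "polar (phi (- I) (cnj z)) = cnj z"
      using I by (intro polar_phi imag_sphere_uminus) auto
    then show ?thesis using cnj_in_profile[OF z] by (simp add: x phi_uminus)
  qed
qed

lemma open_profile: "open D"
proof -
  obtain T where T: "open T" "\<Omega> = paravectors \<inter> T"
    using openin by (auto simp: openin_open)
  define I where "I = (gen undefined :: 'm clifford)"
  have I: "I \<in> imag_sphere" by (simp add: I_def gen_in_imag_sphere)
  have "D = phi I -` T"
    using phi_in_domain_iff[OF I] phi_in_paravectors[OF I] T(2) by auto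
  moreover have "open (phi I -` T)"
    using T(1) bounded_linear.continuous_on[OF bounded_linear_phi continuous_on_id]
    by (rule open_vimage)
  ultimately show ?thesis by simp
qed

lemma open_profile_nonreal: "open (D - \<real>)"
  using open_profile closed_complex_Reals by (rule open_Diff)

lemma real_point:
  obtains r where "of_real r \<in> D" "of_real r \<in> \<Omega>"
proof -
  obtain r where r: "of_real r \<in> \<Omega>"
    using meets_Reals by (auto elim!: Reals_cases)
  then have "phi (gen undefined) (of_real r) \<in> \<Omega>" by (simp add: phi_of_real)
  then have "of_real r \<in> D" using phi_in_domain_iff[OF gen_in_imag_sphere] by blast
  with r that show ?thesis by blast
qed

text \<open>
  The closed upper half of \<open>D\<close> is the continuous image of \<open>\<Omega>\<close> under \<open>polar\<close>, the lower half is its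
  mirror image, and they share a real point.
\<close>

lemma connected_profile: "connected D"
proof -
  have up: "connected (polar ` \<Omega>)"
    by (rule connected_continuous_image[OF continuous_on_polar connected])
  have "connected (cnj ` polar ` \<Omega>)"
    by (rule connected_continuous_image[OF _ up]) (intro continuous_intros)
  moreover obtain r where r: "of_real r \<in> D" "of_real r \<in> \<Omega>" by (rule real_point)
  have "polar (of_real r :: 'm clifford) = of_real r"
    by (simp add: complex_eq_iff coord_of_real Im_part_of_real)
  with r have "of_real r \<in> polar ` \<Omega>" by (metis image_eqI)
  then have "of_real r \<in> polar ` \<Omega> \<inter> cnj ` polar ` \<Omega>"
    by (metis IntI complex_cnj_complex_of_real image_eqI)
  ultimately have "connected (polar ` \<Omega> \<union> cnj ` polar ` \<Omega>)"
    using up by (intro connected_Un) auto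
  moreover have "D = polar ` \<Omega> \<union> cnj ` polar ` \<Omega>"
  proof
    show "D \<subseteq> polar ` \<Omega> \<union> cnj ` polar ` \<Omega>"
    proof
      fix z assume z: "z \<in> D"
      define I where "I = (gen undefined :: 'm clifford)"
      have I: "I \<in> imag_sphere" by (simp add: I_def gen_in_imag_sphere)
      show "z \<in> polar ` \<Omega> \<union> cnj ` polar ` \<Omega>"
      proof (cases "Im z \<ge> 0")
        case True
        then show ?thesis using polar_phi[OF I True] phi_in_domain[OF z I] by (metis UnI1 image_eqI)
      next
        case False
        then have "polar (phi I (cnj z)) = cnj z" by (intro polar_phi I) simp
        then show ?thesis
          using phi_in_domain[OF cnj_in_profile[OF z] I]
          by (metis UnI2 complex_cnj_cnj image_eqI)
      qed
    qed
    show "polar ` \<Omega> \<union> cnj ` polar ` \<Omega> \<subseteq> D"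
      using polar_in_profile cnj_in_profile by auto
  qed
  ultimately show ?thesis by simp
qed

lemma openin_nonreal: "openin (top_of_set paravectors) (\<Omega> - \<real>)"
proof -
  obtain T where T: "open T" "\<Omega> = paravectors \<inter> T"
    using openin by (auto simp: openin_open)
  have "\<Omega> - \<real> = paravectors \<inter> (T - \<real>)" using T(2) by auto
  then show ?thesis
    using open_Diff[OF T(1) closed_clifford_Reals] by (auto simp: openin_open)
qed

lemma line_open_domain: "line_open paravec_basis \<Omega>"
  and line_open_nonreal: "line_open paravec_basis (\<Omega> - \<real>)"
  using openin openin_nonreal by (simp_all add: line_open_paravectors)

lemma inv_phi: "I \<in> imag_sphere \<Longrightarrow> z \<in> D \<Longrightarrow> inv_into D (phi I) (phi I z) = z"
  using inj_phi by (intro inv_into_f_f) (auto intro: inj_on_subset)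

lemma slice_eq: "I \<in> imag_sphere \<Longrightarrow> \<Omega> \<inter> slice_plane I = phi I ` D"
  using phi_in_domain_iff by (auto simp: slice_plane_def)

end

section \<open>Stem functions and their complex components\<close>

text \<open>
  The value at \<open>\<alpha> + I \<beta>\<close> of the slice function whose stem function has the value \<open>p\<close> at \<open>\<alpha> + i \<beta>\<close>.
\<close>

definition sval :: "'m::{finite,linorder} clifford \<Rightarrow> 'm clifford \<times> 'm clifford \<Rightarrow> 'm clifford" where
  "sval I p = fst p + I * snd p"

text \<open>
  The coefficient of \<open>blade A\<close>, when the complexified algebra is regarded as a complex vector space
  with the blades as basis.
\<close>

definition component :: "'m set \<Rightarrow> 'm::{finite,linorder} clifford \<times> 'm clifford \<Rightarrow> complex" where
  "component A p = Complex (coord (fst p) A) (coord (snd p) A)"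

abbreviation Ck_stem :: "nat \<Rightarrow> complex set \<Rightarrow>
    (complex \<Rightarrow> 'm::{finite,linorder} clifford \<times> 'm clifford) \<Rightarrow> bool" where
  "Ck_stem n U F \<equiv> Ck_complex n U (\<lambda>z. fst (F z)) \<and> Ck_complex n U (\<lambda>z. snd (F z))"

lemma component_eq_iff: "p = q \<longleftrightarrow> (\<forall>A. component A p = component A q)"
  by (auto simp: component_def prod_eq_iff clifford_eq_iff)

lemma component_zero [simp]: "component A 0 = 0"
  by (simp add: component_def complex_eq_iff)

lemma stem_function_iff:
  "stem_function \<Omega> F \<longleftrightarrow> (\<forall>z\<in>profile \<Omega>. \<forall>A. component A (F (cnj z)) = cnj (component A (F z)))"
  by (auto simp: stem_function_def component_def clifford_eq_iff complex_eq_iff)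

lemma induces_iff:
  "induces \<Omega> F f \<longleftrightarrow> (\<forall>z\<in>profile \<Omega>. \<forall>I\<in>imag_sphere. f (phi I z) = sval I (F z))"
  by (simp add: induces_def sval_def)

text \<open>
  Half the sum and half the difference of the values at \<open>I\<close> and \<open>- I\<close> separate the two entries.
\<close>

lemma sval_zero_imp_zero:
  assumes "I \<in> imag_sphere" "sval I p = 0" "sval (- I) p = 0"
  shows "p = 0"
proof -
  have "2 *\<^sub>R fst p = sval I p + sval (- I) p" by (simp add: sval_def scaleR_2)
  then have "fst p = 0" using assms by simp
  then have "I * (I * snd p) = 0" using assms by (simp add: sval_def)
  then have "snd p = 0" using imag_sphere_sq_mult[OF assms(1)] by simp
  with \<open>fst p = 0\<close> show ?thesis by (simp add: prod_eq_iff)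
qed

text \<open>Multiplication by a scalar is componentwise; on values it is multiplication by a paravector.\<close>

lemma sval_mult:
  assumes "I \<in> imag_sphere" "\<And>A. component A q = w * component A p"
  shows "sval I q = phi I w * sval I p"
proof -
  have "fst q = Re w *\<^sub>R fst p - Im w *\<^sub>R snd p" "snd q = Re w *\<^sub>R snd p + Im w *\<^sub>R fst p"
    using assms(2) by (simp_all add: clifford_eq_iff component_def complex_eq_iff)
  then show ?thesis
    using imag_sphere_sq_mult[OF assms(1)]
    by (simp add: sval_def phi_alt of_real_def algebra_simps mult.assoc)
qed

lemma sval_sum:
  assumes "\<And>A. component A q = (\<Sum>h\<in>S. component A (p h))"
  shows "sval I q = (\<Sum>h\<in>S. sval I (p h))"
proof -
  have "fst q = (\<Sum>h\<in>S. fst (p h))" "snd q = (\<Sum>h\<in>S. snd (p h))"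
    using assms by (simp_all add: clifford_eq_iff component_def complex_eq_iff)
  then show ?thesis by (simp add: sval_def sum.distrib sum_distrib_left)
qed

lemma Ck_stem_iff_components:
  fixes F :: "complex \<Rightarrow> 'm::{finite,linorder} clifford \<times> 'm clifford"
  assumes "open U"
  shows "Ck_stem n U F \<longleftrightarrow> (\<forall>A. Ck_complex n U (\<lambda>z. component A (F z)))"
proof (intro iffI conjI allI)
  note o = line_open_if_open[OF assms, of "{1, \<i>}"]
  fix A assume F: "Ck_stem n U F"
  have L: "bounded_linear (\<lambda>x :: 'm clifford. complex_of_real (coord x A))"
    by (rule bounded_linear_compose[OF bounded_linear_of_real bounded_linear_coord])
  have "Ck_complex n U (\<lambda>z. of_real (coord (fst (F z)) A) + \<i> * of_real (coord (snd (F z)) A))"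
    by (intro Ck_on_add[OF o] Ck_on_mult[OF o] Ck_on_const Ck_on_bounded_linear[OF o L]
        conjunct1[OF F] conjunct2[OF F])
  moreover have "(\<lambda>z. component A (F z)) =
      (\<lambda>z. of_real (coord (fst (F z)) A) + \<i> * of_real (coord (snd (F z)) A))"
    by (simp add: fun_eq_iff component_def complex_eq_iff)
  ultimately show "Ck_complex n U (\<lambda>z. component A (F z))" by simp
next
  note o = line_open_if_open[OF assms, of "{1, \<i>}"]
  assume F: "\<forall>A. Ck_complex n U (\<lambda>z. component A (F z))"
  have expand: "fst p = (\<Sum>A\<in>UNIV. Re (component A p) *\<^sub>R blade A)"
    "snd p = (\<Sum>A\<in>UNIV. Im (component A p) *\<^sub>R blade A)" for p :: "'m clifford \<times> 'm clifford"
    unfolding component_def complex.sel by (rule clifford_expand)+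
  have L: "bounded_linear (\<lambda>c. Re c *\<^sub>R b)" "bounded_linear (\<lambda>c. Im c *\<^sub>R b)" for b :: "'m clifford"
    by (auto intro: bounded_linear_compose[OF bounded_linear_scaleR_left]
        bounded_linear_Re bounded_linear_Im)
  show "Ck_complex n U (\<lambda>z. fst (F z))" "Ck_complex n U (\<lambda>z. snd (F z))"
    unfolding expand
    by (intro Ck_on_sum[OF o] Ck_on_bounded_linear[OF o L(1)] Ck_on_bounded_linear[OF o L(2)]
        F[rule_format])+
qed

lemma Ck_stem_cong:
  assumes "open U" "\<And>z. z \<in> U \<Longrightarrow> F z = G z" "Ck_stem n U F"
  shows "Ck_stem n U G"
proof -
  note o = line_open_if_open[OF assms(1), of "{1, \<i>}"]
  show ?thesis
    using assms(2,3) Ck_on_cong[OF o, of "\<lambda>z. fst (F z)" "\<lambda>z. fst (G z)" n]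
      Ck_on_cong[OF o, of "\<lambda>z. snd (F z)" "\<lambda>z. snd (G z)" n]
    by simp
qed

lemma Ck_stem_subset: "Ck_stem n U F \<Longrightarrow> V \<subseteq> U \<Longrightarrow> Ck_stem n V F"
  by (intro conjI Ck_on_subset[of "{1, \<i>}" n U _ V]) auto

lemma Ck_stem_SucD: "Ck_stem (Suc n) U F \<Longrightarrow> Ck_stem n U F"
  using Ck_on_SucD by blast

lemma Ck_dbar_stem:
  assumes "open U" "Ck_stem (Suc n) U F"
  shows "Ck_stem n U (dbar_stem F)"
proof -
  note o = line_open_if_open[OF assms(1), of "{1, \<i>}"]
  have "Ck_complex n U (partial v (\<lambda>z. fst (F z)))" "Ck_complex n U (partial v (\<lambda>z. snd (F z)))"
    if "v \<in> {1, \<i>}" for v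
    using assms(2) that by auto
  then show ?thesis
    unfolding dbar_stem_def fst_conv snd_conv
    by (intro conjI Ck_on_bounded_linear[OF o bounded_linear_scaleR_right]
        Ck_on_add[OF o] Ck_on_diff[OF o]) auto
qed

lemma Ck_dbar_stem_pow:
  assumes "open U"
  shows "Ck_stem (n + k) U F \<Longrightarrow> Ck_stem k U ((dbar_stem ^^ n) F)"
proof (induction n arbitrary: k)
  case (Suc n)
  then have "Ck_stem (Suc k) U ((dbar_stem ^^ n) F)" by (intro Suc.IH) simp
  then show ?case using Ck_dbar_stem[OF assms, of k "(dbar_stem ^^ n) F"] by (simp del: Ck_on.simps)
qed simp

lemma component_dbar_stem:
  assumes "Ck_stem (Suc n) U F" "z \<in> U"
  shows "component A (dbar_stem F z) = dbar (\<lambda>w. component A (F w)) z"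
proof -
  have "has_partial v (\<lambda>w. component A (F w)) z
      (Complex (coord (partial v (\<lambda>w. fst (F w)) z) A) (coord (partial v (\<lambda>w. snd (F w)) z) A))"
    if "v \<in> {1, \<i>}" for v
    unfolding has_vector_derivative_complex_iff component_def complex.sel
      has_real_derivative_iff_has_vector_derivative
    using assms that
    by (intro conjI has_partial_bounded_linear[OF bounded_linear_coord]
        Ck_on_has_partial[where B = "{1, \<i>}" and n = n]) auto
  from dbar_eqI[OF this[of 1] this[of \<i>]] show ?thesis
    by (simp add: component_def dbar_stem_def complex_eq_iff)
qed

lemma component_dbar_stem_pow:
  assumes "open U" "Ck_stem n U F" "z \<in> U"
  shows "component A ((dbar_stem ^^ n) F z) = (dbar ^^ n) (\<lambda>w. component A (F w)) z"
  using assms(2,3)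
proof (induction n arbitrary: z)
  case (Suc n)
  have F: "Ck_stem n U F" using Suc.prems(1) by (rule Ck_stem_SucD)
  have "Ck_stem (Suc 0) U ((dbar_stem ^^ n) F)"
    using Suc.prems by (intro Ck_dbar_stem_pow assms(1)) simp
  then have "component A ((dbar_stem ^^ Suc n) F z) = dbar (\<lambda>w. component A ((dbar_stem ^^ n) F w)) z"
    using component_dbar_stem[of 0 U "(dbar_stem ^^ n) F"] Suc.prems(2) by (simp del: Ck_on.simps)
  also have "\<dots> = (dbar ^^ Suc n) (\<lambda>w. component A (F w)) z"
    using Suc.IH[OF F] Suc.prems(2) by (auto intro: dbar_cong[OF assms(1)])
  finally show ?case .
qed simp

text \<open>
  The reflection \<open>cnj\<close> carries the line through \<open>z\<close> in direction \<open>v\<close> to the line through \<open>cnj z\<close> in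
  direction \<open>cnj v\<close>.
\<close>

lemma has_partial_cnj:
  assumes "open U" "\<And>w. w \<in> U \<Longrightarrow> g (cnj w) = c *\<^sub>R g w" "z \<in> U" "has_partial v g z d"
  shows "has_partial (cnj v) g (cnj z) (c *\<^sub>R d)"
proof -
  have "has_partial v (\<lambda>w. g (cnj w)) z (c *\<^sub>R d)"
  proof -
    have "has_partial v (\<lambda>w. g (cnj w)) z (c *\<^sub>R d) \<longleftrightarrow> has_partial v (\<lambda>w. c *\<^sub>R g w) z (c *\<^sub>R d)"
      by (rule has_partial_cong[OF eventually_on_line[OF assms(1,3)] assms(2)])
    then show ?thesis
      using has_partial_bounded_linear[OF bounded_linear_scaleR_right assms(4)] by blast
  qed
  then show ?thesis by simp
qed

text \<open>
  The symmetry of stem functions is treated on an open set \<open>U\<close> in place of the profile, because it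
  is also used where differentiability is only known off the real axis.
\<close>

lemma dbar_stem_reflection:
  assumes "open U" "\<And>w. w \<in> U \<Longrightarrow> F (cnj w) = (fst (F w), - snd (F w))"
    and "Ck_stem (Suc n) U F" "z \<in> U"
  shows "dbar_stem F (cnj z) = (fst (dbar_stem F z), - snd (dbar_stem F z))"
proof -
  have p: "has_partial v (\<lambda>w. fst (F w)) z (partial v (\<lambda>w. fst (F w)) z)"
    "has_partial v (\<lambda>w. snd (F w)) z (partial v (\<lambda>w. snd (F w)) z)" if "v \<in> {1, \<i>}" for v
    using assms(3,4) that by (intro Ck_on_has_partial[where B = "{1, \<i>}"]; auto)+
  have c: "fst (F (cnj w)) = 1 *\<^sub>R fst (F w)" "snd (F (cnj w)) = (- 1) *\<^sub>R snd (F w)" if "w \<in> U" for w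
    by (simp_all add: assms(2)[OF that])
  have q: "has_partial (cnj v) (\<lambda>w. fst (F w)) (cnj z) (1 *\<^sub>R partial v (\<lambda>w. fst (F w)) z)"
    "has_partial (cnj v) (\<lambda>w. snd (F w)) (cnj z) ((- 1) *\<^sub>R partial v (\<lambda>w. snd (F w)) z)"
    if "v \<in> {1, \<i>}" for v
    using has_partial_cnj[OF assms(1) c(1) assms(4) p(1)[OF that]]
      has_partial_cnj[OF assms(1) c(2) assms(4) p(2)[OF that]] by auto
  have "partial 1 (\<lambda>w. fst (F w)) (cnj z) = partial 1 (\<lambda>w. fst (F w)) z"
    "partial 1 (\<lambda>w. snd (F w)) (cnj z) = - partial 1 (\<lambda>w. snd (F w)) z"
    using partialI[OF q(1)[of 1]] partialI[OF q(2)[of 1]] by simp_all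
  moreover have "partial \<i> (\<lambda>w. fst (F w)) (cnj z) = - partial \<i> (\<lambda>w. fst (F w)) z"
    "partial \<i> (\<lambda>w. snd (F w)) (cnj z) = partial \<i> (\<lambda>w. snd (F w)) z"
    using partialI[OF has_partial_scale_direction[OF q(1)[of \<i>], of "- 1"]]
      partialI[OF has_partial_scale_direction[OF q(2)[of \<i>], of "- 1"]] by simp_all
  ultimately show ?thesis by (simp add: dbar_stem_def scaleR_right_diff_distrib scaleR_right_distrib)
qed

lemma dbar_stem_pow_reflection:
  assumes "open U" "\<And>w. w \<in> U \<Longrightarrow> F (cnj w) = (fst (F w), - snd (F w))"
    and "Ck_stem n U F" "z \<in> U"
  shows "(dbar_stem ^^ n) F (cnj z) = (fst ((dbar_stem ^^ n) F z), - snd ((dbar_stem ^^ n) F z))"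
  using assms(3,4)
proof (induction n arbitrary: z)
  case (Suc n)
  have F: "Ck_stem n U F" using Suc.prems(1) by (rule Ck_stem_SucD)
  have "Ck_stem (Suc 0) U ((dbar_stem ^^ n) F)"
    using Suc.prems by (intro Ck_dbar_stem_pow assms(1)) simp
  from dbar_stem_reflection[OF assms(1) Suc.IH[OF F] this Suc.prems(2)]
  show ?case by simp
qed (simp add: assms(2))

lemma stem_function_reflection:
  "stem_function \<Omega> F \<longleftrightarrow> (\<forall>z\<in>profile \<Omega>. F (cnj z) = (fst (F z), - snd (F z)))"
  by (auto simp: stem_function_def prod_eq_iff)

lemma (in circular_domain) stem_function_dbar_stem_pow:
  assumes "stem_function \<Omega> F" "Ck_stem n D F"
  shows "stem_function \<Omega> ((dbar_stem ^^ n) F)"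
  using dbar_stem_pow_reflection[OF open_profile _ assms(2)] assms(1)
  by (simp add: stem_function_reflection)

section \<open>The operators on slices\<close>

abbreviation slice_op :: "'m::{finite,linorder} clifford \<Rightarrow> (complex \<Rightarrow> 'm clifford) \<Rightarrow>
    complex \<Rightarrow> 'm clifford" where
  "slice_op I \<equiv> (\<lambda>G z. partial 1 G z + I * partial \<i> G z)"

lemma has_partial_sval:
  assumes "Ck_stem (Suc n) U F" "v \<in> {1, \<i>}" "z \<in> U"
  shows "has_partial v (\<lambda>w. sval I (F w)) z
    (sval I (partial v (\<lambda>w. fst (F w)) z, partial v (\<lambda>w. snd (F w)) z))"
  unfolding sval_def fst_conv snd_conv
  using assms
  by (intro has_partial_add has_partial_bounded_linear[OF bounded_linear_clifford_mult_right]
      Ck_on_has_partial[where B = "{1, \<i>}" and n = n]) auto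

text \<open>
  Since \<open>sval I\<close> turns multiplication of the pair by the imaginary unit into left multiplication by
  \<open>I\<close>, it intertwines the Cauchy-Riemann operators. The scalar \<open>r\<close> accommodates the factors 2 that
  accumulate under iteration.
\<close>

lemma slice_op_sval:
  assumes "open U" "I \<in> imag_sphere" "Ck_stem (Suc n) U F" "z \<in> U"
    and "\<And>w. w \<in> U \<Longrightarrow> g w = r *\<^sub>R sval I (F w)"
  shows "slice_op I g z = (2 * r) *\<^sub>R sval I (dbar_stem F z)"
proof -
  have p: "partial v g z = r *\<^sub>R sval I (partial v (\<lambda>w. fst (F w)) z, partial v (\<lambda>w. snd (F w)) z)"
    if "v \<in> {1, \<i>}" for v
  proof -
    have "partial v g z = partial v (\<lambda>w. r *\<^sub>R sval I (F w)) z"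
      by (rule partial_cong[OF eventually_on_line[OF assms(1,4)] assms(5)])
    also have "\<dots> = r *\<^sub>R sval I (partial v (\<lambda>w. fst (F w)) z, partial v (\<lambda>w. snd (F w)) z)"
      by (rule partialI[OF has_partial_bounded_linear[OF bounded_linear_scaleR_right
              has_partial_sval[OF assms(3) that assms(4)]]])
    finally show ?thesis .
  qed
  have "2 *\<^sub>R sval I (dbar_stem F z) =
      sval I (partial 1 (\<lambda>w. fst (F w)) z, partial 1 (\<lambda>w. snd (F w)) z) +
      I * sval I (partial \<i> (\<lambda>w. fst (F w)) z, partial \<i> (\<lambda>w. snd (F w)) z)"
    by (simp add: sval_def dbar_stem_def algebra_simps imag_sphere_sq_mult[OF assms(2)])
  moreover have "(2 * r) *\<^sub>R sval I (dbar_stem F z) = r *\<^sub>R 2 *\<^sub>R sval I (dbar_stem F z)"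
    by simp
  ultimately show ?thesis
    by (simp only:) (simp add: p scaleR_right_distrib)
qed

lemma slice_op_pow_sval:
  assumes "open U" "I \<in> imag_sphere" "Ck_stem n U F" "z \<in> U"
    and "\<And>w. w \<in> U \<Longrightarrow> g w = sval I (F w)"
  shows "(slice_op I ^^ n) g z = 2 ^ n *\<^sub>R sval I ((dbar_stem ^^ n) F z)"
  using assms(3,4)
proof (induction n arbitrary: z)
  case (Suc n)
  have F: "Ck_stem n U F" using Suc.prems(1) by (rule Ck_stem_SucD)
  have "Ck_stem (Suc 0) U ((dbar_stem ^^ n) F)"
    using Suc.prems by (intro Ck_dbar_stem_pow assms(1)) simp
  from slice_op_sval[OF assms(1,2) this Suc.prems(2) Suc.IH[OF F]]
  show ?case by simp
qed (simp add: assms(5))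

lemma (in circular_domain) dbar_slice_eq:
  assumes "induces \<Omega> F f" "Ck_stem n D F" "z \<in> D" "I \<in> imag_sphere"
  shows "dbar_slice n I \<Omega> f (phi I z) = sval I ((dbar_stem ^^ n) F z)"
proof -
  have "(slice_op I ^^ n) (f \<circ> phi I) z = 2 ^ n *\<^sub>R sval I ((dbar_stem ^^ n) F z)"
    by (rule slice_op_pow_sval[OF open_profile assms(4,2,3)])
      (use assms(1,4) in \<open>simp add: induces_iff\<close>)
  then show ?thesis by (simp add: dbar_slice_def inv_phi[OF assms(4,3)])
qed

text \<open>
  The stem function chosen in the definition need not be \<open>F\<close>, but it agrees with \<open>F\<close> on \<open>D\<close>, and \<open>D\<close>
  is open.
\<close>

lemma (in circular_domain) dbar_slice_fun_eq:
  assumes "stem_function \<Omega> F" "induces \<Omega> F f" "Ck_stem n D F" "z \<in> D" "I \<in> imag_sphere"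
  shows "dbar_slice_fun n \<Omega> f (phi I z) = sval I ((dbar_stem ^^ n) F z)"
proof -
  define G where "G = stem_of \<Omega> f"
  have G: "stem_function \<Omega> G \<and> induces \<Omega> G f"
    unfolding G_def stem_of_def by (rule someI[of _ F]) (simp add: assms)
  have FG: "F w = G w" if "w \<in> D" for w
    using stem_unique[OF assms(2) conjunct2[OF G] that] .
  have C: "Ck_stem n D G"
    by (rule Ck_stem_cong[OF open_profile FG assms(3)])
  have "induces \<Omega> ((dbar_stem ^^ n) G) (slice_fun_of \<Omega> ((dbar_stem ^^ n) G))"
    using G C by (intro induces_slice_fun_of stem_function_dbar_stem_pow) auto
  then have "dbar_slice_fun n \<Omega> f (phi I z) = sval I ((dbar_stem ^^ n) G z)"
    using assms(4,5) by (simp add: dbar_slice_fun_def G_def induces_iff)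
  also have "(dbar_stem ^^ n) G z = (dbar_stem ^^ n) F z"
    unfolding component_eq_iff component_dbar_stem_pow[OF open_profile C assms(4)]
      component_dbar_stem_pow[OF open_profile assms(3,4)]
    by (intro allI dbar_pow_cong[OF open_profile _ assms(4)]) (simp add: FG)
  finally show ?thesis .
qed

section \<open>Slice functions off the real axis\<close>

lemma inner_blade: "inner x (blade A) = coord x A"
  unfolding inner_clifford_def coord_blade by (simp add: if_distrib cong: if_cong)

lemma Im_part_one [simp]: "Im_part 1 = 0"
  using Im_part_of_real[of 1] by simp

lemma Im_part_gen [simp]: "Im_part (gen j) = gen j"
  by (metis gen_in_imag_sphere imag_sphere_iff)

lemma coord_one: "coord 1 A = (if A = {} then 1 else 0)"
  by (simp add: one_clifford_def)

lemma Im_part_line: "Im_part (x + t *\<^sub>R v) = Im_part x + t *\<^sub>R Im_part v"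
  by (simp add: linear_add linear_scale bounded_linear.linear[OF bounded_linear_Im_part])

lemma has_partial_norm_Im_part:
  assumes "Im_part x \<noteq> 0"
  shows "has_partial v (\<lambda>y. norm (Im_part y)) x (inner (Im_part x) (Im_part v) / norm (Im_part x))"
proof -
  have "((\<lambda>t. Im_part x + t *\<^sub>R Im_part v) has_derivative (\<lambda>h. h *\<^sub>R Im_part v)) (at 0)"
    by (auto intro!: derivative_eq_intros)
  moreover have "(norm has_derivative (\<lambda>h. inner h (sgn (Im_part x)))) (at (Im_part x + 0 *\<^sub>R Im_part v))"
    using has_derivative_norm[OF assms] by simp
  ultimately have "((\<lambda>t. norm (Im_part x + t *\<^sub>R Im_part v)) has_derivative
      (\<lambda>h. inner (h *\<^sub>R Im_part v) (sgn (Im_part x)))) (at 0)"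
    by (rule has_derivative_compose)
  moreover have "(\<lambda>h. inner (h *\<^sub>R Im_part v) (sgn (Im_part x))) =
      (\<lambda>h. h *\<^sub>R (inner (Im_part x) (Im_part v) / norm (Im_part x)))"
    by (simp add: fun_eq_iff sgn_div_norm inner_commute divide_inverse mult_ac)
  ultimately show ?thesis
    by (simp only: has_vector_derivative_def Im_part_line)
qed

lemma has_partial_inverse_norm_Im_part:
  assumes "Im_part x \<noteq> 0"
  shows "has_partial v (\<lambda>y. inverse (norm (Im_part y))) x
    (- inner (Im_part x) (Im_part v) * inverse (norm (Im_part x)) ^ 3)"
proof -
  have "((\<lambda>t. norm (Im_part (x + t *\<^sub>R v))) has_real_derivative
      inner (Im_part x) (Im_part v) / norm (Im_part x)) (at 0)"
    unfolding has_real_derivative_iff_has_vector_derivative by (rule has_partial_norm_Im_part[OF assms])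
  from DERIV_inverse_fun[OF this] assms show ?thesis
    unfolding has_real_derivative_iff_has_vector_derivative[symmetric]
    by (simp add: field_simps power3_eq_cube power2_eq_square)
qed

text \<open>
  Along a basis direction either the real or the imaginary coordinate of \<open>polar\<close> moves, so the
  one-dimensional chain rule suffices.
\<close>

lemma has_partial_comp_polar:
  assumes "Im_part x \<noteq> 0" "v \<in> paravec_basis"
    and p: "has_partial 1 G (polar x) p" and q: "has_partial \<i> G (polar x) q"
  shows "has_partial v (\<lambda>y. G (polar y)) x
    (coord v {} *\<^sub>R p + (inner (Im_part x) (Im_part v) * inverse (norm (Im_part x))) *\<^sub>R q)"
proof (cases "v = 1")
  case True
  have "polar (x + t *\<^sub>R 1) = polar x + t *\<^sub>R 1" for t
    by (simp add: complex_eq_iff Im_part_line coord_one)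
  then show ?thesis using p by (simp add: True coord_one)
next
  case False
  then obtain j where v: "v = gen j" using assms(2) by (auto simp: paravec_basis_def)
  define \<rho> where "\<rho> t = norm (Im_part (x + t *\<^sub>R v)) - norm (Im_part x)" for t
  have "(\<rho> has_vector_derivative inner (Im_part x) (Im_part v) / norm (Im_part x)) (at 0)"
    unfolding \<rho>_def by (auto intro!: derivative_eq_intros has_partial_norm_Im_part assms)
  moreover have "((\<lambda>s. G (polar x + s *\<^sub>R \<i>)) has_vector_derivative q) (at (\<rho> 0))"
    using q by (simp add: \<rho>_def)
  ultimately have "((\<lambda>s. G (polar x + s *\<^sub>R \<i>)) \<circ> \<rho> has_vector_derivative
      (inner (Im_part x) (Im_part v) / norm (Im_part x)) *\<^sub>R q) (at 0)"
    by (rule vector_diff_chain_at)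
  moreover have "polar (x + t *\<^sub>R v) = polar x + \<rho> t *\<^sub>R \<i>" for t
    by (simp add: complex_eq_iff \<rho>_def v)
  ultimately show ?thesis by (simp add: o_def v divide_inverse)
qed

lemma has_partial_im_dir:
  assumes "Im_part x \<noteq> 0"
  shows "has_partial v im_dir x (inverse (norm (Im_part x)) *\<^sub>R Im_part v -
    (inner (Im_part x) (Im_part v) * inverse (norm (Im_part x)) ^ 3) *\<^sub>R Im_part x)"
proof -
  have "has_partial v Im_part x (Im_part v)"
    unfolding Im_part_line by (auto intro!: derivative_eq_intros)
  from has_partial_bounded_bilinear[OF bounded_bilinear_scaleR
      has_partial_inverse_norm_Im_part[OF assms] this]
  show ?thesis by (simp add: im_dir_def[abs_def])
qed

lemma Ck_on_ident: "line_open B U \<Longrightarrow> Ck_on B n U (\<lambda>x. x)"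
proof (cases n)
  case (Suc k)
  assume "line_open B U"
  then show ?thesis
    unfolding Suc
    by (rule Ck_on_SucI[where f' = "\<lambda>v x. v"])
      (auto intro!: Ck_on_const derivative_eq_intros continuous_intros)
qed simp

context circular_domain
begin

lemma Im_part_nonreal: "x \<in> \<Omega> - \<real> \<Longrightarrow> Im_part x \<noteq> 0"
  using paravector_real_iff domain_subset by blast

lemma polar_nonreal: "x \<in> \<Omega> - \<real> \<Longrightarrow> polar x \<in> D - \<real>"
  using polar_real_iff domain_subset polar_in_profile by blast

lemma Ck_Im_part: "Ck_on paravec_basis n (\<Omega> - \<real>) Im_part"
  by (rule Ck_on_bounded_linear[OF line_open_nonreal bounded_linear_Im_part
        Ck_on_ident[OF line_open_nonreal]])

lemma Ck_inner_Im_part: "Ck_on paravec_basis n (\<Omega> - \<real>) (\<lambda>x. inner (Im_part x) c)"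
  by (rule Ck_on_bounded_linear[OF line_open_nonreal bounded_linear_inner_left Ck_Im_part])

lemma Ck_inverse_norm_Im_part:
  "Ck_on paravec_basis n (\<Omega> - \<real>) (\<lambda>x. inverse (norm (Im_part x)))"
proof -
  note o = line_open_nonreal
  have c: "continuous_on (\<Omega> - \<real>) (\<lambda>x. inverse (norm (Im_part x)))"
    using Im_part_nonreal
    by (intro continuous_intros bounded_linear.continuous_on[OF bounded_linear_Im_part]) auto
  show ?thesis
  proof (induction n)
    case 0
    show ?case using c by simp
  next
    case (Suc n)
    have "Ck_on paravec_basis n (\<Omega> - \<real>) (\<lambda>x. inverse (norm (Im_part x)) ^ 3)"
      unfolding power3_eq_cube by (intro Ck_on_mult[OF o] Suc.IH)
    then have "Ck_on paravec_basis n (\<Omega> - \<real>)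
        (\<lambda>x. inner (Im_part x) (- Im_part v) * inverse (norm (Im_part x)) ^ 3)" for v
      by (intro Ck_on_mult[OF o] Ck_inner_Im_part)
    then show ?case
      using has_partial_inverse_norm_Im_part Im_part_nonreal
      by (intro Ck_on_SucI[OF o c, where f' =
            "\<lambda>v x. inner (Im_part x) (- Im_part v) * inverse (norm (Im_part x)) ^ 3"]) auto
  qed
qed

lemma Ck_comp_polar:
  "Ck_complex n (D - \<real>) G \<Longrightarrow> Ck_on paravec_basis n (\<Omega> - \<real>) (\<lambda>x. G (polar x))"
proof (induction n arbitrary: G)
  case 0
  have "polar ` (\<Omega> - \<real>) \<subseteq> D - \<real>" using polar_nonreal by blast
  then show ?case
    using 0 continuous_on_compose2[OF _ continuous_on_polar, of "D - \<real>" G "\<Omega> - \<real>"] by simp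
next
  case (Suc n)
  note o = line_open_nonreal
  define f' where "f' v x = coord v {} *\<^sub>R partial 1 G (polar x) +
      (inner (Im_part x) (Im_part v) * inverse (norm (Im_part x))) *\<^sub>R partial \<i> G (polar x)"
    for v x :: "'m clifford"
  show ?case
  proof (rule Ck_on_SucI[OF o])
    have "polar ` (\<Omega> - \<real>) \<subseteq> D - \<real>" using polar_nonreal by blast
    then show "continuous_on (\<Omega> - \<real>) (\<lambda>x. G (polar x))"
      using Ck_on_imp_continuous_on[OF Suc.prems]
        continuous_on_compose2[OF _ continuous_on_polar, of "D - \<real>" G "\<Omega> - \<real>"] by simp
    show "has_partial v (\<lambda>x. G (polar x)) x (f' v x)" if "v \<in> paravec_basis" "x \<in> \<Omega> - \<real>" for v x
      unfolding f'_def
      using that Im_part_nonreal polar_nonreal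
      by (intro has_partial_comp_polar Ck_on_has_partial[OF Suc.prems]) auto
    show "Ck_on paravec_basis n (\<Omega> - \<real>) (f' v)" for v
      unfolding f'_def using Suc.prems
      by (intro Ck_on_add[OF o] Ck_on_scaleR[OF o] Ck_on_mult[OF o] Ck_on_const Ck_inner_Im_part
          Ck_inverse_norm_Im_part Suc.IH) auto
  qed
qed

lemma induces_polar:
  assumes "induces \<Omega> F f" "x \<in> \<Omega> - \<real>"
  shows "f x = sval (im_dir x) (F (polar x))"
proof -
  have "x \<in> paravectors" using assms(2) domain_subset by blast
  then show ?thesis
    using assms(1) polar_in_profile[of x] im_dir_in_imag_sphere[of x] assms(2) phi_im_dir_polar[of x]
    unfolding induces_iff by force
qed

lemma Ck_slice_function_nonreal:
  assumes "Ck_stem n (D - \<real>) F" "\<And>x. x \<in> \<Omega> - \<real> \<Longrightarrow> f x = sval (im_dir x) (F (polar x))"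
  shows "Ck_on paravec_basis n (\<Omega> - \<real>) f"
proof -
  note o = line_open_nonreal
  have "Ck_on paravec_basis n (\<Omega> - \<real>) (\<lambda>x. sval (im_dir x) (F (polar x)))"
    unfolding sval_def im_dir_def using assms(1)
    by (intro Ck_on_add[OF o] Ck_on_bounded_bilinear[OF o bounded_bilinear_clifford_mult]
        Ck_on_scaleR[OF o] Ck_inverse_norm_Im_part Ck_Im_part Ck_comp_polar) auto
  then show ?thesis using assms(2) by (rule Ck_on_transfer[OF o])
qed

lemma has_partial_slice_function:
  assumes "Ck_stem (Suc n) (D - \<real>) F" "\<And>x. x \<in> \<Omega> - \<real> \<Longrightarrow> f x = sval (im_dir x) (F (polar x))"
    and "x \<in> \<Omega> - \<real>" "v \<in> paravec_basis"
  shows "has_partial v f x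
    (coord v {} *\<^sub>R sval (im_dir x) (partial 1 (\<lambda>w. fst (F w)) (polar x), partial 1 (\<lambda>w. snd (F w)) (polar x)) +
     (inner (Im_part x) (Im_part v) * inverse (norm (Im_part x))) *\<^sub>R
       sval (im_dir x) (partial \<i> (\<lambda>w. fst (F w)) (polar x), partial \<i> (\<lambda>w. snd (F w)) (polar x)) +
     (inverse (norm (Im_part x)) *\<^sub>R Im_part v -
       (inner (Im_part x) (Im_part v) * inverse (norm (Im_part x)) ^ 3) *\<^sub>R Im_part x) * snd (F (polar x)))"
    (is "has_partial v f x ?d")
proof -
  have nz: "Im_part x \<noteq> 0" and D: "polar x \<in> D - \<real>"
    using Im_part_nonreal polar_nonreal assms(3) by auto
  note F = conjunct1[OF assms(1)] conjunct2[OF assms(1)]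
  have p: "has_partial v (\<lambda>y. fst (F (polar y))) x
      (coord v {} *\<^sub>R partial 1 (\<lambda>w. fst (F w)) (polar x) +
       (inner (Im_part x) (Im_part v) * inverse (norm (Im_part x))) *\<^sub>R partial \<i> (\<lambda>w. fst (F w)) (polar x))"
    by (rule has_partial_comp_polar[OF nz assms(4) Ck_on_has_partial[OF F(1) _ D]
          Ck_on_has_partial[OF F(1) _ D]]) auto
  have q: "has_partial v (\<lambda>y. snd (F (polar y))) x
      (coord v {} *\<^sub>R partial 1 (\<lambda>w. snd (F w)) (polar x) +
       (inner (Im_part x) (Im_part v) * inverse (norm (Im_part x))) *\<^sub>R partial \<i> (\<lambda>w. snd (F w)) (polar x))"
    by (rule has_partial_comp_polar[OF nz assms(4) Ck_on_has_partial[OF F(2) _ D]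
          Ck_on_has_partial[OF F(2) _ D]]) auto
  have "has_partial v (\<lambda>y. sval (im_dir y) (F (polar y))) x ?d"
    unfolding sval_def fst_conv snd_conv
    by (rule has_vector_derivative_eq_rhs[OF has_partial_add[OF p
          has_partial_bounded_bilinear[OF bounded_bilinear_clifford_mult has_partial_im_dir[OF nz] q]]])
      (simp add: algebra_simps)
  moreover have "has_partial v f x ?d \<longleftrightarrow> has_partial v (\<lambda>y. sval (im_dir y) (F (polar y))) x ?d"
    by (rule has_partial_cong[OF line_openD[OF line_open_nonreal assms(4,3)] assms(2)])
  ultimately show ?thesis by simp
qed

text \<open>
  The sum of the \<open>coord x {h} *\<^sub>R partial (gen h)\<close> is \<open>\<rho>\<close> times the radial derivative. The direction
  \<open>im_dir\<close> is constant along rays, so the terms from differentiating it cancel and what remains is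
  \<open>\<rho>\<close> times the derivative of the stem function in the imaginary direction.
\<close>

lemma theta_bar_slice_function:
  assumes "Ck_stem (Suc n) (D - \<real>) F" "\<And>x. x \<in> \<Omega> - \<real> \<Longrightarrow> f x = sval (im_dir x) (F (polar x))"
    and "x \<in> \<Omega> - \<real>"
  shows "theta_bar f x = sval (im_dir x) (dbar_stem F (polar x))"
proof -
  define \<rho> where "\<rho> = norm (Im_part x)"
  define I where "I = im_dir x"
  define a where "a = sval I (partial 1 (\<lambda>w. fst (F w)) (polar x), partial 1 (\<lambda>w. snd (F w)) (polar x))"
  define b where "b = sval I (partial \<i> (\<lambda>w. fst (F w)) (polar x), partial \<i> (\<lambda>w. snd (F w)) (polar x))"
  define c where "c = snd (F (polar x))"
  have nz: "\<rho> > 0" using Im_part_nonreal[OF assms(3)] by (simp add: \<rho>_def)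
  have I: "I \<in> imag_sphere"
    unfolding I_def by (rule im_dir_in_imag_sphere) (use assms(3) domain_subset in auto)
  have Im: "Im_part x = \<rho> *\<^sub>R I" using nz by (simp add: I_def im_dir_def \<rho>_def)
  have d: "partial v f x = coord v {} *\<^sub>R a + (inner (Im_part x) (Im_part v) * inverse \<rho>) *\<^sub>R b +
      (inverse \<rho> *\<^sub>R Im_part v - (inner (Im_part x) (Im_part v) * inverse \<rho> ^ 3) *\<^sub>R Im_part x) * c"
    if "v \<in> paravec_basis" for v
    using partialI[OF has_partial_slice_function[OF assms that]]
    by (simp only: \<rho>_def I_def a_def b_def c_def)
  have d0: "partial 1 f x = a"
    by (subst d) (simp_all add: paravec_basis_def coord_one)
  have dj: "coord x {j} *\<^sub>R partial (gen j) f x =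
      ((coord x {j})\<^sup>2 * inverse \<rho>) *\<^sub>R b +
      (inverse \<rho> *\<^sub>R (coord x {j} *\<^sub>R gen j) - ((coord x {j})\<^sup>2 * inverse \<rho> ^ 3) *\<^sub>R Im_part x) * c" for j
    by (subst d) (simp_all add: paravec_basis_def inner_blade coord_Im_part power2_eq_square algebra_simps)
  have "(\<Sum>j\<in>UNIV. coord x {j} *\<^sub>R partial (gen j) f x) =
      ((\<Sum>j\<in>UNIV. (coord x {j})\<^sup>2) * inverse \<rho>) *\<^sub>R b +
      (inverse \<rho> *\<^sub>R Im_part x - ((\<Sum>j\<in>UNIV. (coord x {j})\<^sup>2) * inverse \<rho> ^ 3) *\<^sub>R Im_part x) * c"
    unfolding dj
    by (simp add: sum.distrib sum_subtractf scaleR_sum_left[symmetric] sum_distrib_right[symmetric]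
        scaleR_right.sum[symmetric] Im_part_def[of x, symmetric] del: scaleR_scaleR)
  also have "(\<Sum>j\<in>UNIV. (coord x {j})\<^sup>2) = \<rho>\<^sup>2"
    unfolding \<rho>_def norm_Im_part_sq ..
  also have "\<rho>\<^sup>2 * inverse \<rho> = \<rho>" using nz by (simp add: power2_eq_square)
  also have "\<rho>\<^sup>2 * inverse \<rho> ^ 3 = inverse \<rho>" using nz by (simp add: power2_eq_square power3_eq_cube field_simps)
  finally have "(\<Sum>j\<in>UNIV. coord x {j} *\<^sub>R partial (gen j) f x) = \<rho> *\<^sub>R b" by simp
  moreover have "Im_part x /\<^sub>R \<rho>\<^sup>2 = inverse \<rho> *\<^sub>R I"
    using nz by (simp add: Im power2_eq_square)
  ultimately have "theta_bar f x = (1 / 2) *\<^sub>R (a + I * b)"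
    using nz by (simp add: theta_bar_def d0 \<rho>_def[symmetric])
  also have "\<dots> = sval I (dbar_stem F (polar x))"
    by (simp add: a_def b_def sval_def dbar_stem_def algebra_simps imag_sphere_sq_mult[OF I])
  finally show ?thesis by (simp add: I_def)
qed

lemma theta_bar_pow_slice_function:
  assumes "Ck_stem n (D - \<real>) F" "\<And>x. x \<in> \<Omega> - \<real> \<Longrightarrow> f x = sval (im_dir x) (F (polar x))"
    and "x \<in> \<Omega> - \<real>"
  shows "(theta_bar ^^ n) f x = sval (im_dir x) ((dbar_stem ^^ n) F (polar x))"
  using assms(1,3)
proof (induction n arbitrary: x)
  case (Suc n)
  have F: "Ck_stem n (D - \<real>) F" using Suc.prems(1) by (rule Ck_stem_SucD)
  have "Ck_stem (Suc 0) (D - \<real>) ((dbar_stem ^^ n) F)"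
    using Suc.prems by (intro Ck_dbar_stem_pow open_profile_nonreal) simp
  from theta_bar_slice_function[OF this Suc.IH[OF F] Suc.prems(2)]
  show ?case by simp
qed (simp add: assms(2))

text \<open>
  The components of the stem function are recovered on the planes through a generator, where the
  derivative in the imaginary direction is one of the available coordinate derivatives.
\<close>

lemma Ck_stem_nonreal:
  assumes "stem_function \<Omega> F" "induces \<Omega> F f" "Ck_on paravec_basis n (\<Omega> - \<real>) f"
  shows "Ck_stem n (D - \<real>) F"
proof -
  define I where "I = (gen undefined :: 'm clifford)"
  have I: "I \<in> imag_sphere" "- I \<in> imag_sphere"
    by (simp_all add: I_def gen_in_imag_sphere imag_sphere_uminus)
  note o = line_open_if_open[OF open_profile_nonreal, of "{1, \<i>}"]
  have C: "Ck_complex n (D - \<real>) (\<lambda>z. f (phi J z))" if J: "J = c *\<^sub>R I" "J \<in> imag_sphere" for J c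
  proof (rule Ck_on_compose_axis_linear[OF o _ _ _ _ assms(3)])
    show "linear (phi J)" by (rule bounded_linear.linear[OF bounded_linear_phi])
    show "continuous_on (D - \<real>) (phi J)"
      by (rule bounded_linear.continuous_on[OF bounded_linear_phi continuous_on_id])
    show "phi J ` (D - \<real>) \<subseteq> \<Omega> - \<real>"
      using phi_in_domain phi_real_iff J(2) by blast
    show "(if w = 1 then 1 else I) \<in> paravec_basis \<and>
        phi J w = (if w = 1 then 1 else c) *\<^sub>R (if w = 1 then 1 else I)" if "w \<in> {1, \<i>}" for w
      using that J(1) by (auto simp: paravec_basis_def I_def phi_alt)
  qed
  have fI: "Ck_complex n (D - \<real>) (\<lambda>z. f (phi I z))" using C[of I 1] I by simp
  have fI': "Ck_complex n (D - \<real>) (\<lambda>z. f (phi (- I) z))" using C[of "- I" "- 1"] I by simp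
  have fst: "fst (F z) = (1 / 2) *\<^sub>R (f (phi I z) + f (phi (- I) z))" if "z \<in> D - \<real>" for z
    using assms(2) that I by (simp add: induces_def scaleR_2[symmetric])
  have snd: "snd (F z) = (- 1 / 2) *\<^sub>R (I * (f (phi I z) - f (phi (- I) z)))" if "z \<in> D - \<real>" for z
    using assms(2) that I
    by (simp add: induces_def algebra_simps imag_sphere_sq_mult scaleR_2[symmetric])
  have C: "Ck_complex n (D - \<real>) (\<lambda>z. (1 / 2) *\<^sub>R (f (phi I z) + f (phi (- I) z)))"
    "Ck_complex n (D - \<real>) (\<lambda>z. (- 1 / 2) *\<^sub>R (I * (f (phi I z) - f (phi (- I) z))))"
    by (intro Ck_on_bounded_linear[OF o bounded_linear_scaleR_right]
        Ck_on_bounded_linear[OF o bounded_linear_clifford_mult_right]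
        Ck_on_add[OF o] Ck_on_diff[OF o] fI fI')+
  show ?thesis
    by (rule conjI, rule Ck_on_transfer[OF o C(1) fst], assumption,
        rule Ck_on_transfer[OF o C(2) snd])
qed

end

section \<open>Differentiability across the real axis\<close>

text \<open>
  The coefficients \<open>c\<close> will be built from \<open>im_dir\<close>, which is bounded but has no limit at real
  points; the factor that vanishes there restores continuity.
\<close>

lemma continuous_on_bounded_times_vanishing:
  assumes prd: "bounded_bilinear prd" and Z: "closed Z"
    and c: "continuous_on (S - Z) c" "\<And>x. x \<in> S \<Longrightarrow> norm (c x) \<le> K"
    and Q: "continuous_on S Q" "\<And>x. x \<in> S \<Longrightarrow> x \<in> Z \<Longrightarrow> Q x = 0"
  shows "continuous_on S (\<lambda>x. prd (c x) (Q x))"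
  unfolding continuous_on_def
proof
  fix x assume x: "x \<in> S"
  show "((\<lambda>x. prd (c x) (Q x)) \<longlongrightarrow> prd (c x) (Q x)) (at x within S)"
  proof (cases "x \<in> Z")
    case False
    have "at x within S = at x within (S - Z)"
      using False Z by (intro at_within_nhd[of x "- Z"]) auto
    moreover have "(c \<longlongrightarrow> c x) (at x within (S - Z))"
      using c(1) x False by (simp add: continuous_on_def)
    moreover have "(Q \<longlongrightarrow> Q x) (at x within S)"
      using Q(1) x by (simp add: continuous_on_def)
    ultimately show ?thesis using bounded_bilinear.tendsto[OF prd] by simp
  next
    case True
    obtain C where C: "\<And>a b. norm (prd a b) \<le> norm a * norm b * C" "C > 0"
      using bounded_bilinear.pos_bounded[OF prd] by blast
    have Q0: "Q x = 0" using Q(2) x True by blast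
    have "(Q \<longlongrightarrow> 0) (at x within S)"
      using Q(1) x Q0 unfolding continuous_on_def by metis
    then have "((\<lambda>y. K * norm (Q y) * C) \<longlongrightarrow> K * 0 * C) (at x within S)"
      by (intro tendsto_intros tendsto_norm_zero)
    then have lim: "((\<lambda>y. K * norm (Q y) * C) \<longlongrightarrow> 0) (at x within S)" by simp
    have "\<forall>\<^sub>F y in at x within S. norm (prd (c y) (Q y)) \<le> K * norm (Q y) * C"
    proof -
      have "norm (prd (c y) (Q y)) \<le> K * norm (Q y) * C" if "y \<in> S" for y
      proof (rule order_trans[OF C(1)])
        show "norm (c y) * norm (Q y) * C \<le> K * norm (Q y) * C"
          using c(2)[OF that] C(2) by (intro mult_right_mono) auto
      qed
      then show ?thesis by (auto simp: eventually_at_filter)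
    qed
    then have "((\<lambda>y. prd (c y) (Q y)) \<longlongrightarrow> 0) (at x within S)"
      by (rule Lim_null_comparison[OF _ lim])
    then show ?thesis using bounded_bilinear.zero_right[OF prd] Q0 by simp
  qed
qed

lemma norm_im_dir: "norm (im_dir x) \<le> 1"
  by (cases "Im_part x = 0") (simp_all add: im_dir_def)

context circular_domain
begin

lemma continuous_on_comp_polar: "continuous_on D Q \<Longrightarrow> continuous_on \<Omega> (\<lambda>x. Q (polar x))"
  using polar_in_profile by (intro continuous_on_compose2[OF _ continuous_on_polar]) auto

lemma continuous_on_im_dir: "continuous_on (\<Omega> - \<real>) im_dir"
proof -
  have "continuous_on (\<Omega> - \<real>) (\<lambda>x. Im_part x /\<^sub>R norm (Im_part x))"
    using Im_part_nonreal
    by (intro continuous_intros bounded_linear.continuous_on[OF bounded_linear_Im_part]) auto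
  then show ?thesis by (simp add: im_dir_def[abs_def])
qed

lemma continuous_on_bounded_times_comp_polar:
  assumes "bounded_bilinear prd" "continuous_on (\<Omega> - \<real>) c" "\<And>x. x \<in> \<Omega> \<Longrightarrow> norm (c x) \<le> K"
    and "continuous_on D Q" "\<And>z. z \<in> D \<Longrightarrow> z \<in> \<real> \<Longrightarrow> Q z = 0"
  shows "continuous_on \<Omega> (\<lambda>x. prd (c x) (Q (polar x)))"
proof (rule continuous_on_bounded_times_vanishing[OF assms(1) closed_clifford_Reals assms(2,3)])
  show "continuous_on \<Omega> (\<lambda>x. Q (polar x))" by (rule continuous_on_comp_polar[OF assms(4)])
  show "Q (polar x) = 0" if "x \<in> \<Omega>" "x \<in> \<real>" for x
    using assms(5) polar_in_profile that polar_real_iff domain_subset by blast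
qed

lemma continuous_on_sval:
  assumes "continuous_on D P" "continuous_on D Q" "\<And>z. z \<in> D \<Longrightarrow> z \<in> \<real> \<Longrightarrow> Q z = 0"
  shows "continuous_on \<Omega> (\<lambda>x. sval (im_dir x) (P (polar x), Q (polar x)))"
  unfolding sval_def fst_conv snd_conv
  by (intro continuous_on_add continuous_on_comp_polar[OF assms(1)]
      continuous_on_bounded_times_comp_polar[OF bounded_bilinear_clifford_mult continuous_on_im_dir _ assms(2,3)])
    (rule norm_im_dir)

lemma induces_polar_all:
  assumes "stem_function \<Omega> F" "induces \<Omega> F f" "x \<in> \<Omega>"
  shows "f x = sval (im_dir x) (F (polar x))"
proof (cases "x \<in> \<real>")
  case True
  have x: "x \<in> paravectors" using domain_subset[OF assms(3)] .
  have D: "polar x \<in> D" by (rule polar_in_profile[OF assms(3)])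
  have "cnj (polar x) = polar x" using polar_real_iff[OF x] True by (simp add: Reals_cnj_iff)
  then have "snd (F (polar x)) = - snd (F (polar x))"
    using assms(1) D unfolding stem_function_def by metis
  then have "2 *\<^sub>R snd (F (polar x)) = 0" by (simp add: scaleR_2 eq_neg_iff_add_eq_0)
  then have 0: "snd (F (polar x)) = 0" by simp
  have "Im_part x = 0" using paravector_real_iff[OF x] True by simp
  then have "phi (gen undefined) (polar x) = x"
    using x by (simp add: phi_alt paravectors_iff)
  then have "f x = sval (gen undefined) (F (polar x))"
    using assms(2) D gen_in_imag_sphere unfolding induces_iff by metis
  then show ?thesis by (simp add: sval_def 0)
next
  case False
  then show ?thesis using induces_polar[OF assms(2)] assms(3) by simp
qed

text \<open>
  The odd part \<open>F2\<close> of a stem function vanishes on the real axis, so \<open>F2 / Im\<close> extends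
  continuously by the derivative of \<open>F2\<close>; in terms of the extension, the coordinate derivatives of
  the slice function have no singularity at real points.
\<close>

lemma continuous_on_divided_Im:
  fixes g :: "complex \<Rightarrow> 'b::real_normed_vector"
  assumes "Ck_complex 1 D g" "\<And>z. z \<in> D \<Longrightarrow> z \<in> \<real> \<Longrightarrow> g z = 0"
  shows "continuous_on D (\<lambda>z. if z \<in> \<real> then partial \<i> g z else g z /\<^sub>R Im z)" (is "continuous_on D ?H")
proof -
  have off: "continuous_on (D - \<real>) ?H"
  proof -
    have "continuous_on (D - \<real>) g"
      using continuous_on_subset[OF Ck_on_imp_continuous_on[OF assms(1)]] by blast
    then have "continuous_on (D - \<real>) (\<lambda>z. g z /\<^sub>R Im z)"
      by (intro continuous_intros) (auto simp: complex_is_Real_iff)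
    then show ?thesis by (rule continuous_on_eq) auto
  qed
  have "isCont ?H z" if z: "z \<in> D" for z
  proof (cases "z \<in> \<real>")
    case False
    then show ?thesis
      using off z continuous_on_eq_continuous_at[OF open_profile_nonreal] by blast
  next
    case True
    define d where "d = partial \<i> g z"
    have "continuous_on D (partial \<i> g)" using assms(1) by simp
    then have cont: "isCont (partial \<i> g) z"
      using z continuous_on_eq_continuous_at[OF open_profile] by blast
    have strict: "strict_partial UNIV \<i> g z d"
      unfolding d_def using assms(1) z open_profile
      by (intro Ck_on_strict_partial[of UNIV \<i> D z "{1, \<i>}" 0]) auto
    show ?thesis
      unfolding continuous_at_eps_delta
    proof (intro allI impI)
      fix \<epsilon> :: real assume "\<epsilon> > 0"
      then have h: "\<epsilon> / 2 > 0" by simp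
      obtain \<delta>1 where \<delta>1: "\<delta>1 > 0" "\<And>y t. dist y z < \<delta>1 \<Longrightarrow> \<bar>t\<bar> < \<delta>1 \<Longrightarrow>
          norm (g (y + t *\<^sub>R \<i>) - g y - t *\<^sub>R d) \<le> \<epsilon> / 2 * \<bar>t\<bar>"
        using strict_partialD[OF strict h] by auto
      obtain \<delta>2 where \<delta>2: "\<delta>2 > 0" "\<And>y. dist y z < \<delta>2 \<Longrightarrow> dist (partial \<i> g y) d < \<epsilon>"
        using cont \<open>\<epsilon> > 0\<close> unfolding continuous_at_eps_delta d_def by blast
      obtain \<delta>3 where \<delta>3: "\<delta>3 > 0" "\<And>y. dist y z < \<delta>3 \<Longrightarrow> y \<in> D"
        using open_profile z unfolding open_dist by blast
      have "dist (?H w) (?H z) < \<epsilon>" if w: "dist w z < min \<delta>1 (min \<delta>2 \<delta>3)" for w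
      proof (cases "w \<in> \<real>")
        case True
        then show ?thesis using \<delta>2(2)[of w] w \<open>z \<in> \<real>\<close> by (simp add: d_def)
      next
        case False
        define y where "y = complex_of_real (Re w)"
        have wy: "w = y + Im w *\<^sub>R \<i>" by (simp add: y_def complex_eq_iff)
        have Imw: "Im w \<noteq> 0" using False by (simp add: complex_is_Real_iff)
        have Imz: "Im z = 0" using True by (simp add: complex_is_Real_iff)
        have "dist y z \<le> dist w z"
          using abs_Re_le_cmod[of "w - z"] Imz by (simp add: y_def dist_norm cmod_def)
        moreover have "\<bar>Im w\<bar> \<le> dist w z"
          using abs_Im_le_cmod[of "w - z"] Imz by (simp add: dist_norm)
        ultimately have "norm (g (y + Im w *\<^sub>R \<i>) - g y - Im w *\<^sub>R d) \<le> \<epsilon> / 2 * \<bar>Im w\<bar>" "y \<in> D"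
          using w \<delta>1(2) \<delta>3(2) by auto
        then have "norm (g w - Im w *\<^sub>R d) \<le> \<epsilon> / 2 * \<bar>Im w\<bar>"
          using assms(2)[of y] wy by (simp add: y_def)
        moreover have "g w - Im w *\<^sub>R d = Im w *\<^sub>R (g w /\<^sub>R Im w - d)"
          using Imw by (simp add: scaleR_diff_right)
        ultimately have "\<bar>Im w\<bar> * norm (g w /\<^sub>R Im w - d) \<le> \<bar>Im w\<bar> * (\<epsilon> / 2)"
          by (simp add: mult.commute)
        then have "norm (g w /\<^sub>R Im w - d) \<le> \<epsilon> / 2" using Imw by simp
        then show ?thesis using False True \<open>\<epsilon> > 0\<close> by (simp add: dist_norm d_def)
      qed
      then show "\<exists>\<delta>>0. \<forall>w. dist w z < \<delta> \<longrightarrow> dist (?H w) (?H z) < \<epsilon>"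
        using \<delta>1(1) \<delta>2(1) \<delta>3(1) by (intro exI[of _ "min \<delta>1 (min \<delta>2 \<delta>3)"]) auto
    qed
  qed
  then show ?thesis by (simp add: continuous_at_imp_continuous_on)
qed

text \<open>
  On the real axis the reflection fixes the point and reverses the imaginary direction, so there the
  odd expressions equal their own negatives.
\<close>

lemma partial_stem_real:
  assumes "stem_function \<Omega> F" "Ck_stem 1 D F" "z \<in> D" "z \<in> \<real>"
  shows "snd (F z) = 0" "partial \<i> (\<lambda>w. fst (F w)) z = 0" "partial 1 (\<lambda>w. snd (F w)) z = 0"
proof -
  have self: "d = 0" if "d = - d" for d :: "'m clifford"
  proof -
    have "2 *\<^sub>R d = 0" using that by (simp add: scaleR_2 eq_neg_iff_add_eq_0)
    then show ?thesis by simp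
  qed
  have z: "cnj z = z" using assms(4) by (simp add: Reals_cnj_iff)
  show "snd (F z) = 0"
    using assms(1,3) z unfolding stem_function_def by (metis self)
  have c: "fst (F (cnj w)) = 1 *\<^sub>R fst (F w)" "snd (F (cnj w)) = (- 1) *\<^sub>R snd (F w)" if "w \<in> D" for w
    using assms(1) that by (simp_all add: stem_function_def)
  have "has_partial \<i> (\<lambda>w. fst (F w)) z (partial \<i> (\<lambda>w. fst (F w)) z)"
    by (rule Ck_on_has_partial[where B = "{1, \<i>}" and n = 0 and U = D]) (use assms in auto)
  from has_partial_scale_direction[OF has_partial_cnj[OF open_profile c(1) assms(3) this], of "- 1"]
  have "has_partial \<i> (\<lambda>w. fst (F w)) z (- partial \<i> (\<lambda>w. fst (F w)) z)" by (simp add: z)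
  then have "partial \<i> (\<lambda>w. fst (F w)) z = - partial \<i> (\<lambda>w. fst (F w)) z" by (rule partialI)
  then show "partial \<i> (\<lambda>w. fst (F w)) z = 0" by (rule self)
  have "has_partial 1 (\<lambda>w. snd (F w)) z (partial 1 (\<lambda>w. snd (F w)) z)"
    by (rule Ck_on_has_partial[where B = "{1, \<i>}" and n = 0 and U = D]) (use assms in auto)
  from has_partial_cnj[OF open_profile c(2) assms(3) this]
  have "has_partial 1 (\<lambda>w. snd (F w)) z (- partial 1 (\<lambda>w. snd (F w)) z)" by (simp add: z)
  then have "partial 1 (\<lambda>w. snd (F w)) z = - partial 1 (\<lambda>w. snd (F w)) z" by (rule partialI)
  then show "partial 1 (\<lambda>w. snd (F w)) z = 0" by (rule self)
qed

text \<open>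
  Off the real axis the product rule gives the coordinate derivatives. Rewritten with \<open>F2 / Im\<close>,
  every coefficient that is discontinuous at real points is multiplied by a function of \<open>polar x\<close> that
  vanishes on the real axis, and the remaining terms are the derivatives at real points.
\<close>

lemma C1_slice_function:
  assumes stem: "stem_function \<Omega> F" and f: "induces \<Omega> F f" and F: "Ck_stem 1 D F"
  shows "Ck_on paravec_basis 1 \<Omega> f"
proof -
  define p where "p v = partial v (\<lambda>w. fst (F w))" for v
  define q where "q v = partial v (\<lambda>w. snd (F w))" for v
  define H where "H z = (if z \<in> \<real> then q \<i> z else snd (F z) /\<^sub>R Im z)" for z
  note vanish = partial_stem_real[OF stem F]
  have cont: "continuous_on D (p v)" "continuous_on D (q v)" if "v \<in> {1, \<i>}" for v
    using F that by (auto simp: p_def q_def)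
  have contH: "continuous_on D H"
    unfolding H_def[abs_def] q_def by (rule continuous_on_divided_Im) (use F vanish(1) in auto)
  define u where "u v x = inner (im_dir x) (Im_part v)" for v x :: "'m clifford"
  have u: "continuous_on (\<Omega> - \<real>) (u v)" "norm (u v x) \<le> norm (Im_part v)" for v x
  proof -
    show "continuous_on (\<Omega> - \<real>) (u v)"
      unfolding u_def by (intro continuous_on_inner continuous_on_im_dir continuous_on_const)
    have "norm (u v x) \<le> norm (im_dir x) * norm (Im_part v)"
      unfolding u_def using Cauchy_Schwarz_ineq2 by simp
    also have "\<dots> \<le> 1 * norm (Im_part v)" by (intro mult_right_mono norm_im_dir) simp
    finally show "norm (u v x) \<le> norm (Im_part v)" by simp
  qed
  \<comment> \<open>The factors \<open>p \<i>\<close> and \<open>q \<i> - H\<close> of the direction-dependent terms vanish on the real axis.\<close>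
  define f' where "f' v x = coord v {} *\<^sub>R sval (im_dir x) (p 1 (polar x), q 1 (polar x)) +
      u v x *\<^sub>R p \<i> (polar x) + (u v x *\<^sub>R im_dir x) * (q \<i> (polar x) - H (polar x)) +
      Im_part v * H (polar x)" for v x :: "'m clifford"
  have cont_f: "continuous_on \<Omega> f"
  proof -
    have "continuous_on \<Omega> (\<lambda>x. sval (im_dir x) (fst (F (polar x)), snd (F (polar x))))"
      using Ck_on_imp_continuous_on F vanish(1) by (intro continuous_on_sval) auto
    then show ?thesis
      by (rule continuous_on_eq) (simp add: induces_polar_all[OF stem f])
  qed
  have cont_f': "continuous_on \<Omega> (f' v)" for v
  proof -
    have 1: "continuous_on \<Omega> (\<lambda>x. sval (im_dir x) (p 1 (polar x), q 1 (polar x)))"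
      by (rule continuous_on_sval[OF cont(1) cont(2)]) (use vanish(3) in \<open>auto simp: q_def\<close>)
    have 2: "continuous_on \<Omega> (\<lambda>x. u v x *\<^sub>R p \<i> (polar x))"
      by (rule continuous_on_bounded_times_comp_polar[OF bounded_bilinear_scaleR u cont(1)])
        (use vanish(2) in \<open>auto simp: p_def\<close>)
    have 3: "continuous_on \<Omega> (\<lambda>x. (u v x *\<^sub>R im_dir x) * (q \<i> (polar x) - H (polar x)))"
    proof (rule continuous_on_bounded_times_comp_polar[OF bounded_bilinear_clifford_mult])
      show "continuous_on (\<Omega> - \<real>) (\<lambda>x. u v x *\<^sub>R im_dir x)"
        by (intro continuous_on_scaleR u continuous_on_im_dir)
      show "norm (u v x *\<^sub>R im_dir x) \<le> norm (Im_part v) * 1" for x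
        unfolding norm_scaleR using u(2)[of v x] norm_im_dir[of x] by (intro mult_mono) auto
      show "continuous_on D (\<lambda>z. q \<i> z - H z)"
        by (intro continuous_on_diff cont contH) simp
    qed (simp add: H_def)
    have 4: "continuous_on \<Omega> (\<lambda>x. Im_part v * H (polar x))"
      by (intro bounded_linear.continuous_on[OF bounded_linear_clifford_mult_right]
          continuous_on_comp_polar contH)
    show ?thesis
      unfolding f'_def[abs_def] by (intro continuous_on_add continuous_on_scaleR continuous_on_const 1 2 3 4)
  qed
  have der: "has_partial v f x (f' v x)" if v: "v \<in> paravec_basis" and x: "x \<in> \<Omega>" for v x
  proof (cases "x \<in> \<real>")
    case False
    have F': "Ck_stem (Suc 0) (D - \<real>) F"
      by (rule Ck_stem_subset[OF _ Diff_subset]) (use F in simp)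
    have x': "x \<in> \<Omega> - \<real>" using x False by simp
    have nz: "norm (Im_part x) \<noteq> 0" using Im_part_nonreal[OF x'] by simp
    have "polar x \<notin> \<real>" using polar_nonreal[OF x'] by simp
    then have H: "H (polar x) = inverse (norm (Im_part x)) *\<^sub>R snd (F (polar x))"
      by (simp add: H_def)
    have u: "inner (Im_part x) (Im_part v) * inverse (norm (Im_part x)) = u v x"
      by (simp add: u_def im_dir_def)
    have u3: "(inner (Im_part x) (Im_part v) * inverse (norm (Im_part x)) ^ 3) *\<^sub>R Im_part x =
        (u v x * inverse (norm (Im_part x))) *\<^sub>R im_dir x"
      by (simp add: u_def im_dir_def power3_eq_cube mult_ac)
    have "f' v x = coord v {} *\<^sub>R sval (im_dir x) (p 1 (polar x), q 1 (polar x)) +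
        u v x *\<^sub>R sval (im_dir x) (p \<i> (polar x), q \<i> (polar x)) +
        (inverse (norm (Im_part x)) *\<^sub>R Im_part v -
          (u v x * inverse (norm (Im_part x))) *\<^sub>R im_dir x) * snd (F (polar x))"
      unfolding f'_def H by (simp add: sval_def algebra_simps)
    then show ?thesis
      using has_partial_slice_function[OF F' induces_polar[OF f] x' v]
      unfolding u u3 p_def[symmetric] q_def[symmetric] by simp
  next
    case True
    have xp: "x \<in> paravectors" using domain_subset[OF x] .
    have D: "polar x \<in> D" and R: "polar x \<in> \<real>"
      using polar_in_profile[OF x] polar_real_iff[OF xp] True by auto
    have Im0: "Im_part x = 0" using paravector_real_iff[OF xp] True by simp
    have dir0: "im_dir x = 0" by (simp add: im_dir_def Im0)
    \<comment> \<open>The line through \<open>x\<close> in direction \<open>v\<close> lies in a single slice.\<close>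
    obtain I w where I: "I \<in> imag_sphere" and w: "w \<in> {1, \<i>}" and vw: "v = phi I w"
      and val: "f' v x = sval I (p w (polar x), q w (polar x))"
    proof (cases "v = 1")
      case True
      show ?thesis
        by (rule that[of "gen undefined" 1])
          (use vanish(3)[OF D R] in \<open>auto simp: True gen_in_imag_sphere phi_alt f'_def dir0 u_def sval_def coord_one q_def\<close>)
    next
      case False
      then obtain j where "v = gen j" using v by (auto simp: paravec_basis_def)
      then show ?thesis
        by (intro that[of "gen j" \<i>])
          (use vanish(2)[OF D R] R in \<open>auto simp: gen_in_imag_sphere phi_alt f'_def dir0 u_def sval_def H_def p_def\<close>)
    qed
    have xI: "x = phi I (polar x)"
      using xp by (simp add: phi_alt paravectors_iff Im0)
    have "has_partial w (\<lambda>z. sval I (F z)) (polar x) (f' v x)"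
      unfolding val p_def q_def by (rule has_partial_sval[of 0 D]) (use F w D in auto)
    moreover have "has_partial w (\<lambda>z. sval I (F z)) (polar x) (f' v x) \<longleftrightarrow>
        has_partial w (\<lambda>z. f (phi I z)) (polar x) (f' v x)"
      by (rule has_partial_cong[OF eventually_on_line[OF open_profile D]])
        (use f I in \<open>simp add: induces_iff\<close>)
    ultimately have "has_partial w (\<lambda>z. f (phi I z)) (polar x) (f' v x)" by simp
    then have "has_partial (phi I w) f (phi I (polar x)) (f' v x)"
      by (simp add: phi_add phi_scaleR)
    then show ?thesis using xI vw by simp
  qed
  have "Ck_on paravec_basis (Suc 0) \<Omega> f"
    by (rule Ck_on_SucI[OF line_open_domain cont_f der]) (use cont_f' in auto)
  then show ?thesis by simp
qed

end

section \<open>Slice monogenic functions are the slice functions with holomorphic stem\<close>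

text \<open>
  Left multiplication by \<open>I\<close> is a complex structure on the algebra. The function below is \<open>k\<close> followed
  by the complex linear functional whose real part is the coordinate at \<open>A\<close>, and the hypothesis on \<open>k\<close>
  is the Cauchy-Riemann equation for this structure.
\<close>

lemma slice_holomorphic_component:
  assumes "open U" "I \<in> imag_sphere" "Ck_complex 1 U k" "\<And>z. z \<in> U \<Longrightarrow> slice_op I k z = 0"
  shows "(\<lambda>z. Complex (coord (k z) A) (- coord (I * k z) A)) holomorphic_on U"
proof (rule dbar_zero_imp_holomorphic[OF assms(1)])
  note o = line_open_if_open[OF assms(1), of "{1, \<i>}"]
  let ?G = "\<lambda>z. Complex (coord (k z) A) (- coord (I * k z) A)"
  have 1: "bounded_linear (\<lambda>x. complex_of_real (coord x A))"
    by (rule bounded_linear_compose[OF bounded_linear_of_real bounded_linear_coord])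
  have 2: "bounded_linear (\<lambda>x. complex_of_real (coord (I * x) A))"
    by (rule bounded_linear_compose[OF 1 bounded_linear_clifford_mult_right])
  have "bounded_linear (\<lambda>x. complex_of_real (coord x A) - \<i> * complex_of_real (coord (I * x) A))"
    by (rule bounded_linear_sub[OF 1 bounded_linear_compose[OF bounded_linear_mult_right 2]])
  moreover have "(\<lambda>x. Complex (coord x A) (- coord (I * x) A)) =
      (\<lambda>x. complex_of_real (coord x A) - \<i> * complex_of_real (coord (I * x) A))"
    by (simp add: fun_eq_iff complex_eq_iff)
  ultimately have L: "bounded_linear (\<lambda>x. Complex (coord x A) (- coord (I * x) A))" by simp
  show "Ck_complex 1 U ?G" by (rule Ck_on_bounded_linear[OF o L assms(3)])
  fix z assume z: "z \<in> U"
  have p: "has_partial v ?G z (Complex (coord (partial v k z) A) (- coord (I * partial v k z) A))"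
    if "v \<in> {1, \<i>}" for v
    by (rule has_partial_bounded_linear[OF L Ck_on_has_partial[where B = "{1, \<i>}" and n = 0 and U = U]])
      (use assms(3) that z in auto)
  define q where "q = partial \<i> k z"
  have "partial 1 k z + I * q = 0" using assms(4)[OF z] by (simp add: q_def)
  then have "partial 1 k z = - (I * q)" by (simp add: eq_neg_iff_add_eq_0)
  then show "dbar ?G z = 0"
    using dbar_eqI[OF p[of 1] p[of \<i>]] imag_sphere_sq_mult[OF assms(2), of q]
    by (simp add: q_def[symmetric] complex_eq_iff)
qed

context circular_domain
begin

text \<open>
  The holomorphic functions of the preceding lemma vanish on the real points of \<open>D\<close>, which accumulate
  in the connected set \<open>D\<close>.
\<close>

lemma slice_identity:
  assumes "I \<in> imag_sphere" "Ck_complex 1 D k" "\<And>z. z \<in> D \<Longrightarrow> slice_op I k z = 0"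
    and "\<And>z. z \<in> D \<Longrightarrow> z \<in> \<real> \<Longrightarrow> k z = 0" and "z \<in> D"
  shows "k z = 0"
proof -
  obtain r where r: "complex_of_real r \<in> D" by (rule real_point)
  have lim: "complex_of_real r islimpt (D \<inter> \<real>)"
    unfolding islimpt_approachable
  proof (intro allI impI)
    fix e :: real assume "e > 0"
    obtain d where d: "d > 0" "\<And>w. dist w (complex_of_real r) < d \<Longrightarrow> w \<in> D"
      using open_profile r unfolding open_dist by blast
    define w where "w = complex_of_real (r + min d e / 2)"
    have "dist w (complex_of_real r) = min d e / 2"
      using d(1) \<open>e > 0\<close> by (simp add: w_def dist_norm norm_divide)
    moreover have "w \<noteq> complex_of_real r"
      using d(1) \<open>e > 0\<close> by (simp add: w_def del: of_real_add)
    ultimately show "\<exists>w\<in>D \<inter> \<real>. w \<noteq> complex_of_real r \<and> dist w (complex_of_real r) < e"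
      using d \<open>e > 0\<close> by (intro bexI[of _ w]) (auto simp: w_def)
  qed
  have "coord (k z) A = 0" for A
  proof -
    have "Complex (coord (k z) A) (- coord (I * k z) A) = 0"
      by (rule analytic_continuation[OF slice_holomorphic_component[OF open_profile assms(1-3)]
            open_profile connected_profile _ r lim _ assms(5)])
        (use assms(4) in \<open>auto simp: complex_eq_iff\<close>)
    then show ?thesis by (simp add: complex_eq_iff)
  qed
  then show ?thesis by (simp add: clifford_eq_iff)
qed

text \<open>
  The direction \<open>I\<close> of a slice is a linear combination of generators, along which \<open>f\<close> has strict
  derivatives.
\<close>

lemma C1_compose_phi:
  fixes f :: "'m clifford \<Rightarrow> 'm clifford"
  assumes "Ck_on paravec_basis 1 \<Omega> f" "I \<in> imag_sphere"
  shows "Ck_complex 1 D (\<lambda>z. f (phi I z))"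
proof -
  have cphi: "continuous_on D (phi I)"
    by (rule bounded_linear.continuous_on[OF bounded_linear_phi continuous_on_id])
  have sub: "phi I ` D \<subseteq> \<Omega>" using phi_in_domain assms(2) by blast
  have c: "continuous_on D (\<lambda>z. g (phi I z))" if "continuous_on \<Omega> g" for g :: "'m clifford \<Rightarrow> 'm clifford"
    using continuous_on_compose2[OF that cphi sub] .
  define f' where "f' w z = (if w = 1 then partial 1 f (phi I z)
      else (\<Sum>j\<in>UNIV. coord I {j} *\<^sub>R partial (gen j) f (phi I z)))" for w z :: complex
  have f: "continuous_on \<Omega> f" "\<And>v. v \<in> paravec_basis \<Longrightarrow> continuous_on \<Omega> (partial v f)"
    using assms(1) by auto
  have gen: "gen j \<in> paravec_basis" for j :: 'm by (simp add: paravec_basis_def)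
  have "Ck_complex (Suc 0) D (\<lambda>z. f (phi I z))"
  proof (rule Ck_on_SucI[OF line_open_if_open[OF open_profile] c[OF f(1)]])
    fix w z assume w: "w \<in> {1, \<i>}" and z: "z \<in> D"
    have x: "phi I z \<in> \<Omega>" using phi_in_domain[OF z assms(2)] .
    have strict: "strict_partial paravectors v f (phi I z) (partial v f (phi I z))"
      if "v \<in> paravec_basis" for v
      by (rule Ck_on_strict_partial[where n = 0, OF subspace_paravectors paravec_basis_subset[OF that] openin x _ that])
        (use assms(1) in auto)
    have "has_partial (phi I w) f (phi I z) (f' w z)"
    proof (cases "w = 1")
      case True
      have "1 \<in> (paravec_basis :: 'm clifford set)" by (simp add: paravec_basis_def)
      then show ?thesis
        using strict_partial_imp_has_partial[OF strict domain_subset[OF x]]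
        by (simp add: True f'_def phi_alt)
    next
      case False
      have "I = (\<Sum>j\<in>UNIV. coord I {j} *\<^sub>R gen j)"
        using assms(2) imag_sphere_iff Im_part_def by metis
      then have "phi I w = (\<Sum>j\<in>UNIV. coord I {j} *\<^sub>R gen j)"
        using False w by (simp add: phi_alt)
      moreover have "strict_partial paravectors (\<Sum>j\<in>UNIV. coord I {j} *\<^sub>R gen j) f (phi I z) (f' w z)"
        unfolding f'_def using False
        by (simp add: strict_partial_sum[OF subspace_paravectors] strict gen paravec_basis_subset)
      ultimately show ?thesis
        using strict_partial_imp_has_partial domain_subset[OF x] by metis
    qed
    then show "has_partial w (\<lambda>z. f (phi I z)) z (f' w z)"
      by (simp add: phi_add phi_scaleR)
  next
    fix w :: complex
    have "continuous_on D (\<lambda>z. partial v f (phi I z))" if "v \<in> paravec_basis" for v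
      using c[OF f(2)[OF that]] .
    then have "continuous_on D (f' w)"
      unfolding f'_def[abs_def] by (cases "w = 1") (auto intro!: continuous_intros simp: paravec_basis_def)
    then show "Ck_complex 0 D (f' w)" by simp
  qed
  then show ?thesis by simp
qed

lemma slice_monogenicD:
  assumes "f \<in> slice_monogenic \<Omega>" "I \<in> imag_sphere" "z \<in> D"
  shows "slice_op I (\<lambda>z. f (phi I z)) z = 0"
proof -
  have "phi I z \<in> \<Omega> \<inter> slice_plane I"
    using phi_in_domain[OF assms(3,2)] by (simp add: slice_plane_def)
  then have "dbar_slice 1 I \<Omega> f (phi I z) = 0"
    using assms(1,2) by (simp add: slice_monogenic_def)
  then show ?thesis
    by (simp add: dbar_slice_def inv_phi[OF assms(2,3)] o_def)
qed

text \<open>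
  The representation formula. The stem function is read off on one slice, and on any other slice it
  gives a solution of the same Cauchy-Riemann system that agrees with the function on the real axis.
\<close>

lemma slice_monogenic_imp_stem:
  assumes "f \<in> slice_monogenic \<Omega>"
  obtains F where "stem_function \<Omega> F" "induces \<Omega> F f" "Ck_stem 1 D F" "\<And>z. z \<in> D \<Longrightarrow> dbar_stem F z = 0"
proof -
  note o = line_open_if_open[OF open_profile, of "{1, \<i>}"]
  define J where "J = (gen undefined :: 'm clifford)"
  have J: "J \<in> imag_sphere" "- J \<in> imag_sphere"
    by (simp_all add: J_def gen_in_imag_sphere imag_sphere_uminus)
  have C1: "Ck_complex 1 D (\<lambda>z. f (phi I z))" if "I \<in> imag_sphere" for I
    by (rule C1_compose_phi[OF _ that]) (use assms in \<open>simp add: slice_monogenic_def Ck_paravec_def\<close>)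
  define F where "F z = ((1 / 2) *\<^sub>R (f (phi J z) + f (phi (- J) z)),
      (- 1 / 2) *\<^sub>R (J * (f (phi J z) - f (phi (- J) z))))" for z
  have stem: "stem_function \<Omega> F"
  proof -
    have "phi (- J) (cnj z) = phi J z" for z by (simp add: phi_alt)
    then show ?thesis
      by (simp add: stem_function_def F_def phi_uminus[symmetric] add.commute algebra_simps)
  qed
  have F1: "Ck_stem 1 D F"
    unfolding F_def fst_conv snd_conv
    by (intro conjI Ck_on_bounded_linear[OF o bounded_linear_scaleR_right]
        Ck_on_bounded_linear[OF o bounded_linear_clifford_mult_right] Ck_on_add[OF o] Ck_on_diff[OF o]
        C1 J)
  have FJ: "f (phi I z) = 1 *\<^sub>R sval I (F z)" if "I \<in> {J, - J}" for I z
  proof -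
    have half: "(1 / 2) *\<^sub>R (a + b) + (1 / 2) *\<^sub>R (a - b) = a"
      "(1 / 2) *\<^sub>R (a + b) - (1 / 2) *\<^sub>R (a - b) = b"
      "(1 / 2) *\<^sub>R (a + b) - (1 / 2) *\<^sub>R (b - a) = a" for a b :: "'m clifford"
      by (simp_all add: algebra_simps scaleR_2[symmetric] flip: scaleR_add_left)
    show ?thesis
      using that half by (auto simp: sval_def F_def imag_sphere_sq_mult[OF J(1)])
  qed
  have F1': "Ck_stem (Suc 0) D F" using F1 by simp
  have dF: "dbar_stem F z = 0" if z: "z \<in> D" for z
  proof (rule sval_zero_imp_zero[OF J(1)])
    have "slice_op J (\<lambda>z. f (phi J z)) z = (2 * 1) *\<^sub>R sval J (dbar_stem F z)"
      by (rule slice_op_sval[OF open_profile J(1) F1' z]) (rule FJ, simp)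
    then show "sval J (dbar_stem F z) = 0" using slice_monogenicD[OF assms J(1) z] by simp
    have "slice_op (- J) (\<lambda>z. f (phi (- J) z)) z = (2 * 1) *\<^sub>R sval (- J) (dbar_stem F z)"
      by (rule slice_op_sval[OF open_profile J(2) F1' z]) (rule FJ, simp)
    then show "sval (- J) (dbar_stem F z) = 0" using slice_monogenicD[OF assms J(2) z] by simp
  qed
  have ind: "induces \<Omega> F f"
    unfolding induces_iff
  proof (intro ballI)
    fix z I assume z: "z \<in> D" and I: "I \<in> (imag_sphere :: 'm clifford set)"
    define k where "k z = f (phi I z) - sval I (F z)" for z
    have F2: "Ck_complex 1 D (\<lambda>z. sval I (F z))"
      unfolding sval_def using F1
      by (intro Ck_on_add[OF o] Ck_on_bounded_linear[OF o bounded_linear_clifford_mult_right]) auto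
    have "k z = 0"
    proof (rule slice_identity[OF I _ _ _ z])
      show "Ck_complex 1 D k"
        unfolding k_def by (rule Ck_on_diff[OF o C1[OF I] F2])
      show "slice_op I k w = 0" if w: "w \<in> D" for w
      proof -
        have pk: "partial v k w = partial v (\<lambda>z. f (phi I z)) w - partial v (\<lambda>z. sval I (F z)) w"
          if "v \<in> {1, \<i>}" for v
          unfolding k_def[abs_def]
          by (rule partialI, rule has_partial_diff;
              rule Ck_on_has_partial[of "{1, \<i>}" 0 D]; use that w C1[OF I] F2 in simp)
        have "slice_op I k w =
            slice_op I (\<lambda>z. f (phi I z)) w - slice_op I (\<lambda>z. sval I (F z)) w"
          using pk[of 1] pk[of \<i>] by (simp add: right_diff_distrib)
        also have "\<dots> = 0"
          using slice_monogenicD[OF assms I w] dF[OF w]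
            slice_op_sval[OF open_profile I F1' w, of "\<lambda>z. sval I (F z)" 1]
          by (simp add: sval_def)
        finally show ?thesis .
      qed
      show "k w = 0" if "w \<in> D" "w \<in> \<real>" for w
      proof -
        obtain r where "w = of_real r" using \<open>w \<in> \<real>\<close> by (auto elim: Reals_cases)
        then show ?thesis by (simp add: k_def sval_def F_def phi_of_real scaleR_2[symmetric])
      qed
    qed
    then show "f (phi I z) = sval I (F z)" by (simp add: k_def)
  qed
  show ?thesis by (rule that[OF stem ind F1 dF])
qed

lemma slice_monogenicI:
  assumes "stem_function \<Omega> F" "induces \<Omega> F f" "Ck_stem 1 D F" "\<And>z. z \<in> D \<Longrightarrow> dbar_stem F z = 0"
  shows "f \<in> slice_monogenic \<Omega>"
proof -
  have "dbar_slice 1 I \<Omega> f x = 0" if I: "I \<in> imag_sphere" and x: "x \<in> \<Omega> \<inter> slice_plane I" for I x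
  proof -
    obtain z where z: "z \<in> D" "x = phi I z" using x slice_eq[OF I] by auto
    show ?thesis
      using dbar_slice_eq[OF assms(2,3) z(1) I] assms(4)[OF z(1)] by (simp add: z(2) sval_def)
  qed
  then show ?thesis
    using C1_slice_function[OF assms(1-3)] by (simp add: slice_monogenic_def Ck_paravec_def)
qed

section \<open>Polymonogenic functions and polyanalytic stem functions\<close>

definition of_components :: "('m set \<Rightarrow> complex) \<Rightarrow> 'm clifford \<times> 'm clifford" where
  "of_components c = (Clifford (\<lambda>A. Re (c A)), Clifford (\<lambda>A. Im (c A)))"

lemma component_of_components [simp]: "component A (of_components c) = c A"
  by (simp add: component_def of_components_def)

text \<open>
  The conjugate of \<open>phi I z\<close> is \<open>phi I (cnj z)\<close>, so multiplication by its powers is multiplication of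
  the components by powers of \<open>cnj z\<close>.
\<close>

lemma polymonogenic_imp_stem:
  assumes "f \<in> slice_polymonogenic n \<Omega>"
  obtains F where "stem_function \<Omega> F" "induces \<Omega> F f" "\<And>k. Ck_stem k D F"
    "\<And>z. z \<in> D \<Longrightarrow> (dbar_stem ^^ n) F z = 0"
proof -
  obtain fs where fs: "\<And>h. h < n \<Longrightarrow> fs h \<in> slice_monogenic \<Omega>"
    "\<And>x. x \<in> \<Omega> \<Longrightarrow> f x = (\<Sum>h<n. conj_paravec x ^ h * fs h x)"
    using assms by (auto simp: slice_polymonogenic_def)
  have "\<exists>F. stem_function \<Omega> F \<and> induces \<Omega> F (fs h) \<and> Ck_stem 1 D F \<and> (\<forall>z\<in>D. dbar_stem F z = 0)"
    if "h < n" for h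
    using slice_monogenic_imp_stem[OF fs(1)[OF that]] by metis
  then obtain G where G: "\<And>h. h < n \<Longrightarrow> stem_function \<Omega> (G h)"
    "\<And>h. h < n \<Longrightarrow> induces \<Omega> (G h) (fs h)" "\<And>h. h < n \<Longrightarrow> Ck_stem 1 D (G h)"
    "\<And>h z. h < n \<Longrightarrow> z \<in> D \<Longrightarrow> dbar_stem (G h) z = 0" by metis
  have hol: "(\<lambda>z. component A (G h z)) holomorphic_on D" if h: "h < n" for A h
  proof (rule dbar_zero_imp_holomorphic[OF open_profile])
    show "Ck_complex 1 D (\<lambda>z. component A (G h z))"
      using G(3)[OF h] Ck_stem_iff_components[OF open_profile] by blast
    show "dbar (\<lambda>z. component A (G h z)) z = 0" if "z \<in> D" for z
      using component_dbar_stem[of 0 D "G h" z A] G(3,4)[OF h] that by simp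
  qed
  define F where "F z = of_components (\<lambda>A. \<Sum>h<n. cnj z ^ h * component A (G h z))" for z
  have C: "Ck_stem k D F" for k
    unfolding Ck_stem_iff_components[OF open_profile] F_def component_of_components
    by (intro allI Ck_on_sum[OF line_open_if_open[OF open_profile]] Ck_cnj_pow
        holomorphic_imp_Ck open_profile hol) simp
  show ?thesis
  proof (rule that[OF _ _ C])
    show "stem_function \<Omega> F"
      unfolding stem_function_iff F_def component_of_components
      using G(1) by (simp add: stem_function_iff)
    show "induces \<Omega> F f"
      unfolding induces_iff
    proof (intro ballI)
      fix z I assume z: "z \<in> D" and I: "I \<in> (imag_sphere :: 'm clifford set)"
      have "f (phi I z) = (\<Sum>h<n. phi I (cnj z ^ h) * sval I (G h z))"
        using fs(2)[OF phi_in_domain[OF z I]] G(2) z I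
        by (simp add: conj_phi phi_power induces_iff)
      also have "\<dots> = (\<Sum>h<n. sval I (of_components (\<lambda>A. cnj z ^ h * component A (G h z))))"
        by (intro sum.cong refl sval_mult[OF I, symmetric]) simp
      also have "\<dots> = sval I (F z)"
        by (rule sval_sum[symmetric]) (simp add: F_def)
      finally show "f (phi I z) = sval I (F z)" .
    qed
    show "(dbar_stem ^^ n) F z = 0" if "z \<in> D" for z
    proof -
      have "component A ((dbar_stem ^^ n) F z) = (dbar ^^ n) (\<lambda>z. \<Sum>h<n. cnj z ^ h * component A (G h z)) z" for A
      proof -
        have "component A ((dbar_stem ^^ n) F z) = (dbar ^^ n) (\<lambda>z. component A (F z)) z"
          by (rule component_dbar_stem_pow[OF open_profile C that])
        also have "(\<lambda>z. component A (F z)) = (\<lambda>z. \<Sum>h<n. cnj z ^ h * component A (G h z))"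
          by (simp add: F_def)
        finally show ?thesis .
      qed
      then have "component A ((dbar_stem ^^ n) F z) = component A 0" for A
        using dbar_pow_polyanalytic[OF open_profile hol that] by simp
      then show ?thesis unfolding component_eq_iff by blast
    qed
  qed
qed

text \<open>
  The components have polyanalytic decompositions. Averaging the coefficients with their
  reflections at the real axis makes them components of stem functions without changing the sum,
  because the components of a stem function are invariant under this reflection.
\<close>

lemma stem_imp_polymonogenic:
  assumes stem: "stem_function \<Omega> F" and f: "induces \<Omega> F f" and F: "Ck_stem N D F"
    and F': "Ck_stem (Suc N) (D - \<real>) F"
    and zero: "\<And>z. z \<in> D - \<real> \<Longrightarrow> (dbar_stem ^^ Suc N) F z = 0"
  shows "f \<in> slice_polymonogenic (Suc N) \<Omega>"
proof -
  have "\<exists>H. (\<forall>h\<le>N. H h holomorphic_on D) \<and> (\<forall>z\<in>D. component A (F z) = (\<Sum>h\<le>N. cnj z ^ h * H h z))" for A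
  proof (rule polyanalytic_decomposition[OF open_profile])
    show "Ck_complex N D (\<lambda>z. component A (F z))"
      using F Ck_stem_iff_components[OF open_profile] by blast
    show "Ck_complex (Suc N) (D - \<real>) (\<lambda>z. component A (F z))"
      using F' Ck_stem_iff_components[OF open_profile_nonreal] by blast
    show "(dbar ^^ Suc N) (\<lambda>z. component A (F z)) z = 0" if "z \<in> D - \<real>" for z
      unfolding component_dbar_stem_pow[OF open_profile_nonreal F' that, symmetric] zero[OF that]
      by simp
  qed
  then obtain H where H: "\<And>A h. h \<le> N \<Longrightarrow> H A h holomorphic_on D"
    "\<And>A z. z \<in> D \<Longrightarrow> component A (F z) = (\<Sum>h\<le>N. cnj z ^ h * H A h z)" by metis
  define K where "K A h z = (H A h z + cnj (H A h (cnj z))) / 2" for A h z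
  have cnjD: "cnj ` D = D"
    using cnj_in_profile complex_cnj_cnj by (metis (no_types, lifting) image_subset_iff subsetI subset_antisym image_eqI)
  have K: "K A h holomorphic_on D" if "h \<le> N" for A h
  proof -
    have "cnj \<circ> H A h \<circ> cnj holomorphic_on D"
      using holomorphic_on_compose_cnj_cnj[of "H A h" D] H(1)[OF that] open_profile cnjD by simp
    then show ?thesis
      unfolding K_def[abs_def] using H(1)[OF that]
      by (intro holomorphic_intros) (auto simp: o_def)
  qed
  have sumK: "component A (F z) = (\<Sum>h\<le>N. cnj z ^ h * K A h z)" if z: "z \<in> D" for A z
  proof -
    have "component A (F z) = cnj (component A (F (cnj z)))"
      using stem z by (simp add: stem_function_iff)
    also have "\<dots> = (\<Sum>h\<le>N. cnj z ^ h * cnj (H A h (cnj z)))"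
      using H(2)[OF cnj_in_profile[OF z]] by simp
    finally have "component A (F z) = ((\<Sum>h\<le>N. cnj z ^ h * H A h z) + (\<Sum>h\<le>N. cnj z ^ h * cnj (H A h (cnj z)))) / 2"
      using H(2)[OF z, of A] by simp
    then show ?thesis
      by (simp add: K_def sum.distrib[symmetric] sum_divide_distrib distrib_left add_divide_distrib)
  qed
  define G where "G h z = of_components (\<lambda>A. K A h z)" for h z
  have stemG: "stem_function \<Omega> (G h)" for h
    by (simp add: stem_function_iff G_def K_def add.commute)
  define fs where "fs h = slice_fun_of \<Omega> (G h)" for h
  have fs: "induces \<Omega> (G h) (fs h)" for h
    unfolding fs_def by (rule induces_slice_fun_of[OF stemG])
  have "fs h \<in> slice_monogenic \<Omega>" if h: "h < Suc N" for h
  proof (rule slice_monogenicI[OF stemG fs])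
    show C: "Ck_stem 1 D (G h)"
      unfolding Ck_stem_iff_components[OF open_profile] G_def component_of_components
      using K h by (intro allI holomorphic_imp_Ck open_profile) auto
    show "dbar_stem (G h) z = 0" if "z \<in> D" for z
    proof -
      have "component A (dbar_stem (G h) z) = component A 0" for A
      proof -
        have "component A (dbar_stem (G h) z) = dbar (\<lambda>w. component A (G h w)) z"
          by (rule component_dbar_stem[of 0 D]) (use C that in auto)
        also have "(\<lambda>w. component A (G h w)) = K A h" by (simp add: G_def)
        also have "dbar (K A h) z = 0" using h by (intro dbar_holomorphic[OF K open_profile that]) simp
        finally show ?thesis by simp
      qed
      then show ?thesis unfolding component_eq_iff by blast
    qed
  qed
  moreover have "f x = (\<Sum>h<Suc N. conj_paravec x ^ h * fs h x)" if x: "x \<in> \<Omega>" for x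
  proof -
    obtain I z where I: "I \<in> imag_sphere" and z: "z \<in> D" and x: "x = phi I z"
      using domain_cases[OF x] .
    have "f x = sval I (F z)" using f I z by (simp add: x induces_iff)
    also have "\<dots> = (\<Sum>h<Suc N. sval I (of_components (\<lambda>A. cnj z ^ h * K A h z)))"
      by (rule sval_sum) (simp add: sumK[OF z] lessThan_Suc_atMost)
    also have "\<dots> = (\<Sum>h<Suc N. phi I (cnj z ^ h) * sval I (G h z))"
      by (intro sum.cong refl sval_mult[OF I]) (simp add: G_def)
    also have "\<dots> = (\<Sum>h<Suc N. conj_paravec x ^ h * fs h x)"
      using fs I z by (simp add: x conj_phi[OF I] phi_power[OF I] induces_iff)
    finally show ?thesis .
  qed
  ultimately show ?thesis by (auto simp: slice_polymonogenic_def)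
qed

end

theorem theorem2p25:
  fixes \<Omega> :: "'m::{finite,linorder} clifford set"
    and f :: "'m clifford \<Rightarrow> 'm clifford"
    and n :: nat
  assumes "CARD('m) \<ge> 2"
    and "\<Omega> \<noteq> {}" and "connected \<Omega>" and "circular \<Omega>"
    and "openin (top_of_set paravectors) \<Omega>"
    and "\<Omega> \<inter> \<real> \<noteq> {}"
    and "n \<ge> 1"
  shows
    "(f \<in> slice_polymonogenic n \<Omega> \<longleftrightarrow>
        f \<in> slice_functions (n - 1) \<Omega> \<and> f \<in> Ck_paravec n (\<Omega> - \<real>) \<and>
        f \<in> ker_theta_bar n (\<Omega> - \<real>)) \<and>
     (f \<in> slice_polymonogenic n \<Omega> \<longleftrightarrow>
        f \<in> slice_functions n \<Omega> \<and>
        (\<forall>I\<in>imag_sphere. \<forall>x\<in>\<Omega> \<inter> slice_plane I. dbar_slice n I \<Omega> f x = 0)) \<and>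
     (f \<in> slice_polymonogenic n \<Omega> \<longleftrightarrow>
        f \<in> slice_functions n \<Omega> \<and> f \<in> ker_theta_bar n (\<Omega> - \<real>)) \<and>
     (f \<in> slice_polymonogenic n \<Omega> \<longleftrightarrow>
        f \<in> slice_functions n \<Omega> \<and> (\<forall>x\<in>\<Omega>. dbar_slice_fun n \<Omega> f x = 0))"
    (is "(?a \<longleftrightarrow> ?b) \<and> (?a \<longleftrightarrow> ?c) \<and> (?a \<longleftrightarrow> ?c') \<and> (?a \<longleftrightarrow> ?c'')")
proof -
  interpret circular_domain \<Omega> using assms by unfold_locales
  obtain N where n: "n = Suc N" using assms(7) by (cases n) auto
  \<comment> \<open>A polymonogenic function has a stem function that is smooth on all of \<open>D\<close> and annihilated by the
    iterated operator there, which gives all four conditions at once.\<close>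
  have forward: "?b \<and> ?c \<and> ?c' \<and> ?c''" if a: ?a
  proof -
    obtain F where F: "stem_function \<Omega> F" "induces \<Omega> F f" "\<And>k. Ck_stem k D F"
      "\<And>z. z \<in> D \<Longrightarrow> (dbar_stem ^^ n) F z = 0"
      using polymonogenic_imp_stem[OF a] by metis
    have slice: "f \<in> slice_functions k \<Omega>" for k
      using F(1-3) by (auto simp: slice_functions_def)
    have Fn: "Ck_stem n (D - \<real>) F"
      by (rule Ck_stem_subset[OF F(3) Diff_subset])
    note polar = induces_polar[OF F(2)]
    have reg: "f \<in> Ck_paravec n (\<Omega> - \<real>)"
      using Ck_slice_function_nonreal[OF Fn polar] by (simp add: Ck_paravec_def)
    moreover have "(theta_bar ^^ n) f x = 0" if "x \<in> \<Omega> - \<real>" for x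
      using theta_bar_pow_slice_function[OF Fn polar that] F(4)[of "polar x"] polar_nonreal[OF that]
      by (simp add: sval_def)
    ultimately have ker: "f \<in> ker_theta_bar n (\<Omega> - \<real>)" by (simp add: ker_theta_bar_def)
    have c: "dbar_slice n I \<Omega> f x = 0" if I: "I \<in> imag_sphere" and x: "x \<in> \<Omega> \<inter> slice_plane I" for I x
      using dbar_slice_eq[OF F(2,3) _ I] F(4) x slice_eq[OF I] by (auto simp: sval_def)
    have "dbar_slice_fun n \<Omega> f x = 0" if "x \<in> \<Omega>" for x
      using domain_cases[OF that] dbar_slice_fun_eq[OF F(1-3)] F(4) by (metis sval_def fst_zero snd_zero mult_zero_right add_0)
    then show ?thesis using slice reg ker c by simp
  qed
  have zeroI: ?a if F: "stem_function \<Omega> F" "induces \<Omega> F f" "Ck_stem n D F"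
    and zero: "\<And>z I. z \<in> D \<Longrightarrow> I \<in> imag_sphere \<Longrightarrow> sval I ((dbar_stem ^^ n) F z) = 0" for F
    unfolding n
  proof (rule stem_imp_polymonogenic[OF F(1,2)])
    show "Ck_stem N D F" using F(3) unfolding n by (rule Ck_stem_SucD)
    show "Ck_stem (Suc N) (D - \<real>) F"
      using Ck_stem_subset[OF F(3) Diff_subset] unfolding n .
    show "(dbar_stem ^^ Suc N) F z = 0" if "z \<in> D - \<real>" for z
      using zero[of z] that gen_in_imag_sphere imag_sphere_uminus[OF gen_in_imag_sphere] unfolding n
      by (intro sval_zero_imp_zero[of "gen undefined"]) auto
  qed
  have c: ?a if h: ?c
  proof -
    obtain F where F: "stem_function \<Omega> F" "induces \<Omega> F f" "Ck_stem n D F"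
      using h by (auto simp: slice_functions_def)
    show ?thesis
    proof (rule zeroI[OF F])
      fix z I assume z: "z \<in> D" and I: "I \<in> (imag_sphere :: 'm clifford set)"
      have "dbar_slice n I \<Omega> f (phi I z) = 0" using h I z slice_eq[OF I] by blast
      then show "sval I ((dbar_stem ^^ n) F z) = 0" using dbar_slice_eq[OF F(2,3) z I] by simp
    qed
  qed
  have c'': ?a if h: ?c''
  proof -
    obtain F where F: "stem_function \<Omega> F" "induces \<Omega> F f" "Ck_stem n D F"
      using h by (auto simp: slice_functions_def)
    show ?thesis
    proof (rule zeroI[OF F])
      fix z I assume z: "z \<in> D" and I: "I \<in> (imag_sphere :: 'm clifford set)"
      have "dbar_slice_fun n \<Omega> f (phi I z) = 0" using h phi_in_domain[OF z I] by blast
      then show "sval I ((dbar_stem ^^ n) F z) = 0" using dbar_slice_fun_eq[OF F z I] by simp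
    qed
  qed
  have b: ?a if h: ?b
  proof -
    obtain F where F: "stem_function \<Omega> F" "induces \<Omega> F f" "Ck_stem N D F"
      using h by (auto simp: slice_functions_def n)
    have Fn: "Ck_stem n (D - \<real>) F"
      by (rule Ck_stem_nonreal[OF F(1,2)]) (use h in \<open>simp add: Ck_paravec_def\<close>)
    \<comment> \<open>In the upper half-plane \<open>im_dir (phi I z)\<close> is \<open>I\<close>, and \<open>I\<close> is arbitrary; the lower half-plane
      follows by the symmetry of the stem function.\<close>
    have upper: "(dbar_stem ^^ n) F z = 0" if z: "z \<in> D" "Im z > 0" for z
    proof (rule sval_zero_imp_zero)
      have "sval I ((dbar_stem ^^ n) F z) = 0" if I: "I \<in> imag_sphere" for I
      proof -
        have x: "phi I z \<in> \<Omega> - \<real>"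
          using phi_in_domain[OF z(1) I] phi_real_iff[OF I] z(2) by (auto simp: complex_is_Real_iff)
        have "(theta_bar ^^ n) f (phi I z) = 0" using h x by (simp add: ker_theta_bar_def)
        then show ?thesis
          using theta_bar_pow_slice_function[OF Fn induces_polar[OF F(2)] x] I z(2)
          by (simp add: im_dir_phi polar_phi)
      qed
      then show "sval (gen undefined) ((dbar_stem ^^ n) F z) = 0"
        "sval (- gen undefined) ((dbar_stem ^^ n) F z) = 0"
        by (simp_all add: gen_in_imag_sphere imag_sphere_uminus)
    qed (rule gen_in_imag_sphere)
    show ?thesis
      unfolding n
    proof (rule stem_imp_polymonogenic[OF F])
      show "Ck_stem (Suc N) (D - \<real>) F" using Fn unfolding n .
      show "(dbar_stem ^^ Suc N) F z = 0" if z: "z \<in> D - \<real>" for z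
      proof (cases "Im z > 0")
        case True
        then show ?thesis using upper[of z] z by (simp only: n) simp
      next
        case False
        have sym: "F (cnj w) = (fst (F w), - snd (F w))" if "w \<in> D - \<real>" for w
          using F(1) that by (simp add: stem_function_reflection)
        have "Im (cnj z) > 0" using False z by (auto simp: complex_is_Real_iff not_less order_less_le)
        then have "(dbar_stem ^^ n) F (cnj z) = 0" using z by (intro upper cnj_in_profile) auto
        then show ?thesis
          using dbar_stem_pow_reflection[OF open_profile_nonreal sym Fn z]
          by (simp only: n) (simp add: prod_eq_iff)
      qed
    qed
  qed
  have "?c' \<Longrightarrow> ?b"
  proof -
    assume c': ?c'
    then have "f \<in> slice_functions N \<Omega>"
      using Ck_on_SucD unfolding slice_functions_def n by blast
    then show ?b using c' by (simp add: n ker_theta_bar_def)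
  qed
  then show ?thesis using forward b c c'' by blast
qed

end
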